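(* Let $0<p<1$ and let $\eta$ be an inner function with $\eta(0)=0$. Then the conditional expectation $\mathbb{E}(\cdot\mid\eta)$ is bounded on $H^p(\mathbb{T})$ if and only if $\eta$ is a finite Blaschke product. Furthermore, for a finite Blaschke product $\eta$ with $\eta(0)=0$, $$\|\mathbb{E}(\cdot\mid\eta)\|_{H^p}=\|\mathbb{E}(\cdot\mid\eta)\|_{L^p}=\|\eta'\|_\infty^{\frac1p-1}.$$
   Context: $\mathbb{T}$ is the unit circle with normalized Lebesgue measure $m$ on the Lebesgue $\sigma$-algebra. For $0<p<\infty$, $\|f\|_p=(\int_{\mathbb T}|f|^p\,dm)^{1/p}$, and $H^p(\mathbb{T})$ is the closure of the analytic polynomials in $L^p(\mathbb{T})$; its elements are identified with analytic functions on the unit disc $\mathbb{D}$ via radial limits. An inner function is a bounded analytic function on $\mathbb{D}$ whose radial limits are unimodular a.e. on $\mathbb{T}$. A finite Blaschke product is a function $\eta(z)=c\prod_{j=1}^k\frac{z-a_j}{1-\overline{a_j}z}$ with $|c|=1$, $k\ge1$, $a_j\in\mathbb{D}$; $\|\eta'\|_\infty=\sup_{w\in\mathbb{T}}|\eta'(w)|$. $\mathbf\Sigma(\eta)$ is the smallest complete (i.e. containing all $m$-null sets) sub $\sigma$-algebra of the Lebesgue $\sigma$-algebra of $\mathbb{T}$ making (the boundary function of) $\eta$ measurable, and $\mathbb{E}(f\mid\eta):=\mathbb{E}(f\mid\mathbf\Sigma(\eta))$ is the conditional expectation of $f\in L^1(\mathbb{T})$. For $0<p<1$, $\mathbb{E}(\cdot\mid\eta)$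 is regarded as an operator densely defined on $H^1(\mathbb{T})\subset H^p(\mathbb{T})$ (respectively on $L^1(\mathbb{T})\subset L^p(\mathbb{T})$). It is bounded on $H^p(\mathbb T)$ if there is $C<\infty$ with $\|\mathbb{E}(f\mid\eta)\|_p\le C\|f\|_p$ for all $f\in H^1(\mathbb{T})$ (equivalently, it extends boundedly to $H^p(\mathbb T)$), and $\|\mathbb{E}(\cdot\mid\eta)\|_{H^p}$ is the least such $C$; $\|\mathbb{E}(\cdot\mid\eta)\|_{L^p}$ is the least $C$ with this inequality for all $f\in L^1(\mathbb{T})$. *)

theory Defs
  imports
    "HOL-Complex_Analysis.Complex_Analysis"
    "HOL-Probability.Probability"
begin

text \<open>Normalized Lebesgue measure on the unit circle: the image under \<open>\<theta> \<mapsto> e\<^sup>i\<^sup>\<theta>\<close> of the uniform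
  distribution on \<open>[0, 2\<pi>]\<close>, completed so that the measurable sets are the Lebesgue ones.\<close>

definition circle_borel_measure :: "complex measure" where
  "circle_borel_measure =
     distr (uniform_measure lborel {0..2 * pi}) (restrict_space borel (sphere 0 1)) cis"

definition circle_measure :: "complex measure" where
  "circle_measure = completion circle_borel_measure"

definition Lp_norm :: "real \<Rightarrow> (complex \<Rightarrow> complex) \<Rightarrow> real" where
  "Lp_norm p f = (LINT z|circle_measure. norm (f z) powr p) powr (1 / p)"

definition Lp_space :: "real \<Rightarrow> (complex \<Rightarrow> complex) set" where
  "Lp_space p = {f \<in> borel_measurable circle_measure.
     integrable circle_measure (\<lambda>z. norm (f z) powr p)}"

definition Hp_space :: "real \<Rightarrow> (complex \<Rightarrow> complex) set" where
  "Hp_space p = {f \<in> Lp_space p. \<forall>e>0. \<exists>P :: complex poly. Lp_norm p (\<lambda>z. f z - poly P z) < e}"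

text \<open>Only the values on the open unit disc of the functions below matter. At points of the circle
  where the radial limit does not exist the boundary function has an arbitrary (constant) value.\<close>

definition boundary_fun :: "(complex \<Rightarrow> complex) \<Rightarrow> complex \<Rightarrow> complex" where
  "boundary_fun \<eta> w = Lim (at_left (1 :: real)) (\<lambda>r. \<eta> (of_real r * w))"

definition inner_function :: "(complex \<Rightarrow> complex) \<Rightarrow> bool" where
  "inner_function \<eta> \<longleftrightarrow>
     \<eta> holomorphic_on ball 0 1 \<and> bounded (\<eta> ` ball 0 1) \<and>
     (AE w in circle_measure. \<exists>l. norm l = 1 \<and> ((\<lambda>r :: real. \<eta> (of_real r * w)) \<longlongrightarrow> l) (at_left 1))"

text \<open>Here a finite Blaschke product is a rational function on the whole plane, so that its
  derivative on the unit circle makes sense.\<close>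

definition finite_blaschke_product :: "(complex \<Rightarrow> complex) \<Rightarrow> bool" where
  "finite_blaschke_product B \<longleftrightarrow>
     (\<exists>c (k :: nat) a. norm c = 1 \<and> k \<ge> 1 \<and> (\<forall>j\<in>{1..k}. a j \<in> ball 0 1) \<and>
        B = (\<lambda>z. c * (\<Prod>j=1..k. (z - a j) / (1 - cnj (a j) * z))))"

definition sup_norm_deriv :: "(complex \<Rightarrow> complex) \<Rightarrow> real" where
  "sup_norm_deriv B = (SUP w\<in>sphere 0 1. norm (deriv B w))"

definition Sigma_alg :: "(complex \<Rightarrow> complex) \<Rightarrow> complex measure" where
  "Sigma_alg \<eta> = sigma (space circle_measure)
     ({boundary_fun \<eta> -` A \<inter> space circle_measure |A. A \<in> sets borel} \<union> null_sets circle_measure)"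

definition cexp :: "(complex \<Rightarrow> complex) \<Rightarrow> (complex \<Rightarrow> complex) \<Rightarrow> complex \<Rightarrow> complex" where
  "cexp \<eta> f z =
     Complex (real_cond_exp circle_measure (Sigma_alg \<eta>) (\<lambda>z. Re (f z)) z)
             (real_cond_exp circle_measure (Sigma_alg \<eta>) (\<lambda>z. Im (f z)) z)"

definition cexp_bound :: "real \<Rightarrow> (complex \<Rightarrow> complex) set \<Rightarrow> (complex \<Rightarrow> complex) \<Rightarrow> real \<Rightarrow> bool" where
  "cexp_bound p X \<eta> C \<longleftrightarrow> (\<forall>f\<in>X. Lp_norm p (cexp \<eta> f) \<le> C * Lp_norm p f)"

definition cexp_bounded_Hp :: "real \<Rightarrow> (complex \<Rightarrow> complex) \<Rightarrow> bool" where
  "cexp_bounded_Hp p \<eta> \<longleftrightarrow> (\<exists>C. cexp_bound p (Hp_space 1) \<eta> C)"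

text \<open>The least bounds, equal to \<open>\<infinity>\<close> if there is no finite bound.\<close>

definition cexp_norm_Hp :: "real \<Rightarrow> (complex \<Rightarrow> complex) \<Rightarrow> ennreal" where
  "cexp_norm_Hp p \<eta> = Inf {ennreal C |C. 0 \<le> C \<and> cexp_bound p (Hp_space 1) \<eta> C}"

definition cexp_norm_Lp :: "real \<Rightarrow> (complex \<Rightarrow> complex) \<Rightarrow> ennreal" where
  "cexp_norm_Lp p \<eta> = Inf {ennreal C |C. 0 \<le> C \<and> cexp_bound p (Lp_space 1) \<eta> C}"

text \<open>The conditional expectation of the library is zero unless the second argument is a
  subalgebra; the following shows that this degenerate case does not occur for inner functions.\<close>

lemma prob_space_circle_measure: "prob_space circle_measure"
proof -
  have c: "cis \<in> measurable (uniform_measure lborel {0..2 * pi}) (restrict_space borel (sphere 0 1))"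
  proof (rule measurable_restrict_space2)
    have "continuous_on UNIV cis" by (intro continuous_intros)
    then have "cis \<in> borel_measurable borel" by (rule borel_measurable_continuous_onI)
    then show "cis \<in> borel_measurable (uniform_measure lborel {0..2 * pi})"
      by (simp cong: measurable_cong_sets)
  qed auto
  have "prob_space (uniform_measure lborel {0..2 * pi})"
    by (rule prob_space_uniform_measure) auto
  then have "prob_space circle_borel_measure"
    unfolding circle_borel_measure_def using c by (rule prob_space.prob_space_distr)
  then show ?thesis
    unfolding circle_measure_def by (rule prob_space.prob_space_completion)
qed

lemma space_circle_measure: "space circle_measure = sphere 0 1"
  by (auto simp: circle_measure_def circle_borel_measure_def space_restrict_space)

lemma null_subset_circle_measure:
  assumes "N \<in> null_sets circle_measure" "A \<subseteq> N"
  shows "A \<in> sets circle_measure"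
  using assms completion.complete2[of A N circle_borel_measure]
  unfolding circle_measure_def by auto

lemma measurable_boundary_fun:
  assumes "inner_function \<eta>"
  shows "boundary_fun \<eta> \<in> borel_measurable circle_measure"
proof -
  let ?M = circle_measure
  let ?r = "\<lambda>n. 1 - 1 / real (n + 2)"
  obtain N where N: "N \<in> null_sets ?M"
    and lim: "\<And>w. w \<in> space ?M - N \<Longrightarrow>
      \<exists>l. norm l = 1 \<and> ((\<lambda>r :: real. \<eta> (of_real r * w)) \<longlongrightarrow> l) (at_left 1)"
    using assms unfolding inner_function_def by (auto elim!: AE_E3)
  let ?g = "\<lambda>w. if w \<in> N then 0 else boundary_fun \<eta> w"
  have mN: "N \<in> sets ?M" using N by auto
  have idm: "(\<lambda>w. w) \<in> measurable ?M (restrict_space borel (sphere 0 1))"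
    unfolding circle_measure_def
    by (rule measurable_completion) (simp add: circle_borel_measure_def measurable_ident_sets)
  have g: "?g \<in> borel_measurable ?M"
  proof (rule borel_measurable_LIMSEQ_metric)
    fix n
    have "continuous_on (sphere 0 1) (\<lambda>w. \<eta> (of_real (?r n) * w))"
    proof (rule continuous_on_compose2[of "ball 0 1" \<eta>])
      show "continuous_on (ball 0 1) \<eta>"
        using assms unfolding inner_function_def by (auto intro: holomorphic_on_imp_continuous_on)
      show "(\<lambda>w :: complex. of_real (?r n) * w) ` sphere 0 1 \<subseteq> ball 0 1"
      proof (rule image_subsetI)
        fix w :: complex assume "w \<in> sphere 0 1"
        then have "norm (of_real (?r n) * w) = \<bar>?r n\<bar>"
          by (simp only: norm_mult norm_of_real) simp
        also have "\<dots> < 1" by (simp add: field_simps abs_if)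
        finally show "of_real (?r n) * w \<in> ball 0 1" by simp
      qed
    qed (intro continuous_intros)
    then have "(\<lambda>w. \<eta> (of_real (?r n) * w)) \<in> borel_measurable (restrict_space borel (sphere 0 1))"
      by (rule borel_measurable_continuous_on_restrict)
    from measurable_compose[OF idm this]
    show "(\<lambda>w. if w \<in> N then 0 else \<eta> (of_real (?r n) * w)) \<in> borel_measurable ?M"
      using mN by (intro measurable_If) auto
  next
    fix w assume w: "w \<in> space ?M"
    have r: "filterlim ?r (at_left 1) sequentially"
      unfolding filterlim_at by (auto; real_asymp)
    show "(\<lambda>n. if w \<in> N then 0 else \<eta> (of_real (?r n) * w)) \<longlonglongrightarrow> ?g w"
    proof (cases "w \<in> N")
      case False
      then obtain l where l: "((\<lambda>r :: real. \<eta> (of_real r * w)) \<longlongrightarrow> l) (at_left 1)"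
        using lim w by blast
      then have "boundary_fun \<eta> w = l"
        unfolding boundary_fun_def by (intro tendsto_Lim) auto
      then show ?thesis using filterlim_compose[OF l r] False by simp
    qed simp
  qed
  show ?thesis
  proof (rule measurableI)
    fix A :: "complex set" assume A: "A \<in> sets borel"
    have eq: "boundary_fun \<eta> -` A \<inter> space ?M =
      ((?g -` A \<inter> space ?M) - N) \<union> (boundary_fun \<eta> -` A \<inter> space ?M \<inter> N)"
      by auto
    have "?g -` A \<inter> space ?M \<in> sets ?M"
      using g A by (rule measurable_sets)
    then have "(?g -` A \<inter> space ?M) - N \<in> sets ?M"
      using mN by (rule sets.Diff)
    moreover have "boundary_fun \<eta> -` A \<inter> space ?M \<inter> N \<in> sets ?M"
      by (rule null_subset_circle_measure[OF N]) auto
    ultimately show "boundary_fun \<eta> -` A \<inter> space ?M \<in> sets ?M"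
      by (subst eq) (rule sets.Un)
  qed simp
qed

lemma finite_measure_subalgebra_Sigma_alg:
  assumes "inner_function \<eta>"
  shows "finite_measure_subalgebra circle_measure (Sigma_alg \<eta>)"
proof -
  interpret prob_space circle_measure by (rule prob_space_circle_measure)
  let ?G = "{boundary_fun \<eta> -` A \<inter> space circle_measure |A. A \<in> sets borel} \<union> null_sets circle_measure"
  have G: "?G \<subseteq> sets circle_measure"
    using measurable_sets[OF measurable_boundary_fun[OF assms]] by auto
  then have "?G \<subseteq> Pow (space circle_measure)"
    using sets.space_closed by (rule subset_trans)
  then have "subalgebra circle_measure (Sigma_alg \<eta>)"
    unfolding subalgebra_def Sigma_alg_def
    using sets.sigma_sets_subset[OF G] by (simp add: space_measure_of_conv)
  then show ?thesis by unfold_locales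
qed

end

theory Submission
  imports Defs
begin

text \<open>Let \<open>f\<^bsub>n,a\<^esub>(z) = n! z\<^sup>n / (1 - cnj a z)\<^sup>n\<^sup>+\<^sup>1\<close>. Integration against its conjugate represents
  \<open>F \<mapsto> F\<^sup>(\<^sup>n\<^sup>)(a)\<close> on bounded analytic functions. Comparing Fourier coefficients, \<open>\<eta>\<close> preserves \<open>\<mu>\<close>, and by the
  chain rule \<open>E(f\<^bsub>n,a\<^esub>|\<eta>)\<close> is a combination of the \<open>f\<^bsub>j,\<eta>(a)\<^esub> \<circ> \<eta>\<close>, \<open>j \<le> n\<close>, with leading coefficient
  \<open>cnj (\<eta>'(a))\<^sup>n\<close>; for \<open>n = 0\<close> this says that \<open>E(P\<^sub>a|\<eta>) = P\<^bsub>\<eta>(a)\<^esub> \<circ> \<eta>\<close> for Poisson kernels.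

  Upper bound: let \<open>M\<close> be the supremum of \<open>\<bar>\<eta>'\<bar>\<close> on the circle. Julia's inequality
  \<open>P\<^sub>a \<le> M P\<^bsub>\<eta>(a)\<^esub> \<circ> \<eta>\<close> gives \<open>\<integral> h P\<^sub>a d\<mu> \<le> M \<integral> E(h|\<eta>) P\<^sub>a d\<mu>\<close> and hence \<open>h \<le> M E(h|\<eta>)\<close> for
  \<open>h \<ge> 0\<close>. Therefore \<open>\<integral> E(h|\<eta>)\<^sup>p d\<mu> = \<integral> E(h|\<eta>)\<^sup>p\<^sup>-\<^sup>1 h d\<mu>\<close> is at most \<open>M\<^sup>1\<^sup>-\<^sup>p \<integral> h\<^sup>p d\<mu>\<close>.

  Lower bound: test on \<open>f\<^bsub>n,a\<^esub>\<close> with \<open>s = (n + 1) p > 1\<close> and \<open>a = r w\<close>, \<open>r \<rightarrow> 1\<close>. Since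
  \<open>\<integral> \<bar>1 - r z\<bar>\<^sup>-\<^sup>s d\<mu>\<close> is asymptotic to a constant times \<open>(1 - r)\<^sup>1\<^sup>-\<^sup>s\<close> and
  \<open>(1 - \<bar>\<eta>(r w)\<bar>) / (1 - r) \<rightarrow> \<bar>\<eta>'(w)\<bar>\<close>, the leading term alone survives and contributes \<open>\<bar>\<eta>'(w)\<bar>\<^sup>1\<^sup>-\<^sup>p\<close>.

  For a general inner function the same test functions yield
  \<open>\<bar>\<eta>'(a)\<bar> \<le> A ((1 - \<bar>\<eta>(a)\<bar>) / (1 - \<bar>a\<bar>))\<^sup>\<beta>\<close> with \<open>\<beta> < 1\<close>. Integrating this differential inequality along
  radii from the circle, where \<open>\<bar>\<eta>\<bar> = 1\<close> almost everywhere, gives \<open>1 - \<bar>\<eta>(z)\<bar> = O(1 - \<bar>z\<bar>)\<close>, so \<open>\<eta>\<close> is a finite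
  Blaschke product.\<close>

section \<open>The circle measure\<close>

text \<open>For \<open>p < 1\<close> neither duality nor the triangle inequality is at hand;
  subadditivity of t^p takes the place of the latter. The Cauchy kernel (\<open>n = 0\<close>) is
  too weak as a test function: the integral of its p-th power stays bounded as the pole approaches
  the circle. Only for \<open>s = (n + 1) p > 1\<close> does the mass concentrate at scale
  \<open>1 - r\<close>, so that the local stretching of \<eta> becomes visible. The leading
  coefficient then contributes the exponent \<open>n p\<close>, the change of scale from
  \<open>1 - r\<close> to \<open>1 - |\<eta>(r w)|\<close> contributes \<open>1 - s\<close>, and the
  sum is \<open>1 - p\<close>. For a general inner function nothing is known about the lower
  coefficients near the circle, so they cannot be removed by a limit. The leading coefficient is
  instead estimated uniformly in all the others, with a constant depending only on n and p. This
  produces \<open>\<beta> = (s - 1) / (n p)\<close>, which is below 1 exactly because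
  \<open>p < 1\<close>; and \<open>\<beta> < 1\<close> makes (1 - r)^(-\<beta>) integrable up to the
  circle.\<close>

abbreviation "\<mu> \<equiv> circle_measure"

interpretation circle: prob_space \<mu>
  by (rule prob_space_circle_measure)

lemma measurable_ident_circle:
  "(\<lambda>w. w) \<in> measurable \<mu> (restrict_space borel (sphere 0 1))"
  unfolding circle_measure_def
  by (rule measurable_completion) (simp add: circle_borel_measure_def measurable_ident_sets)

lemma borel_measurable_ident_circle [measurable]: "(\<lambda>w. w) \<in> borel_measurable \<mu>"
  using measurable_restrict_space3 measurable_ident_circle measurable_restrict_space2_iff by blast

lemma borel_measurable_circle: "f \<in> borel_measurable borel \<Longrightarrow> f \<in> borel_measurable \<mu>"
  using measurable_compose[OF borel_measurable_ident_circle] by auto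

lemma borel_measurable_circle_continuous:
  assumes "continuous_on (sphere 0 1) f"
  shows "f \<in> borel_measurable \<mu>"
  using measurable_compose[OF measurable_ident_circle borel_measurable_continuous_on_restrict[OF assms]] .

lemma borel_measurable_cis [measurable]: "cis \<in> borel_measurable borel"
  by (intro borel_measurable_continuous_onI continuous_intros)

lemma measurable_cis_restrict:
  "cis \<in> measurable borel (restrict_space borel (sphere 0 1))"
  by (rule measurable_restrict_space2) auto

text \<open>Borel measurability on the circle allows the completion to be removed before the image
  measure is unfolded.\<close>

lemma integrable_circle_iff:
  fixes F :: "complex \<Rightarrow> 'b::{banach, second_countable_topology}"
  assumes F: "F \<in> borel_measurable (restrict_space borel (sphere 0 1))"
  shows "integrable \<mu> F \<longleftrightarrow> set_integrable lborel {0..2*pi} (\<lambda>t. F (cis t))"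
    and "(LINT w|\<mu>. F w) = (1 / (2*pi)) *\<^sub>R (LINT t:{0..2*pi}|lborel. F (cis t))"
proof -
  let ?U = "uniform_measure lborel {0..2 * pi}"
  have U: "?U = density lborel (\<lambda>t. ennreal (indicator {0..2*pi} t / (2*pi)))"
    unfolding uniform_measure_def
    by (intro arg_cong[where f = "density lborel"] ext)
       (simp add: divide_ennreal[symmetric] ennreal_indicator indicator_def)
  have c: "cis \<in> measurable ?U (restrict_space borel (sphere 0 1))"
    using measurable_cis_restrict by (simp cong: measurable_cong_sets)
  have Fb: "F \<in> borel_measurable circle_borel_measure"
    using F by (simp add: circle_borel_measure_def)
  have Fc: "(\<lambda>t. F (cis t)) \<in> borel_measurable borel"
    using measurable_compose[OF measurable_cis_restrict F] .
  have "integrable \<mu> F \<longleftrightarrow> integrable ?U (\<lambda>t. F (cis t))"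
    unfolding circle_measure_def integrable_completion[OF Fb]
    unfolding circle_borel_measure_def using c F by (rule integrable_distr_eq)
  also have "\<dots> \<longleftrightarrow> integrable lborel (\<lambda>t. (indicator {0..2*pi} t / (2*pi)) *\<^sub>R F (cis t))"
    unfolding U using Fc by (intro integrable_density) auto
  also have "\<dots> \<longleftrightarrow> integrable lborel (\<lambda>t. (1 / (2*pi)) *\<^sub>R (indicator {0..2*pi} t *\<^sub>R F (cis t)))"
    by (simp add: field_simps)
  also have "\<dots> \<longleftrightarrow> set_integrable lborel {0..2*pi} (\<lambda>t. F (cis t))"
    (is "integrable _ (\<lambda>t. _ *\<^sub>R ?g t) \<longleftrightarrow> _")
    unfolding set_integrable_def
    using integrable_scaleR_right[of "2*pi" lborel "\<lambda>t. (1 / (2*pi)) *\<^sub>R ?g t"]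
      integrable_scaleR_right[of "1 / (2*pi)" lborel ?g] by auto
  finally show "integrable \<mu> F \<longleftrightarrow> set_integrable lborel {0..2*pi} (\<lambda>t. F (cis t))" .
  have "(LINT w|\<mu>. F w) = (LINT t|?U. F (cis t))"
    unfolding circle_measure_def integral_completion[OF Fb]
    unfolding circle_borel_measure_def using c F by (rule integral_distr)
  also have "\<dots> = (LINT t|lborel. (indicator {0..2*pi} t / (2*pi)) *\<^sub>R F (cis t))"
    unfolding U using Fc by (intro integral_density) auto
  also have "\<dots> = (LINT t|lborel. (1 / (2*pi)) *\<^sub>R (indicator {0..2*pi} t *\<^sub>R F (cis t)))"
    by (simp add: field_simps)
  also have "\<dots> = (1 / (2*pi)) *\<^sub>R (LINT t:{0..2*pi}|lborel. F (cis t))"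
    unfolding set_lebesgue_integral_def by (rule integral_scaleR_right) 
  finally show "(LINT w|\<mu>. F w) = (1 / (2*pi)) *\<^sub>R (LINT t:{0..2*pi}|lborel. F (cis t))" .
qed

lemma circle_integral_has_integral:
  fixes F :: "complex \<Rightarrow> 'b::euclidean_space"
  assumes "continuous_on (sphere 0 1) F" "((\<lambda>t. F (cis t)) has_integral I) {0..2*pi}"
  shows "(LINT w|\<mu>. F w) = (1 / (2*pi)) *\<^sub>R I"
proof -
  have F: "F \<in> borel_measurable (restrict_space borel (sphere 0 1))"
    using assms(1) by (rule borel_measurable_continuous_on_restrict)
  have "continuous_on {0..2*pi} (\<lambda>t. F (cis t))"
    by (rule continuous_on_compose2[OF assms(1)]) (auto intro!: continuous_intros)
  then have "set_integrable lborel {0..2*pi} (\<lambda>t. F (cis t))"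
    by (rule borel_integrable_atLeastAtMost')
  from set_borel_integral_eq_integral(2)[OF this] assms(2)
  show ?thesis by (simp add: integrable_circle_iff(2)[OF F] integral_unique)
qed

lemma integrable_circle_continuous:
  fixes f :: "complex \<Rightarrow> 'b::{banach, second_countable_topology}"
  assumes "continuous_on (sphere 0 1) f"
  shows "integrable \<mu> f"
proof -
  have "bounded (f ` sphere 0 1)"
    by (intro compact_imp_bounded compact_continuous_image assms) auto
  then obtain B where "\<forall>w\<in>sphere 0 1. norm (f w) \<le> B" by (auto simp: bounded_iff)
  then show ?thesis
    by (intro circle.integrable_const_bound[where B = B] borel_measurable_circle_continuous assms AE_I2)
       (auto simp: space_circle_measure)
qed

text \<open>A ball missing the full-measure set would carry a continuous bump with zero integral.
  Density later extends estimates proved along almost every radius to every radius.\<close>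

lemma AE_circle_dense:
  assumes P: "AE w in \<mu>. P w" and w0: "w0 \<in> sphere 0 1" and e: "0 < e"
  shows "\<exists>w\<in>sphere 0 1. dist w w0 < e \<and> P w"
proof (rule ccontr)
  assume "\<not> ?thesis"
  then have nP: "\<And>w. w \<in> sphere 0 1 \<Longrightarrow> dist w w0 < e \<Longrightarrow> \<not> P w" by auto
  define F where "F = (\<lambda>w. max 0 (e - dist w w0))"
  have cF: "continuous_on S F" for S unfolding F_def by (intro continuous_intros)
  have ae: "AE w in \<mu>. F w = 0"
    using P AE_space
  proof eventually_elim
    case (elim w)
    then have "\<not> dist w w0 < e" using nP[of w] by (auto simp: space_circle_measure)
    then show ?case by (simp add: F_def)
  qed
  have "(LINT w|\<mu>. F w) = 0"
    using ae by (subst integral_cong_AE[of _ _ "\<lambda>_. 0"])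
      (auto intro!: borel_measurable_circle_continuous cF)
  moreover have cc: "continuous_on {0..2*pi} (\<lambda>t. F (cis t))"
    by (rule continuous_on_compose2[OF cF[of UNIV]]) (auto intro!: continuous_intros)
  then have "(LINT w|\<mu>. F w) = (1 / (2*pi)) *\<^sub>R integral {0..2*pi} (\<lambda>t. F (cis t))"
    by (intro circle_integral_has_integral cF integrable_integral integrable_continuous_real)
  ultimately have "integral {0..2*pi} (\<lambda>t. F (cis t)) = 0" by simp
  then have z: "\<forall>t\<in>{0..2*pi}. F (cis t) = 0"
    using cc by (subst (asm) integral_eq_0_iff) (auto simp: F_def)
  obtain t where "0 \<le> t" "t < 2*pi" "w0 = cis t"
    using w0 complex_unimodular_polar[of w0] by (auto simp: cis.code complex_eq_iff)
  with z have "F w0 = 0" by auto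
  then show False using e by (simp add: F_def)
qed

lemma integrable_times_bounded:
  fixes u g :: "'a \<Rightarrow> 'b::{real_normed_field, banach, second_countable_topology}"
  assumes "u \<in> borel_measurable M" "AE w in M. norm (u w) \<le> B" "integrable M g"
  shows "integrable M (\<lambda>w. u w * g w)"
proof (rule Bochner_Integration.integrable_bound)
  show "integrable M (\<lambda>w. B * norm (g w))" using assms(3) by auto
  show "(\<lambda>w. u w * g w) \<in> borel_measurable M" using assms by auto
  show "AE w in M. norm (u w * g w) \<le> norm (B * norm (g w))"
    using assms(2)
  proof eventually_elim
    case (elim w)
    then have "norm (u w * g w) \<le> B * norm (g w)" by (simp add: norm_mult mult_right_mono)
    then show ?case by simp
  qed
qed

text \<open>The truncations \<open>1 - n * infdist z C\<close> carry statements about continuous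
  test functions to closed sets by dominated convergence.\<close>

lemma closed_indicator_approx:
  fixes C :: "'a::metric_space set"
  assumes C: "closed C" "C \<noteq> {}"
  obtains h :: "nat \<Rightarrow> 'a \<Rightarrow> real" where "\<And>n S. continuous_on S (h n)"
    "\<And>n z. 0 \<le> h n z" "\<And>n z. h n z \<le> 1" "\<And>z. (\<lambda>n. h n z) \<longlonglongrightarrow> indicator C z"
proof -
  define h where "h n z = max 0 (1 - real n * infdist z C)" for n z
  show thesis
  proof (rule that[of h])
    show "continuous_on S (h n)" for n S unfolding h_def by (intro continuous_intros)
    show "0 \<le> h n z" "h n z \<le> 1" for n z unfolding h_def by (auto simp: infdist_nonneg)
    show "(\<lambda>n. h n z) \<longlonglongrightarrow> indicator C z" for z
    proof (cases "z \<in> C")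
      case True then show ?thesis by (simp add: h_def)
    next
      case F: False
      then have d: "0 < infdist z C"
        using in_closed_iff_infdist_zero[OF C] infdist_nonneg[of z C] by (auto simp: less_le)
      obtain N where N: "1 < real N * infdist z C" using reals_Archimedean3[OF d] by auto
      have "h n z = 0" if "N \<le> n" for n
      proof -
        have "real N * infdist z C \<le> real n * infdist z C" using that d by (intro mult_right_mono) auto
        then show ?thesis using N by (simp add: h_def)
      qed
      then have "eventually (\<lambda>n. h n z = 0) sequentially" by (auto simp: eventually_sequentially)
      then have "(\<lambda>n. h n z) \<longlonglongrightarrow> 0" by (rule tendsto_eventually)
      then show ?thesis using F by simp
    qed
  qed
qed

lemma circle_norm_1: "AE w in \<mu>. norm w = 1"
  by (rule AE_I2) (simp add: space_circle_measure)

section \<open>Derivative kernels\<close>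

text \<open>This is the \<open>n\<close>-th derivative of the Szego kernel
  \<open>1 / (1 - cnj a * z)\<close> with respect to \<open>cnj a\<close>, which is why it
  reproduces \<open>n\<close>-th derivatives.\<close>

definition deriv_kernel :: "nat \<Rightarrow> complex \<Rightarrow> complex \<Rightarrow> complex" where
  "deriv_kernel n a z = fact n * z ^ n / (1 - cnj a * z) ^ Suc n"

lemma one_minus_cnj_mult_nonzero:
  assumes "norm a < 1" "norm z \<le> 1"
  shows "1 - cnj a * z \<noteq> 0"
proof
  assume "1 - cnj a * z = 0"
  then have "norm (cnj a * z) = 1" by simp
  moreover have "norm (cnj a * z) \<le> norm a * 1"
    using assms by (simp only: norm_mult complex_mod_cnj) (intro mult_left_mono, auto)
  ultimately show False using assms by simp
qed

lemma continuous_on_deriv_kernel: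
  assumes "norm a < 1" "S \<subseteq> cball 0 1" shows "continuous_on S (deriv_kernel n a)"
  unfolding deriv_kernel_def using assms one_minus_cnj_mult_nonzero[of a]
  by (intro continuous_intros) auto

lemma holomorphic_on_deriv_kernel:
  assumes "norm a < 1" "S \<subseteq> cball 0 1" shows "deriv_kernel n a holomorphic_on S"
  unfolding deriv_kernel_def using assms one_minus_cnj_mult_nonzero[of a]
  by (intro holomorphic_intros) auto

text \<open>On the circle \<open>cnj w = 1 / w\<close>, so the conjugate kernel is the integrand of
  Cauchy's formula; the extra factor \<open>w\<close> is the one in dw = i w dt.\<close>

lemma cnj_deriv_kernel:
  assumes "norm a < 1" "norm w = 1"
  shows "cnj (deriv_kernel n a w) = fact n * w / (w - a) ^ Suc n"
proof -
  have w: "w \<noteq> 0" and c: "cnj w = 1 / w"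
    using assms(2) by (auto simp: divide_conv_cnj)
  have "1 - a * cnj w = (w - a) / w" using w by (simp add: c field_simps)
  then show ?thesis using w by (simp add: deriv_kernel_def c field_simps)
qed

lemma circle_integral_deriv_kernel_continuous:
  assumes "g holomorphic_on ball 0 1" "continuous_on (cball 0 1) g" "norm a < 1"
  shows "(LINT w|\<mu>. g w * cnj (deriv_kernel n a w)) = (deriv ^^ n) g a"
proof -
  let ?I = "(2 * pi * \<i>) / (fact n) * (deriv ^^ n) g a"
  have "((\<lambda>u. g u / (u - a) ^ (Suc n)) has_contour_integral ?I) (part_circlepath 0 1 0 (2*pi))"
    using Cauchy_has_contour_integral_higher_derivative_circlepath[OF assms(2,1), of a n] assms(3)
    by (simp add: circlepath_def)
  then have "((\<lambda>t. g (cis t) / (cis t - a) ^ (Suc n) * \<i> * cis t) has_integral ?I) {0..2*pi}"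
    by (subst (asm) has_contour_integral_part_circlepath_iff) auto
  from has_integral_mult_right[OF this, of "fact n / \<i>"]
  have "((\<lambda>t. g (cis t) * cnj (deriv_kernel n a (cis t))) has_integral (2 * pi) *\<^sub>R (deriv ^^ n) g a) {0..2*pi}"
    using assms(3) by (simp add: cnj_deriv_kernel scaleR_conv_of_real field_simps)
  then have "(LINT w|\<mu>. g w * cnj (deriv_kernel n a w)) = (1 / (2*pi)) *\<^sub>R ((2 * pi) *\<^sub>R (deriv ^^ n) g a)"
    using assms
    by (intro circle_integral_has_integral continuous_intros continuous_on_deriv_kernel
        continuous_on_subset[OF assms(2)]) auto
  then show ?thesis by simp
qed

lemma filterlim_one_minus_at_left: "filterlim (\<lambda>n. 1 - 1 / real (n + 2)) (at_left 1) sequentially"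
  unfolding filterlim_at by (auto; real_asymp)

text \<open>The dilates of \<open>F\<close> by \<open>r < 1\<close> are continuous on the closed
  disc, where Cauchy's formula applies; boundedness of \<open>F\<close> gives the majorant for r ->
  1. Differentiating a dilate \<open>n\<close> times produces the factor \<open>r ^ n\<close>, which
  tends to 1.\<close>

lemma circle_integral_deriv_kernel:
  assumes F: "F holomorphic_on ball 0 1" "bounded (F ` ball 0 1)"
    and Fs: "Fs \<in> borel_measurable \<mu>"
    and lim: "AE w in \<mu>. ((\<lambda>r :: real. F (of_real r * w)) \<longlongrightarrow> Fs w) (at_left 1)"
    and a: "norm a < 1"
  shows "(LINT w|\<mu>. Fs w * cnj (deriv_kernel n a w)) = (deriv ^^ n) F a"
proof -
  define r where "r = (\<lambda>k. 1 - 1 / real (k + 2))"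
  have r: "0 < r k" "r k < 1" for k by (simp_all add: r_def field_simps)
  have r_lim: "filterlim r (at_left 1) sequentially"
    unfolding r_def by (rule filterlim_one_minus_at_left)
  obtain B where B: "\<And>z. norm z < 1 \<Longrightarrow> norm (F z) \<le> B"
    using F(2) unfolding bounded_iff by (metis imageI mem_ball_0)
  have K: "continuous_on (sphere 0 1) (deriv_kernel n a)"
    by (rule continuous_on_deriv_kernel) (use a in auto)
  have in_ball: "of_real (r k) * z \<in> ball 0 1" if "norm z \<le> 1" for k and z :: complex
  proof -
    have "norm (of_real (r k) * z) = r k * norm z"
      using r(1)[of k] by (simp only: norm_mult norm_of_real)
    also have "\<dots> \<le> r k * 1" using r(1)[of k] that by (intro mult_left_mono) auto
    finally show ?thesis using r(2)[of k] by simp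
  qed
  let ?G = "\<lambda>k w. F (of_real (r k) * w)"
  have Gc: "continuous_on (cball 0 1) (?G k)" for k
    by (rule continuous_on_compose2[OF holomorphic_on_imp_continuous_on[OF F(1)]])
       (use in_ball in \<open>auto intro!: continuous_intros\<close>)
  have Gh: "?G k holomorphic_on ball 0 1" for k
    using in_ball by (intro holomorphic_on_compose_gen[OF _ F(1), unfolded o_def] holomorphic_intros) auto
  have eq: "(LINT w|\<mu>. ?G k w * cnj (deriv_kernel n a w)) =
      of_real (r k) ^ n * (deriv ^^ n) F (of_real (r k) * a)" for k
  proof -
    have "(deriv ^^ n) (?G k) a = of_real (r k) ^ n * (deriv ^^ n) F (of_real (r k) * a)"
      by (rule higher_deriv_compose_linear[OF F(1), of "ball 0 1"]) (use in_ball a in auto)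
    then show ?thesis
      using circle_integral_deriv_kernel_continuous[OF Gh Gc a] by metis
  qed
  have "(\<lambda>k. LINT w|\<mu>. ?G k w * cnj (deriv_kernel n a w)) \<longlonglongrightarrow>
      (LINT w|\<mu>. Fs w * cnj (deriv_kernel n a w))"
  proof (rule integral_dominated_convergence)
    have "continuous_on (sphere 0 1) (\<lambda>w. B * norm (deriv_kernel n a w))"
      by (intro continuous_intros K)
    then show "integrable \<mu> (\<lambda>w. B * norm (deriv_kernel n a w))"
      by (rule integrable_circle_continuous)
    show "(\<lambda>w. Fs w * cnj (deriv_kernel n a w)) \<in> borel_measurable \<mu>"
      by (rule borel_measurable_times[OF Fs]) (intro borel_measurable_circle_continuous continuous_intros K)
    show "(\<lambda>w. ?G k w * cnj (deriv_kernel n a w)) \<in> borel_measurable \<mu>" for k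
      by (intro borel_measurable_circle_continuous continuous_intros K continuous_on_subset[OF Gc]) auto
    show "AE w in \<mu>. (\<lambda>k. ?G k w * cnj (deriv_kernel n a w)) \<longlonglongrightarrow> Fs w * cnj (deriv_kernel n a w)"
      using lim
    proof eventually_elim
      case (elim w)
      show ?case by (intro tendsto_mult tendsto_const filterlim_compose[OF elim] r_lim)
    qed
    show "AE w in \<mu>. norm (?G k w * cnj (deriv_kernel n a w)) \<le> B * norm (deriv_kernel n a w)" for k
      using AE_space
    proof eventually_elim
      case (elim w)
      then have "of_real (r k) * w \<in> ball 0 1" using in_ball by (auto simp: space_circle_measure)
      then show ?case using B by (simp add: norm_mult mult_right_mono)
    qed
  qed
  moreover have "(\<lambda>k. of_real (r k) ^ n * (deriv ^^ n) F (of_real (r k) * a)) \<longlonglongrightarrow> 1 ^ n * (deriv ^^ n) F (1 * a)"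
  proof (intro tendsto_mult tendsto_power)
    have "r \<longlonglongrightarrow> 1" using r_lim by (simp add: filterlim_at)
    then show rr: "(\<lambda>k. complex_of_real (r k)) \<longlonglongrightarrow> 1" using tendsto_of_real by fastforce
    have "isCont ((deriv ^^ n) F) (1 * a)"
      using holomorphic_on_imp_continuous_on[OF holomorphic_higher_deriv[OF F(1) open_ball]] a
      by (auto simp: continuous_on_eq_continuous_at)
    then show "(\<lambda>k. (deriv ^^ n) F (of_real (r k) * a)) \<longlonglongrightarrow> (deriv ^^ n) F (1 * a)"
      by (rule isCont_tendsto_compose) (intro tendsto_mult rr tendsto_const)
  qed
  ultimately show ?thesis unfolding eq by (simp add: LIMSEQ_unique)
qed

section \<open>Equality of push-forwards from Fourier coefficients\<close>

lemma borel_measurable_cnj [measurable]: "cnj \<in> borel_measurable borel"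
  by (intro borel_measurable_continuous_onI continuous_intros)

text \<open>Both exponents are free, so multiplying by a monomial stays in the class on the whole
  plane; only on the circle does \<open>unimodular_monomial\<close> reduce a monomial to a single
  power of \<open>z\<close> or of \<open>cnj z\<close>, that is, to one Fourier mode.\<close>

inductive trig_poly :: "(complex \<Rightarrow> complex) \<Rightarrow> bool" where
  monomial: "trig_poly (\<lambda>z. c * z ^ j * cnj z ^ k)"
| add: "trig_poly g \<Longrightarrow> trig_poly h \<Longrightarrow> trig_poly (\<lambda>z. g z + h z)"

lemma trig_poly_times_monomial: "trig_poly h \<Longrightarrow> trig_poly (\<lambda>z. (c * z ^ j * cnj z ^ k) * h z)"
proof (induction rule: trig_poly.induct)
  case (monomial d l m)
  have "(\<lambda>z. (c * z ^ j * cnj z ^ k) * (d * z ^ l * cnj z ^ m)) = (\<lambda>z. (c * d) * z ^ (j + l) * cnj z ^ (k + m))"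
    by (auto simp: power_add)
  then show ?case by (simp only: trig_poly.monomial)
next
  case (add g h)
  then show ?case by (simp only: distrib_left trig_poly.add)
qed

text \<open>Carrying the factor \<open>h\<close> through the induction turns the product case into
  two applications of the induction hypothesis.\<close>

lemma trig_poly_times_real_polynomial_function:
  assumes "real_polynomial_function g" "trig_poly h"
  shows "trig_poly (\<lambda>z. of_real (g z) * h z)"
  using assms
proof (induction arbitrary: h rule: real_polynomial_function.induct)
  case (linear f)
  \<comment> \<open>Every real-linear functional on the plane has the form
    \<open>\<alpha> * z + cnj (\<alpha> * z)\<close>; its values at 1 and at the imaginary unit
    determine \<alpha>.\<close>
  define \<alpha> where "\<alpha> = (of_real (f 1) - \<i> * of_real (f \<i>)) / 2"
  have "complex_of_real (f z) = \<alpha> * z + cnj \<alpha> * cnj z" for z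
  proof -
    have "f z = f (Re z *\<^sub>R 1 + Im z *\<^sub>R \<i>)"
      by (rule arg_cong[where f = f]) (simp add: complex_eq_iff)
    also have "\<dots> = Re z * f 1 + Im z * f \<i>"
      using linear(1) by (simp add: linear_add linear_scale bounded_linear.linear)
    finally show ?thesis by (simp add: \<alpha>_def complex_eq_iff add_divide_distrib[symmetric])
  qed
  then have "(\<lambda>z. of_real (f z) * h z) = (\<lambda>z. (\<alpha> * z ^ 1 * cnj z ^ 0) * h z + (cnj \<alpha> * z ^ 0 * cnj z ^ 1)
      * h z)"
    by (simp only: power_0 power_one_right mult_1_right distrib_right)
  then show ?case by (simp only: trig_poly.add trig_poly_times_monomial linear)
next
  case (const c)
  then show ?case using trig_poly_times_monomial[of h "of_real c" 0 0] by simp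
next
  case (add f g)
  then show ?case by (simp add: distrib_right trig_poly.add)
next
  case (mult f g)
  then show ?case by (simp add: mult.assoc)
qed

lemma trig_poly_of_real_polynomial_function:
  assumes "real_polynomial_function g" shows "trig_poly (\<lambda>z. of_real (g z))"
  using trig_poly_times_real_polynomial_function[OF assms trig_poly.monomial[of 1 0 0]] by simp

lemma continuous_on_trig_poly: "trig_poly h \<Longrightarrow> continuous_on S h"
  by (induction rule: trig_poly.induct) (auto intro!: continuous_intros)

lemma unimodular_monomial:
  fixes z :: complex
  assumes "norm z = 1"
  shows "z ^ j * cnj z ^ k = (if k \<le> j then z ^ (j - k) else cnj z ^ (k - j))"
proof -
  have z: "z ^ m * cnj z ^ m = 1" for m
    using assms by (simp flip: power_mult_distrib add: complex_norm_square[symmetric])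
  show ?thesis
  proof (cases "k \<le> j")
    case True
    then have "z ^ j * cnj z ^ k = z ^ (j - k) * (z ^ k * cnj z ^ k)" by (simp flip: power_add mult.assoc)
    then show ?thesis using z True by simp
  next
    case False
    then have "z ^ j * cnj z ^ k = cnj z ^ (k - j) * (z ^ j * cnj z ^ j)"
      by (simp add: mult.left_commute flip: power_add)
    then show ?thesis using z False by simp
  qed
qed

context
  fixes \<phi> f G :: "complex \<Rightarrow> complex"
  assumes \<phi> [measurable]: "\<phi> \<in> borel_measurable \<mu>"
    and \<phi>_norm: "AE w in \<mu>. norm (\<phi> w) = 1"
    and f: "integrable \<mu> f" and G: "integrable \<mu> G"
    and pos: "\<And>k. (LINT w|\<mu>. \<phi> w ^ k * f w) = (LINT w|\<mu>. w ^ k * G w)"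
    and neg: "\<And>k. (LINT w|\<mu>. cnj (\<phi> w) ^ k * f w) = (LINT w|\<mu>. cnj w ^ k * G w)"
begin

lemma integrable_continuous_comp:
  fixes h :: "complex \<Rightarrow> complex"
  assumes h: "continuous_on UNIV h" and \<psi>: "\<psi> \<in> borel_measurable \<mu>" "AE w in \<mu>. norm (\<psi> w) = 1"
    and g: "integrable \<mu> g"
  shows "integrable \<mu> (\<lambda>w. h (\<psi> w) * g w)"
proof -
  have "bounded (h ` sphere 0 1)"
    by (intro compact_imp_bounded compact_continuous_image continuous_on_subset[OF h]) auto
  then obtain B where B: "\<forall>w\<in>sphere 0 1. norm (h w) \<le> B" by (auto simp: bounded_iff)
  show ?thesis
  proof (rule integrable_times_bounded[OF _ _ g])
    show "(\<lambda>w. h (\<psi> w)) \<in> borel_measurable \<mu>"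
      using measurable_compose[OF \<psi>(1) borel_measurable_continuous_onI[OF h]] .
    show "AE w in \<mu>. norm (h (\<psi> w)) \<le> B"
      using \<psi>(2) by eventually_elim (use B in auto)
  qed
qed

lemma trig_poly_transfer:
  "trig_poly h \<Longrightarrow> (LINT w|\<mu>. h (\<phi> w) * f w) = (LINT w|\<mu>. h w * G w)"
proof (induction rule: trig_poly.induct)
  case (monomial c j k)
  have L: "(LINT w|\<mu>. c * \<phi> w ^ j * cnj (\<phi> w) ^ k * f w) =
      (LINT w|\<mu>. c * ((if k \<le> j then \<phi> w ^ (j - k) else cnj (\<phi> w) ^ (k - j)) * f w))"
  proof (rule integral_cong_AE)
    have [measurable]: "f \<in> borel_measurable \<mu>" using f by auto
    show "(\<lambda>w. c * \<phi> w ^ j * cnj (\<phi> w) ^ k * f w) \<in> borel_measurable \<mu>"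
      "(\<lambda>w. c * ((if k \<le> j then \<phi> w ^ (j - k) else cnj (\<phi> w) ^ (k - j)) * f w)) \<in> borel_measurable \<mu>"
      by measurable
    show "AE w in \<mu>. c * \<phi> w ^ j * cnj (\<phi> w) ^ k * f w =
      c * ((if k \<le> j then \<phi> w ^ (j - k) else cnj (\<phi> w) ^ (k - j)) * f w)"
      using \<phi>_norm by eventually_elim (simp only: unimodular_monomial mult.assoc flip: mult.assoc[of "_ ^
          _" "_ ^ _"])
  qed
  have R: "(LINT w|\<mu>. c * w ^ j * cnj w ^ k * G w) =
      (LINT w|\<mu>. c * ((if k \<le> j then w ^ (j - k) else cnj w ^ (k - j)) * G w))"
  proof (rule integral_cong_AE)
    have [measurable]: "G \<in> borel_measurable \<mu>" using G by auto
    show "(\<lambda>w. c * w ^ j * cnj w ^ k * G w) \<in> borel_measurable \<mu>"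
      "(\<lambda>w. c * ((if k \<le> j then w ^ (j - k) else cnj w ^ (k - j)) * G w)) \<in> borel_measurable \<mu>"
      by measurable
    show "AE w in \<mu>. c * w ^ j * cnj w ^ k * G w =
      c * ((if k \<le> j then w ^ (j - k) else cnj w ^ (k - j)) * G w)"
      using circle_norm_1 by eventually_elim (simp only: unimodular_monomial mult.assoc flip:
          mult.assoc[of "_ ^ _" "_ ^ _"])
  qed
  show ?case unfolding L R
    by (cases "k \<le> j") (simp_all add: pos neg)
next
  case (add g h)
  note c = add(1,2)[THEN continuous_on_trig_poly]
  show ?case
    using add(3,4) integrable_continuous_comp[OF c(1) \<phi> \<phi>_norm f] integrable_continuous_comp[OF c(2) \<phi> \<phi>_norm f]
      integrable_continuous_comp[OF c(1) _ circle_norm_1 G] integrable_continuous_comp[OF c(2) _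
          circle_norm_1 G]
    by (simp add: distrib_right)
qed

lemma continuous_transfer:
  fixes h :: "complex \<Rightarrow> real"
  assumes h: "continuous_on UNIV h"
  shows "(LINT w|\<mu>. of_real (h (\<phi> w)) * f w) = (LINT w|\<mu>. of_real (h w) * G w)"
proof -
  \<comment> \<open>The total mass on both sides: a uniform error \<open>e\<close> in the test
    function changes the difference of the integrals by at most \<open>e * N\<close>. Dividing by
    \<open>N + 1\<close> below also covers \<open>N = 0\<close>.\<close>
  define N where "N = (LINT w|\<mu>. norm (f w)) + (LINT w|\<mu>. norm (G w))"
  let ?L = "LINT w|\<mu>. of_real (h (\<phi> w)) * f w" and ?R = "LINT w|\<mu>. of_real (h w) * G w"
  have hc: "continuous_on UNIV (\<lambda>z. complex_of_real (h z))" using h by (intro continuous_intros)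
  have bound: "norm (?L - ?R) \<le> e * N" if e: "0 < e" for e
  proof -
    obtain g where g: "real_polynomial_function g" "\<And>x. x \<in> sphere 0 1 \<Longrightarrow> \<bar>h x - g x\<bar> < e"
      using Stone_Weierstrass_real_polynomial_function[OF compact_sphere continuous_on_subset[OF h
          subset_UNIV] e]
      by blast
    note t = trig_poly_of_real_polynomial_function[OF g(1)]
    note gc = continuous_on_trig_poly[OF t]
    have diff: "norm ((LINT w|\<mu>. of_real (h (\<psi> w)) * u w) - (LINT w|\<mu>. of_real (g (\<psi> w)) * u w))
        \<le> e * (LINT w|\<mu>. norm (u w))"
      if \<psi>: "\<psi> \<in> borel_measurable \<mu>" "AE w in \<mu>. norm (\<psi> w) = 1"
        and u: "integrable \<mu> u" for \<psi> u :: "complex \<Rightarrow> complex"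
    proof -
      note ih = integrable_continuous_comp[OF hc \<psi> u] and ig = integrable_continuous_comp[OF gc \<psi> u]
      have "norm ((LINT w|\<mu>. of_real (h (\<psi> w)) * u w) - (LINT w|\<mu>. of_real (g (\<psi> w)) * u w))
        = norm (LINT w|\<mu>. of_real (h (\<psi> w)) * u w - of_real (g (\<psi> w)) * u w)"
        using ih ig by simp
      also have "\<dots> \<le> (LINT w|\<mu>. norm (of_real (h (\<psi> w)) * u w - of_real (g (\<psi> w)) * u w))"
        by (rule integral_norm_bound)
      also have "\<dots> \<le> (LINT w|\<mu>. e * norm (u w))"
      proof (rule integral_mono_AE)
        show "AE w in \<mu>. norm (of_real (h (\<psi> w)) * u w - of_real (g (\<psi> w)) * u w) \<le> e * norm (u w)"
          using \<psi>(2)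
        proof eventually_elim
          case (elim w)
          have "of_real (h (\<psi> w)) * u w - of_real (g (\<psi> w)) * u w = of_real (h (\<psi> w) - g (\<psi> w)) * u w"
            by (simp add: algebra_simps)
          then show ?case using g(2)[of "\<psi> w"] elim
            by (simp only: norm_mult norm_of_real) (intro mult_right_mono, auto)
        qed
      qed (use ih ig u in auto)
      finally show ?thesis by simp
    qed
    have eq: "(LINT w|\<mu>. of_real (g (\<phi> w)) * f w) = (LINT w|\<mu>. of_real (g w) * G w)"
      using trig_poly_transfer[OF t] .
    have "?L - ?R = (?L - (LINT w|\<mu>. of_real (g (\<phi> w)) * f w)) -
        (?R - (LINT w|\<mu>. of_real (g w) * G w))"
      using eq by simp
    also have "norm \<dots> \<le> e * (LINT w|\<mu>. norm (f w)) + e * (LINT w|\<mu>. norm (G w))"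
      using diff[OF \<phi> \<phi>_norm f] diff[OF borel_measurable_ident_circle circle_norm_1 G]
      by (intro order.trans[OF norm_triangle_ineq4 add_mono])
    finally show ?thesis by (simp add: N_def distrib_left)
  qed
  have N: "0 \<le> N" unfolding N_def by (intro add_nonneg_nonneg integral_nonneg_AE) auto
  have "norm (?L - ?R) \<le> 0"
  proof (rule field_le_epsilon)
    fix e :: real assume "0 < e"
    have "norm (?L - ?R) \<le> e / (N + 1) * N" using \<open>0 < e\<close> N by (intro bound divide_pos_pos) linarith+
    also have "\<dots> = e * (N / (N + 1))" by simp
    also have "\<dots> \<le> e"
    proof (rule mult_left_le)
      show "N / (N + 1) \<le> 1" using N by (simp add: divide_le_eq)
    qed (use \<open>0 < e\<close> in simp)
    finally show "norm (?L - ?R) \<le> 0 + e" by (simp only: add_0_left)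
  qed
  then show ?thesis by simp
qed

lemma closed_transfer:
  assumes C: "closed C"
  shows "(LINT w:\<phi> -` C \<inter> space \<mu>|\<mu>. f w) = (LINT w:C \<inter> space \<mu>|\<mu>. G w)"
proof (cases "C = {}")
  case False
  obtain h :: "nat \<Rightarrow> complex \<Rightarrow> real" where hc: "\<And>n S. continuous_on S (h n)"
    and hb: "\<And>n z. 0 \<le> h n z" "\<And>n z. h n z \<le> 1" and hl: "\<And>z. (\<lambda>n. h n z) \<longlonglongrightarrow> indicator C z"
    using closed_indicator_approx[OF C False] by blast
  have lim: "(\<lambda>n. LINT w|\<mu>. of_real (h n (\<psi> w)) * u w) \<longlonglongrightarrow>
      (LINT w:\<psi> -` C \<inter> space \<mu>|\<mu>. u w)"
    if \<psi> [measurable]: "\<psi> \<in> borel_measurable \<mu>" and u [measurable]: "integrable \<mu> u"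
    for \<psi> u :: "complex \<Rightarrow> complex"
    unfolding set_lebesgue_integral_def
  proof (rule integral_dominated_convergence)
    have [measurable]: "h n \<in> borel_measurable borel" for n
      by (intro borel_measurable_continuous_onI hc)
    have [measurable]: "C \<in> sets borel" using C by simp
    show "(\<lambda>w. indicator (\<psi> -` C \<inter> space \<mu>) w *\<^sub>R u w) \<in> borel_measurable \<mu>"
      by measurable
    show "(\<lambda>w. complex_of_real (h i (\<psi> w)) * u w) \<in> borel_measurable \<mu>" for i
      by measurable
    show "integrable \<mu> (\<lambda>w. norm (u w))" using u by simp
    show "AE w in \<mu>. (\<lambda>i. of_real (h i (\<psi> w)) * u w) \<longlonglongrightarrow> indicator (\<psi> -` C \<inter> space \<mu>) w *\<^sub>R u w"
      using AE_space
    proof eventually_elim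
      case (elim w)
      then have "indicator (\<psi> -` C \<inter> space \<mu>) w *\<^sub>R u w = of_real (indicator C (\<psi> w)) * u w"
        by (auto simp: indicator_def)
      then show ?case by (simp only:) (intro tendsto_mult tendsto_of_real hl tendsto_const)
    qed
    show "AE w in \<mu>. norm (of_real (h i (\<psi> w)) * u w) \<le> norm (u w)" for i
      using hb by (intro AE_I2) (simp add: norm_mult mult_left_le_one_le)
  qed
  have "(\<lambda>n. LINT w|\<mu>. of_real (h n (\<phi> w)) * f w) \<longlonglongrightarrow>
      (LINT w:C \<inter> space \<mu>|\<mu>. G w)"
    using lim[OF borel_measurable_ident_circle G] unfolding continuous_transfer[OF hc] by simp
  then show ?thesis using lim[OF \<phi> f] LIMSEQ_unique by blast
qed (simp add: set_lebesgue_integral_def)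

text \<open>The push-forward of \<open>f \<mu>\<close> under \<phi> and the complex measure
  \<open>G \<mu>\<close> have equal Fourier coefficients, hence agree. As they are complex-valued,
  uniqueness is proved by induction over disjoint unions from the intersection-stable generator of
  closed sets. With \<open>f = G = 1\<close> this yields measure preservation, with a derivative
  kernel as \<open>f\<close> a conditional expectation.\<close>

lemma circle_transfer:
  assumes S: "S \<in> sets borel"
  shows "(LINT w:\<phi> -` S \<inter> space \<mu>|\<mu>. f w) = (LINT w:S \<inter> space \<mu>|\<mu>. G w)"
proof -
  have sub: "S \<in> sigma_sets UNIV (Collect closed)"
    using S by (simp add: borel_eq_closed sets_measure_of)
  have m1 [measurable]: "\<phi> -` A \<inter> space \<mu> \<in> sets \<mu>" if "A \<in> sets borel" for A
    using that by measurable
  have m2 [measurable]: "A \<inter> space \<mu> \<in> sets \<mu>" if "A \<in> sets borel" for A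
    using measurable_sets[OF borel_measurable_ident_circle that] by (simp add: vimage_def)
  have ii: "set_integrable \<mu> A u" if "A \<in> sets \<mu>" "integrable \<mu> u" 
    for A and u :: "complex \<Rightarrow> complex"
    using that unfolding set_integrable_def by (intro integrable_mult_indicator)
  have int_space: "(LINT w:space \<mu>|\<mu>. u w) = (LINT w|\<mu>. u w)" for u :: "complex \<Rightarrow> complex"
    unfolding set_lebesgue_integral_def by (intro Bochner_Integration.integral_cong) auto
  have sb: "A \<in> sets borel" if "A \<in> sigma_sets UNIV (Collect closed)" for A :: "complex set"
    using that by (simp add: borel_eq_closed sets_measure_of)
  show ?thesis
  proof (rule sigma_sets_induct_disjoint[OF _ _ sub, where P = "\<lambda>S. (LINT w:\<phi> -` S \<inter> space \<mu>|\<mu>. f w) =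
      (LINT w:S \<inter> space \<mu>|\<mu>. G w)"])
    show "Int_stable (Collect closed :: complex set set)" by (auto simp: Int_stable_def)
    fix A :: "complex set" assume "A \<in> sigma_sets UNIV (Collect closed)" 
      and IH: "(LINT w:\<phi> -` A \<inter> space \<mu>|\<mu>. f w) = (LINT w:A \<inter> space \<mu>|\<mu>. G w)"
    then have A: "A \<in> sets borel" using sb by auto
    have "(LINT w|\<mu>. u w) = (LINT w:\<psi> -` A \<inter> space \<mu>|\<mu>. u w) +
        (LINT w:\<psi> -` (UNIV - A) \<inter> space \<mu>|\<mu>. u w)"
      if "\<psi> \<in> borel_measurable \<mu>" "integrable \<mu> u" for \<psi> u :: "complex \<Rightarrow> complex"
    proof -
      have "space \<mu> = (\<psi> -` A \<inter> space \<mu>) \<union> (\<psi> -` (UNIV - A) \<inter> space \<mu>)" by auto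
      then have "(LINT w:space \<mu>|\<mu>. u w) =
          (LINT w:(\<psi> -` A \<inter> space \<mu>) \<union> (\<psi> -` (UNIV - A) \<inter> space \<mu>)|\<mu>. u w)"
        by (rule arg_cong)
      also have "\<dots> = (LINT w:\<psi> -` A \<inter> space \<mu>|\<mu>. u w) +
        (LINT w:\<psi> -` (UNIV - A) \<inter> space \<mu>|\<mu>. u w)"
        using A that(2) by (intro set_integral_Un ii measurable_sets[OF that(1)]) auto
      finally show ?thesis by (simp add: int_space)
    qed
    \<comment> \<open>Equality of the total masses, needed for the complement, is the Fourier
      coefficient of index 0.\<close>
    from this[OF \<phi> f] this[OF borel_measurable_ident_circle G] IH
    show "(LINT w:\<phi> -` (UNIV - A) \<inter> space \<mu>|\<mu>. f w) =
        (LINT w:(UNIV - A) \<inter> space \<mu>|\<mu>. G w)"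
      using pos[of 0] by simp
  next
    fix A :: "nat \<Rightarrow> complex set" assume dis: "disjoint_family A" and "range A \<subseteq> sigma_sets UNIV (Collect
        closed)"
      and IH: "\<And>i. (LINT w:\<phi> -` A i \<inter> space \<mu>|\<mu>. f w) = (LINT w:A i \<inter> space \<mu>|\<mu>. G w)"
    then have A: "A i \<in> sets borel" for i using sb by auto
    have "(LINT w:\<psi> -` (\<Union>i. A i) \<inter> space \<mu>|\<mu>. u w) =
        (\<Sum>i. LINT w:\<psi> -` A i \<inter> space \<mu>|\<mu>. u w)"
      if "\<psi> \<in> borel_measurable \<mu>" "integrable \<mu> u" for \<psi> u :: "complex \<Rightarrow> complex"
    proof -
      have e: "\<psi> -` (\<Union>i. A i) \<inter> space \<mu> = (\<Union>i. \<psi> -` A i \<inter> space \<mu>)" by auto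
      have "(\<Union>i. \<psi> -` A i \<inter> space \<mu>) \<in> sets \<mu>"
        using measurable_sets[OF that(1) A] by (intro sets.countable_UN image_subsetI)
      then show ?thesis
        unfolding e using dis
        by (intro lebesgue_integral_countable_add measurable_sets[OF that(1) A] ii that(2))
          (auto simp: disjoint_family_on_def)
    qed
    from this[OF \<phi> f] this[OF borel_measurable_ident_circle G] IH
    show "(LINT w:\<phi> -` (\<Union>i. A i) \<inter> space \<mu>|\<mu>. f w) =
        (LINT w:(\<Union>i. A i) \<inter> space \<mu>|\<mu>. G w)"
      by simp
  qed (auto intro!: closed_transfer simp: set_lebesgue_integral_def[of _ "{}"])
qed

end

section \<open>Conditional expectation of the derivative kernels\<close>

lemma integral_cnj_commute: "(LINT w|M. cnj (f w)) = cnj (LINT w|M. f w)"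
  by (rule integral_bounded_linear'[OF bounded_linear_cnj bounded_linear_cnj]) simp

lemma inner_function_boundary:
  assumes "inner_function \<eta>"
  shows "AE w in \<mu>. ((\<lambda>r :: real. \<eta> (of_real r * w)) \<longlongrightarrow> boundary_fun \<eta> w) (at_left 1)
    \<and> norm (boundary_fun \<eta> w) = 1"
proof -
  have "AE w in \<mu>. \<exists>l. norm l = 1 \<and> ((\<lambda>r :: real. \<eta> (of_real r * w)) \<longlongrightarrow> l) (at_left 1)"
    using assms by (simp add: inner_function_def)
  then show ?thesis
  proof eventually_elim
    case (elim w)
    then obtain l where l: "norm l = 1" "((\<lambda>r :: real. \<eta> (of_real r * w)) \<longlongrightarrow> l) (at_left 1)" by auto
    then have "boundary_fun \<eta> w = l" unfolding boundary_fun_def by (intro tendsto_Lim) auto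
    then show ?case using l by simp
  qed
qed

lemma deriv_kernel_0_0 [simp]: "deriv_kernel 0 0 z = 1"
  by (simp add: deriv_kernel_def)

lemma borel_measurable_deriv_kernel [measurable]: "deriv_kernel n a \<in> borel_measurable borel"
  unfolding deriv_kernel_def by measurable

lemma integrable_deriv_kernel: "norm a < 1 \<Longrightarrow> integrable \<mu> (deriv_kernel n a)"
  by (intro integrable_circle_continuous continuous_on_deriv_kernel) auto

lemma circle_integral_power: "(LINT w|\<mu>. w ^ k) = (if k = 0 then 1 else (0::complex))"
proof -
  have "(LINT w|\<mu>. w ^ k * cnj (deriv_kernel 0 0 w)) = (deriv ^^ 0) (\<lambda>w. w ^ k) 0"
    by (rule circle_integral_deriv_kernel_continuous) (auto intro!: holomorphic_intros continuous_intros)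
  then show ?thesis by (simp add: power_0_left)
qed

text \<open>Faa di Bruno coefficients: \<open>(F \<circ> \<eta>)\<^sup>(\<^sup>n\<^sup>) = (\<Sum>j\<le>n. faa_di_bruno \<eta> n j \<cdot> F\<^sup>(\<^sup>j\<^sup>) \<circ> \<eta>)\<close>.\<close>

primrec faa_di_bruno :: "(complex \<Rightarrow> complex) \<Rightarrow> nat \<Rightarrow> nat \<Rightarrow> complex \<Rightarrow> complex" where
  "faa_di_bruno \<eta> 0 = (\<lambda>j a. if j = 0 then 1 else 0)"
| "faa_di_bruno \<eta> (Suc n) = (\<lambda>j a. deriv (faa_di_bruno \<eta> n j) a +
     deriv \<eta> a * (case j of 0 \<Rightarrow> 0 | Suc i \<Rightarrow> faa_di_bruno \<eta> n i a))"

lemma faa_di_bruno_eq_0: "n < j \<Longrightarrow> faa_di_bruno \<eta> n j = (\<lambda>a. 0)"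
  by (induction n arbitrary: j) (auto split: nat.split)

lemma faa_di_bruno_top: "faa_di_bruno \<eta> n n a = deriv \<eta> a ^ n"
  by (induction n) (auto simp: faa_di_bruno_eq_0)

lemma holomorphic_on_faa_di_bruno:
  assumes "\<eta> holomorphic_on S" "open S"
  shows "faa_di_bruno \<eta> n j holomorphic_on S"
proof (induction n arbitrary: j)
  case (Suc n)
  show ?case using assms
    by (cases j) (auto intro!: holomorphic_intros Suc)
qed auto

lemma higher_deriv_comp:
  assumes \<eta>: "\<eta> holomorphic_on S" "open S" and F: "F holomorphic_on UNIV" and a: "a \<in> S"
  shows "(deriv ^^ n) (\<lambda>z. F (\<eta> z)) a = (\<Sum>j\<le>n. faa_di_bruno \<eta> n j a * (deriv ^^ j) F (\<eta> a))"
  using a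
proof (induction n arbitrary: a)
  case (Suc n)
  let ?C = "faa_di_bruno \<eta> n"
  have d\<eta>: "(\<eta> has_field_derivative deriv \<eta> a) (at a)"
    using holomorphic_derivI[OF \<eta> Suc.prems] .
  have dC: "(?C j has_field_derivative deriv (?C j) a) (at a)" for j
    using holomorphic_derivI[OF holomorphic_on_faa_di_bruno[OF \<eta>] \<eta>(2) Suc.prems] .
  have dF: "((\<lambda>z. (deriv ^^ j) F (\<eta> z)) has_field_derivative (deriv ^^ Suc j) F (\<eta> a) * deriv \<eta> a) (at a)" for j
  proof (rule DERIV_chain2[OF _ d\<eta>])
    show "((deriv ^^ j) F has_field_derivative (deriv ^^ Suc j) F (\<eta> a)) (at (\<eta> a))"
      using holomorphic_derivI[OF holomorphic_higher_deriv[OF F open_UNIV] open_UNIV] by simp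
  qed
  have "((\<lambda>z. \<Sum>j\<le>n. ?C j z * (deriv ^^ j) F (\<eta> z)) has_field_derivative
      (\<Sum>j\<le>n. deriv (?C j) a * (deriv ^^ j) F (\<eta> a) + (deriv ^^ Suc j) F (\<eta> a) * deriv \<eta> a * ?C j a)) (at a)"
    by (intro DERIV_sum DERIV_mult dC dF)
  then have "((deriv ^^ n) (\<lambda>z. F (\<eta> z)) has_field_derivative
      (\<Sum>j\<le>n. deriv (?C j) a * (deriv ^^ j) F (\<eta> a) + (deriv ^^ Suc j) F (\<eta> a) * deriv \<eta> a * ?C j a)) (at a)"
    by (rule has_field_derivative_transform_within_open[OF _ \<eta>(2) Suc.prems]) (simp add: Suc.IH)
  then have "(deriv ^^ Suc n) (\<lambda>z. F (\<eta> z)) a =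
      (\<Sum>j\<le>n. deriv (?C j) a * (deriv ^^ j) F (\<eta> a)) + (\<Sum>j\<le>n. deriv \<eta> a * ?C j a * (deriv ^^ Suc j) F (\<eta> a))"
    by (simp add: DERIV_imp_deriv sum.distrib mult_ac)
  also have "(\<Sum>j\<le>n. deriv \<eta> a * ?C j a * (deriv ^^ Suc j) F (\<eta> a)) =
      (\<Sum>j\<le>Suc n. deriv \<eta> a * (case j of 0 \<Rightarrow> 0 | Suc i \<Rightarrow> ?C i a) * (deriv ^^ j) F (\<eta> a))"
    by (subst sum.atMost_Suc_shift) simp
  also have "(\<Sum>j\<le>n. deriv (?C j) a * (deriv ^^ j) F (\<eta> a)) = (\<Sum>j\<le>Suc n. deriv (?C j) a * (deriv ^^ j) F (\<eta> a))"
    by (simp add: faa_di_bruno_eq_0)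
  finally show ?case by (simp only: sum.distrib[symmetric] faa_di_bruno.simps distrib_right)
qed (auto)

section \<open>Measure preservation and conditional expectation for an inner function fixing
  0\<close>

context
  fixes \<eta> :: "complex \<Rightarrow> complex"
  assumes inner: "inner_function \<eta>" and \<eta>0: "\<eta> 0 = 0"
begin

lemma inner_holomorphic: "\<eta> holomorphic_on ball 0 1" and inner_bounded: "bounded (\<eta> ` ball 0 1)"
  using inner by (auto simp: inner_function_def)

lemma boundary_measurable [measurable]: "boundary_fun \<eta> \<in> borel_measurable \<mu>"
  by (rule measurable_boundary_fun[OF inner])

lemma boundary_norm: "AE w in \<mu>. norm (boundary_fun \<eta> w) = 1"
  using inner_function_boundary[OF inner] by eventually_elim auto

lemma integral_boundary_power_kernel:
  assumes "norm a < 1"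
  shows "(LINT w|\<mu>. boundary_fun \<eta> w ^ k * cnj (deriv_kernel n a w)) = (deriv ^^ n) (\<lambda>z. \<eta> z ^ k) a"
proof (rule circle_integral_deriv_kernel[OF _ _ _ _ assms])
  show "(\<lambda>z. \<eta> z ^ k) holomorphic_on ball 0 1" by (intro holomorphic_intros inner_holomorphic)
  obtain B where "\<forall>z\<in>ball 0 1. norm (\<eta> z) \<le> B" using inner_bounded by (auto simp: bounded_iff)
  then have "\<forall>z\<in>ball 0 1. norm (\<eta> z ^ k) \<le> B ^ k" by (auto simp: norm_power intro!: power_mono)
  then show "bounded ((\<lambda>z. \<eta> z ^ k) ` ball 0 1)" by (auto simp: bounded_iff)
  show "(\<lambda>w. boundary_fun \<eta> w ^ k) \<in> borel_measurable \<mu>" by measurable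
  show "AE w in \<mu>. ((\<lambda>r :: real. \<eta> (of_real r * w) ^ k) \<longlongrightarrow> boundary_fun \<eta> w ^ k) (at_left 1)"
    using inner_function_boundary[OF inner] by eventually_elim (auto intro!: tendsto_intros)
qed

text \<open>The definition of an inner function only provides some bound on the disc. Representing
  \<open>\<eta> a ^ k\<close> by its boundary values bounds all its powers by the same L^1 norm of a
  kernel, so the modulus is at most 1; equality at an interior point would make \<eta> constant,
  against \<open>\<eta> 0 = 0\<close>.\<close>

lemma inner_norm_less_1:
  assumes "norm z < 1" shows "norm (\<eta> z) < 1"
proof -
  have le: "norm (\<eta> a) \<le> 1" if a: "norm a < 1" for a
  proof (rule ccontr)
    assume "\<not> norm (\<eta> a) \<le> 1"
    then obtain k where k: "(LINT w|\<mu>. norm (deriv_kernel 0 a w)) < norm (\<eta> a) ^ k"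
      using real_arch_pow by (metis not_le)
    have "norm (\<eta> a) ^ k = norm (LINT w|\<mu>. boundary_fun \<eta> w ^ k * cnj (deriv_kernel 0 a w))"
      by (simp add: integral_boundary_power_kernel[OF a] norm_power)
    also have "\<dots> \<le> (LINT w|\<mu>. norm (boundary_fun \<eta> w ^ k * cnj (deriv_kernel 0 a w)))"
      by (rule integral_norm_bound)
    also have "\<dots> = (LINT w|\<mu>. norm (deriv_kernel 0 a w))"
    proof (rule integral_cong_AE)
      have [measurable]: "deriv_kernel 0 a \<in> borel_measurable \<mu>"
        by (intro borel_measurable_circle) measurable
      show "(\<lambda>w. norm (boundary_fun \<eta> w ^ k * cnj (deriv_kernel 0 a w))) \<in> borel_measurable \<mu>"
        "(\<lambda>w. norm (deriv_kernel 0 a w)) \<in> borel_measurable \<mu>" by measurable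
      show "AE w in \<mu>. norm (boundary_fun \<eta> w ^ k * cnj (deriv_kernel 0 a w)) = norm (deriv_kernel 0 a w)"
        using boundary_norm by eventually_elim (simp add: norm_mult norm_power)
    qed
    finally show False using k by simp
  qed
  show ?thesis
  proof (rule ccontr)
    assume "\<not> norm (\<eta> z) < 1"
    with le[OF assms] have 1: "norm (\<eta> z) = 1" by simp
    have "\<eta> constant_on ball 0 1"
      by (rule maximum_modulus_principle[OF inner_holomorphic _ _ open_ball order_refl, of z])
         (use assms le 1 in auto)
    then have "\<eta> z = \<eta> 0" using assms by (auto simp: constant_on_def)
    with 1 \<eta>0 show False by simp
  qed
qed

text \<open>The moments of the boundary function are \<open>\<eta> 0 ^ k\<close>, which vanish for
  \<open>k > 0\<close> exactly as those of the identity do; moments of negative index are their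
  conjugates.\<close>

lemma inner_transfer:
  fixes H :: "complex \<Rightarrow> 'b::{banach, second_countable_topology}"
  assumes "H \<in> borel_measurable borel"
  shows "(LINT w|\<mu>. H (boundary_fun \<eta> w)) = (LINT w|\<mu>. H w)"
    and "integrable \<mu> (\<lambda>w. H (boundary_fun \<eta> w)) \<longleftrightarrow> integrable \<mu> H"
proof -
  have p: "(LINT w|\<mu>. boundary_fun \<eta> w ^ k * 1) = (LINT w|\<mu>. w ^ k * 1)" for k
    using integral_boundary_power_kernel[of 0 k 0] \<eta>0 by (auto simp: circle_integral_power)
  have n: "(LINT w|\<mu>. cnj (boundary_fun \<eta> w) ^ k * 1) = (LINT w|\<mu>. cnj w ^ k * 1)" for k
    using p[of k, THEN arg_cong, of cnj] by (simp flip: integral_cnj_commute)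
  have "distr \<mu> borel (boundary_fun \<eta>) = distr \<mu> borel (\<lambda>w. w)"
  proof (rule measure_eqI)
    fix S :: "complex set" assume "S \<in> sets (distr \<mu> borel (boundary_fun \<eta>))"
    then have S: "S \<in> sets borel" by simp
    have m: "boundary_fun \<eta> -` S \<inter> space \<mu> \<in> sets \<mu>"
      "S \<inter> space \<mu> \<in> sets \<mu>"
      using measurable_sets[OF boundary_measurable S] measurable_sets[OF borel_measurable_ident_circle S]
      by (simp_all add: vimage_def)
    have "(LINT w:boundary_fun \<eta> -` S \<inter> space \<mu>|\<mu>. 1) =
        (LINT w:S \<inter> space \<mu>|\<mu>. 1 :: complex)"
      by (rule circle_transfer[OF boundary_measurable boundary_norm _ _ p n S]) auto
    then have "measure \<mu> (boundary_fun \<eta> -` S \<inter> space \<mu>) = measure \<mu> (S \<inter> space \<mu>)"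
      using m by (simp add: set_lebesgue_integral_def scaleR_conv_of_real)
    then show "emeasure (distr \<mu> borel (boundary_fun \<eta>)) S = emeasure (distr \<mu> borel (\<lambda>w. w)) S"
      using S by (simp add: emeasure_distr circle.emeasure_eq_measure vimage_def)
  qed simp
  then show "(LINT w|\<mu>. H (boundary_fun \<eta> w)) = (LINT w|\<mu>. H w)"
    "integrable \<mu> (\<lambda>w. H (boundary_fun \<eta> w)) \<longleftrightarrow> integrable \<mu> H"
    using integral_distr[OF boundary_measurable assms] integral_distr[OF borel_measurable_ident_circle assms]
      integrable_distr_eq[OF boundary_measurable assms] integrable_distr_eq[OF
          borel_measurable_ident_circle assms]
    by auto
qed

lemma subalg_Sigma_alg: "sigma_finite_subalgebra \<mu> (Sigma_alg \<eta>)"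
proof -
  interpret finite_measure_subalgebra \<mu> "Sigma_alg \<eta>"
    by (rule finite_measure_subalgebra_Sigma_alg[OF inner])
  show ?thesis by unfold_locales
qed

lemma boundary_Sigma_alg: "boundary_fun \<eta> \<in> borel_measurable (Sigma_alg \<eta>)"
proof (rule measurableI)
  let ?G = "{boundary_fun \<eta> -` A \<inter> space \<mu> |A. A \<in> sets borel} \<union> null_sets \<mu>"
  have G: "?G \<subseteq> Pow (space \<mu>)"
    using sets.sets_into_space by (fastforce dest: null_setsD2)
  fix A :: "complex set" assume "A \<in> sets borel"
  then show "boundary_fun \<eta> -` A \<inter> space (Sigma_alg \<eta>) \<in> sets (Sigma_alg \<eta>)"
    using G by (auto simp: Sigma_alg_def space_measure_of_conv)
qed simp

text \<open>Null sets among the generators are matched with the empty set; the almost everywhere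
  quantifier then passes through complements and countable unions.\<close>

lemma sets_Sigma_algD:
  assumes "A \<in> sets (Sigma_alg \<eta>)"
  shows "\<exists>S\<in>sets borel. AE w in \<mu>. w \<in> A \<longleftrightarrow> boundary_fun \<eta> w \<in> S"
proof -
  let ?G = "{boundary_fun \<eta> -` A \<inter> space \<mu> |A. A \<in> sets borel} \<union> null_sets \<mu>"
  have G: "?G \<subseteq> Pow (space \<mu>)"
    using sets.sets_into_space by (fastforce dest: null_setsD2)
  then have "A \<in> sigma_sets (space \<mu>) ?G"
    using assms by (simp add: Sigma_alg_def sets_measure_of)
  then show ?thesis
  proof (induction rule: sigma_sets.induct)
    case (Basic A)
    then show ?case
    proof
      assume "A \<in> null_sets \<mu>"
      then show ?thesis by (intro bexI[of _ "{}"]) (auto dest: AE_not_in)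
    qed (use AE_space in \<open>auto intro!: bexI elim!: eventually_mono\<close>)
  next
    case Empty
    then show ?case by (intro bexI[of _ "{}"]) auto
  next
    case (Compl A)
    then obtain S where S: "S \<in> sets borel" "AE w in \<mu>. w \<in> A \<longleftrightarrow> boundary_fun \<eta> w \<in> S" by auto
    show ?case
    proof
      show "AE w in \<mu>. w \<in> space \<mu> - A \<longleftrightarrow> boundary_fun \<eta> w \<in> - S"
        using S(2) AE_space by eventually_elim auto
    qed (use S(1) in auto)
  next
    case (Union A)
    then obtain S where S: "\<And>i. S i \<in> sets borel" "\<And>i. AE w in \<mu>. w \<in> A i \<longleftrightarrow> boundary_fun \<eta> w \<in> S i" by metis
    then have "AE w in \<mu>. \<forall>i. w \<in> A i \<longleftrightarrow> boundary_fun \<eta> w \<in> S i" by (simp add: AE_all_countable)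
    then have "AE w in \<mu>. w \<in> (\<Union>i. A i) \<longleftrightarrow> boundary_fun \<eta> w \<in> (\<Union>i. S i)"
      by eventually_elim auto
    then show ?case using S(1) by (intro bexI[of _ "\<Union>i. S i"]) auto
  qed
qed

text \<open>Measure preservation rewrites the integral of \<open>G\<close> over \<open>S\<close> as
  that of the composition with the boundary function over the preimage of \<open>S\<close>.
  Identifying a conditional expectation thus becomes an equality of complex measures on Borel sets,
  as supplied by \<open>circle_transfer\<close>.\<close>

lemma cexp_eqI:
  assumes f: "integrable \<mu> f" and G: "integrable \<mu> G" "G \<in> borel_measurable borel"
    and eq: "\<And>S. S \<in> sets borel \<Longrightarrow>
      (LINT w:boundary_fun \<eta> -` S \<inter> space \<mu>|\<mu>. f w) = (LINT w:S \<inter> space \<mu>|\<mu>. G w)"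
  shows "AE w in \<mu>. cexp \<eta> f w = G (boundary_fun \<eta> w)"
proof -
  interpret sigma_finite_subalgebra \<mu> "Sigma_alg \<eta>" by (rule subalg_Sigma_alg)
  let ?H = "\<lambda>w. G (boundary_fun \<eta> w)"
  have H: "integrable \<mu> ?H" using G inner_transfer(2)[of G] by simp
  have HS: "?H \<in> borel_measurable (Sigma_alg \<eta>)"
    using measurable_compose[OF boundary_Sigma_alg G(2)] .
  have main: "(LINT w:A|\<mu>. f w) = (LINT w:A|\<mu>. ?H w)" if A: "A \<in> sets (Sigma_alg \<eta>)" for A
  proof -
    have Am: "A \<in> sets \<mu>" using A subalg by (auto simp: subalgebra_def)
    obtain S where S: "S \<in> sets borel" "AE w in \<mu>. w \<in> A \<longleftrightarrow> boundary_fun \<eta> w \<in> S"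
      using sets_Sigma_algD[OF A] by auto
    have pm: "boundary_fun \<eta> -` S \<inter> space \<mu> \<in> sets \<mu>"
      using measurable_sets[OF boundary_measurable S(1)] .
    have ae: "AE w in \<mu>. w \<in> A \<longleftrightarrow> w \<in> boundary_fun \<eta> -` S \<inter> space \<mu>"
      using S(2) AE_space by eventually_elim auto
    have "(LINT w:A|\<mu>. f w) = (LINT w:boundary_fun \<eta> -` S \<inter> space \<mu>|\<mu>. f w)"
      using ae Am pm f by (intro set_integral_cong_set) (auto simp: set_borel_measurable_def)
    also have "\<dots> = (LINT w:S \<inter> space \<mu>|\<mu>. G w)" by (rule eq[OF S(1)])
    also have "\<dots> = (LINT w|\<mu>. indicator S w *\<^sub>R G w)"
      unfolding set_lebesgue_integral_def by (intro Bochner_Integration.integral_cong) (auto simp: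
          indicator_def)
    also have "\<dots> = (LINT w|\<mu>. indicator S (boundary_fun \<eta> w) *\<^sub>R ?H w)"
      using S(1) G(2) by (subst inner_transfer(1)[symmetric]) auto
    also have "\<dots> = (LINT w:boundary_fun \<eta> -` S \<inter> space \<mu>|\<mu>. ?H w)"
      unfolding set_lebesgue_integral_def by (intro Bochner_Integration.integral_cong) (auto simp:
          indicator_def)
    also have "\<dots> = (LINT w:A|\<mu>. ?H w)"
      using ae Am pm H by (intro set_integral_cong_set) (auto simp: set_borel_measurable_def)
    finally show ?thesis .
  qed
  have si: "set_integrable \<mu> A u" if "A \<in> sets (Sigma_alg \<eta>)" "integrable \<mu> u" for A and u :: "complex \<Rightarrow>
      complex"
    using that subalg unfolding set_integrable_def by (intro integrable_mult_indicator) (auto simp: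
        subalgebra_def)
  have re: "(LINT w:A|\<mu>. Re (u w)) = Re (LINT w:A|\<mu>. u w)"
    and im: "(LINT w:A|\<mu>. Im (u w)) = Im (LINT w:A|\<mu>. u w)"
    if "A \<in> sets (Sigma_alg \<eta>)" "integrable \<mu> u" for A and u :: "complex \<Rightarrow> complex"
    using si[OF that] unfolding set_lebesgue_integral_def set_integrable_def
    by (simp_all flip: integral_Re integral_Im)
  have "AE w in \<mu>. real_cond_exp \<mu> (Sigma_alg \<eta>) (\<lambda>w. Re (f w)) w = Re (?H w)"
    using f H HS by (intro real_cond_exp_charact) (auto simp: re main)
  moreover have "AE w in \<mu>. real_cond_exp \<mu> (Sigma_alg \<eta>) (\<lambda>w. Im (f w)) w = Im (?H w)"
    using f H HS by (intro real_cond_exp_charact) (auto simp: im main)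
  ultimately show ?thesis
    by eventually_elim (simp add: cexp_def)
qed

lemma cexp_deriv_kernel:
  assumes a: "norm a < 1"
  shows "AE w in \<mu>. cexp \<eta> (deriv_kernel n a) w =
    (\<Sum>j\<le>n. cnj (faa_di_bruno \<eta> n j a) * deriv_kernel j (\<eta> a) (boundary_fun \<eta> w))"
proof -
  let ?G = "\<lambda>w. \<Sum>j\<le>n. cnj (faa_di_bruno \<eta> n j a) * deriv_kernel j (\<eta> a) w"
  have b: "norm (\<eta> a) < 1" by (rule inner_norm_less_1[OF a])
  have Gc: "continuous_on (sphere 0 1) ?G"
    by (intro continuous_intros continuous_on_deriv_kernel b) auto
  have G: "integrable \<mu> ?G" by (rule integrable_circle_continuous[OF Gc])
  have Gm: "?G \<in> borel_measurable borel" by measurable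
  \<comment> \<open>Both sides reproduce the \<open>n\<close>-th derivative of
    \<open>\<eta> z ^ k\<close> at \<open>a\<close>: the left one directly, the right one through
    the chain rule with outer function \<open>z ^ k\<close>. Conjugation then gives the Fourier
    coefficients of one sign.\<close>
  have neg': "(LINT w|\<mu>. boundary_fun \<eta> w ^ k * cnj (deriv_kernel n a w)) =
      (LINT w|\<mu>. w ^ k * cnj (?G w))" for k
  proof -
    have w: "(LINT w|\<mu>. w ^ k * cnj (deriv_kernel j (\<eta> a) w)) = (deriv ^^ j) (\<lambda>z. z ^ k) (\<eta> a)" for j
      by (rule circle_integral_deriv_kernel_continuous) (auto intro!: holomorphic_intros continuous_intros b)
    have wi: "integrable \<mu> (\<lambda>w. w ^ k * cnj (deriv_kernel j (\<eta> a) w))" for j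
      by (intro integrable_circle_continuous continuous_intros continuous_on_deriv_kernel b) auto
    have "(LINT w|\<mu>. w ^ k * cnj (?G w)) =
        (LINT w|\<mu>. (\<Sum>j\<le>n. faa_di_bruno \<eta> n j a * (w ^ k * cnj (deriv_kernel j (\<eta> a) w))))"
      by (simp add: sum_distrib_left mult_ac)
    also have "\<dots> = (\<Sum>j\<le>n. faa_di_bruno \<eta> n j a * (deriv ^^ j) (\<lambda>z. z ^ k) (\<eta> a))"
      using wi by (subst Bochner_Integration.integral_sum) (auto simp: w)
    also have "\<dots> = (deriv ^^ n) (\<lambda>z. \<eta> z ^ k) a"
      using a by (intro higher_deriv_comp[OF inner_holomorphic, symmetric]) (auto intro!: holomorphic_intros)
    finally show ?thesis by (simp add: integral_boundary_power_kernel[OF a])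
  qed
  have neg: "(LINT w|\<mu>. cnj (boundary_fun \<eta> w) ^ k * deriv_kernel n a w) =
      (LINT w|\<mu>. cnj w ^ k * ?G w)" for k
    using neg'[of k, THEN arg_cong, of cnj] by (simp flip: integral_cnj_commute del: cnj_sum)
  \<comment> \<open>For \<open>k > 0\<close> both integrands are boundary values of bounded analytic
    functions, whose means are their values at 0; these vanish because of
    \<open>\<eta> 0 = 0\<close> and the factor \<open>w ^ k\<close>. The mean is obtained by pairing
    with \<open>deriv_kernel 0 0\<close>, which is 1.\<close>
  have pos: "(LINT w|\<mu>. boundary_fun \<eta> w ^ k * deriv_kernel n a w) =
      (LINT w|\<mu>. w ^ k * ?G w)" for k
  proof (cases "k = 0")
    case True then show ?thesis using neg[of 0] by simp
  next
    case False
    obtain B where B: "\<forall>z\<in>ball 0 1. norm (\<eta> z) \<le> B" using inner_bounded by (auto simp: bounded_iff)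
    have "bounded (deriv_kernel n a ` cball 0 1)"
      by (intro compact_imp_bounded compact_continuous_image continuous_on_deriv_kernel a) auto
    then obtain D where D: "\<forall>z\<in>cball 0 1. norm (deriv_kernel n a z) \<le> D" by (auto simp: bounded_iff)
    have "(LINT w|\<mu>. (boundary_fun \<eta> w ^ k * deriv_kernel n a w) * cnj (deriv_kernel 0 0 w)) =
        (deriv ^^ 0) (\<lambda>z. \<eta> z ^ k * deriv_kernel n a z) 0"
    proof (rule circle_integral_deriv_kernel)
      show "(\<lambda>z. \<eta> z ^ k * deriv_kernel n a z) holomorphic_on ball 0 1"
        by (intro holomorphic_intros inner_holomorphic holomorphic_on_deriv_kernel a) auto
      have "norm (\<eta> z ^ k * deriv_kernel n a z) \<le> B ^ k * D" if "z \<in> ball 0 1" for z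
        unfolding norm_mult norm_power using B D that order.trans[OF norm_ge_zero B[rule_format, OF that]]
        by (intro mult_mono power_mono zero_le_power) auto
      then show "bounded ((\<lambda>z. \<eta> z ^ k * deriv_kernel n a z) ` ball 0 1)"
        unfolding bounded_iff by (intro exI[of _ "B ^ k * D"]) auto
      show "(\<lambda>w. boundary_fun \<eta> w ^ k * deriv_kernel n a w) \<in> borel_measurable \<mu>"
        using borel_measurable_circle[OF borel_measurable_deriv_kernel] by measurable
      show "AE w in \<mu>. ((\<lambda>r :: real. \<eta> (of_real r * w) ^ k * deriv_kernel n a (of_real r * w)) \<longlongrightarrow>
          boundary_fun \<eta> w ^ k * deriv_kernel n a w) (at_left 1)"
        using inner_function_boundary[OF inner] AE_space
      proof eventually_elim
        case (elim w)
        then have w: "norm w = 1" by (simp add: space_circle_measure)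
        have "((\<lambda>r :: real. of_real r * w) \<longlongrightarrow> of_real 1 * w) (at_left 1)" by (intro tendsto_intros)
        moreover have "1 - cnj a * w \<noteq> 0" using one_minus_cnj_mult_nonzero[OF a, of w] w by simp
        ultimately have "((\<lambda>r :: real. deriv_kernel n a (of_real r * w)) \<longlongrightarrow> deriv_kernel n a w) (at_left 1)"
          unfolding deriv_kernel_def by (intro tendsto_intros) auto
        then show ?case using elim by (auto intro!: tendsto_intros)
      qed
    qed auto
    moreover have "(LINT w|\<mu>. (w ^ k * ?G w) * cnj (deriv_kernel 0 0 w)) =
        (deriv ^^ 0) (\<lambda>w. w ^ k * ?G w) 0"
      by (rule circle_integral_deriv_kernel_continuous)
        (auto intro!: holomorphic_intros continuous_intros holomorphic_on_deriv_kernel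
            continuous_on_deriv_kernel b)
    ultimately show ?thesis using False \<eta>0 by simp
  qed
  show ?thesis
    by (rule cexp_eqI[OF integrable_deriv_kernel[OF a] G Gm
        circle_transfer[OF boundary_measurable boundary_norm integrable_deriv_kernel[OF a] G pos neg]])
qed

end

section \<open>Poisson kernels\<close>

lemma continuous_on_sphere_bounded:
  fixes h :: "complex \<Rightarrow> 'a::real_normed_vector"
  assumes "continuous_on (sphere 0 1) h"
  obtains B where "\<And>z. norm z = 1 \<Longrightarrow> norm (h z) \<le> B"
proof -
  have "bounded (h ` sphere 0 1)"
    by (intro compact_imp_bounded compact_continuous_image assms) auto
  then show thesis using that unfolding bounded_iff by (metis imageI mem_sphere_0)
qed

definition poisson :: "complex \<Rightarrow> complex \<Rightarrow> real" where
  "poisson a w = (1 - (norm a)\<^sup>2) / (norm (w - a))\<^sup>2"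

lemma borel_measurable_poisson [measurable]: "poisson a \<in> borel_measurable borel"
  unfolding poisson_def by measurable

lemma poisson_nonneg: "norm a < 1 \<Longrightarrow> 0 \<le> poisson a w"
  by (simp add: poisson_def abs_square_le_1)

lemma continuous_on_poisson: "norm a < 1 \<Longrightarrow> continuous_on (sphere 0 1) (poisson a)"
  unfolding poisson_def by (intro continuous_intros) auto

lemma poisson_le:
  assumes "norm a < 1" "norm w = 1" "0 < d" "d \<le> norm (w - a)"
  shows "poisson a w \<le> (1 - (norm a)\<^sup>2) / d\<^sup>2"
  unfolding poisson_def using assms
  by (intro divide_left_mono power_mono mult_pos_pos zero_less_power) (auto simp: abs_square_le_1)

lemma poisson_bounded:
  assumes "norm a < 1" "norm w = 1"
  shows "norm (poisson a w) \<le> (1 - (norm a)\<^sup>2) / (1 - norm a)\<^sup>2"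
  using poisson_le[OF assms, of "1 - norm a"] norm_triangle_ineq2[of w a] assms poisson_nonneg[OF
      assms(1), of w]
  by simp

lemma norm_diff_unimodular:
  assumes "norm w = 1"
  shows "norm (w - a) = norm (1 - cnj a * w)"
proof -
  have "norm (w - a) = norm (cnj w * (w - a))" using assms by (simp add: norm_mult)
  also have "cnj w * (w - a) = cnj (1 - cnj a * w)"
    using assms by (simp add: algebra_simps complex_norm_square[symmetric])
  finally show ?thesis by (simp only: complex_mod_cnj)
qed

lemma poisson_eq_deriv_kernel:
  assumes "norm a < 1" "norm w = 1"
  shows "poisson a w = 2 * Re (deriv_kernel 0 a w) - 1"
proof -
  let ?z = "cnj a * w"
  have nz: "1 - ?z \<noteq> 0" using one_minus_cnj_mult_nonzero[of a w] assms by simp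
  have n1: "norm (w - a) = norm (1 - ?z)" by (rule norm_diff_unimodular[OF assms(2)])
  have n2: "norm a = norm ?z" using assms by (simp add: norm_mult)
  have "Re (1 / (1 - ?z)) = Re (1 - ?z) / (norm (1 - ?z))\<^sup>2" by (simp add: Re_divide cmod_power2)
  then have "2 * Re (deriv_kernel 0 a w) - 1 = (2 * Re (1 - ?z) - (norm (1 - ?z))\<^sup>2) / (norm (1 - ?z))\<^sup>2"
    using nz by (simp add: deriv_kernel_def diff_divide_distrib)
  also have "2 * Re (1 - ?z) - (norm (1 - ?z))\<^sup>2 = 1 - (norm ?z)\<^sup>2"
    unfolding cmod_power2 by (simp add: power2_eq_square algebra_simps)
  finally show ?thesis unfolding poisson_def n1 n2 by simp
qed

lemma integrable_poisson: "norm a < 1 \<Longrightarrow> integrable \<mu> (poisson a)"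
  by (intro integrable_circle_continuous continuous_on_poisson)

lemma poisson_integral: 
  assumes "norm a < 1" shows "(LINT w|\<mu>. poisson a w) = 1"
proof -
  have "(LINT w|\<mu>. 1 * cnj (deriv_kernel 0 a w)) = (deriv ^^ 0) (\<lambda>_. 1) a"
    by (rule circle_integral_deriv_kernel_continuous) (use assms in auto)
  then have "Re (LINT w|\<mu>. deriv_kernel 0 a w) = 1"
    by (simp add: integral_cnj_commute complex_eq_iff)
  then have 1: "(LINT w|\<mu>. Re (deriv_kernel 0 a w)) = 1"
    using integrable_deriv_kernel[OF assms] by simp
  have "(LINT w|\<mu>. poisson a w) = (LINT w|\<mu>. 2 * Re (deriv_kernel 0 a w) - 1)"
    using assms by (intro Bochner_Integration.integral_cong) (auto simp: poisson_eq_deriv_kernel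
        space_circle_measure)
  also have "\<dots> = 2 * (LINT w|\<mu>. Re (deriv_kernel 0 a w)) - 1"
    using integrable_deriv_kernel[OF assms] circle.prob_space by simp
  finally show ?thesis using 1 by simp
qed

text \<open>This symmetry lets Fubini's theorem move the Poisson smoothing from a test function to
  the function it is integrated against.\<close>

lemma poisson_symmetric:
  assumes "norm w = 1" "norm z = 1"
  shows "poisson (of_real r * w) z = poisson (of_real r * z) w"
proof -
  have "norm (z - of_real r * w) = norm (1 - cnj (of_real r * w) * z)"
    by (rule norm_diff_unimodular[OF assms(2)])
  also have "\<dots> = norm (cnj (1 - cnj (of_real r * w) * z))" by (simp only: complex_mod_cnj)
  also have "cnj (1 - cnj (of_real r * w) * z) = 1 - cnj (of_real r * z) * w" by simp
  also have "norm \<dots> = norm (w - of_real r * z)" by (rule norm_diff_unimodular[OF assms(1), symmetric])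
  finally have "norm (z - of_real r * w) = norm (w - of_real r * z)" .
  then show ?thesis using assms by (simp add: poisson_def norm_mult)
qed

lemma poisson_approximates:
  fixes h :: "complex \<Rightarrow> real"
  assumes h: "continuous_on UNIV h" and w: "norm w = 1"
    and r: "\<And>k. 0 < r k" "\<And>k. r k < 1" "r \<longlonglongrightarrow> 1"
  shows "(\<lambda>k. LINT z|\<mu>. h z * poisson (of_real (r k) * w) z) \<longlonglongrightarrow> h w"
proof (rule LIMSEQ_I)
  fix e :: real assume e: "0 < e"
  have nr: "norm (of_real (r k) * w) = r k" for k using r(1)[of k] w by (simp add: norm_mult)
  obtain B where B: "\<And>z. norm z = 1 \<Longrightarrow> \<bar>h z\<bar> \<le> B"
    using continuous_on_sphere_bounded[OF continuous_on_subset[OF h subset_UNIV]] by (auto simp del: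
        real_norm_def simp flip: real_norm_def)
  have B0: "0 \<le> B" using B[OF w] by linarith
  have "isCont h w" using h by (auto simp: continuous_on_eq_continuous_at)
  then obtain d where d: "0 < d" "\<And>z. dist z w < d \<Longrightarrow> \<bar>h z - h w\<bar> < e / 2"
    using e unfolding continuous_at_eps_delta by (metis half_gt_zero dist_real_def)
  have "(\<lambda>k. 1 - (r k)\<^sup>2) \<longlonglongrightarrow> 1 - 1\<^sup>2" by (intro tendsto_intros r)
  then have "(\<lambda>k. 2 * B * ((1 - (r k)\<^sup>2) / (d / 2)\<^sup>2)) \<longlonglongrightarrow> 2 * B * ((1 - 1\<^sup>2) / (d / 2)\<^sup>2)"
    using d(1) by (intro tendsto_intros r(3)) auto
  then have "eventually (\<lambda>k. 2 * B * ((1 - (r k)\<^sup>2) / (d / 2)\<^sup>2) < e / 2) sequentially"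
    using e by (intro order_tendstoD(2)) auto
  moreover have "eventually (\<lambda>k. 1 - d / 2 < r k) sequentially"
    using r(3) d(1) by (intro order_tendstoD(1)) auto
  ultimately have "eventually (\<lambda>k. norm ((LINT z|\<mu>. h z * poisson (of_real (r k) * w) z) - h w) < e)
      sequentially"
  proof eventually_elim
    case (elim k)
    let ?P = "poisson (of_real (r k) * w)"
    have n: "norm (of_real (r k) * w) < 1" using nr r(2) by simp
    have i1: "integrable \<mu> (\<lambda>z. h z * ?P z)"
      by (intro integrable_circle_continuous continuous_on_mult continuous_on_poisson n
          continuous_on_subset[OF h]) auto
    have i2: "integrable \<mu> (\<lambda>z. (h z - h w) * ?P z)"
      by (intro integrable_circle_continuous continuous_intros continuous_on_poisson n
          continuous_on_subset[OF h]) auto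
    have "(LINT z|\<mu>. h z * ?P z) - h w = (LINT z|\<mu>. h z * ?P z) - (LINT z|\<mu>. h w * ?P z)"
      using poisson_integral[OF n] by simp
    also have "\<dots> = (LINT z|\<mu>. (h z - h w) * ?P z)"
      using i1 integrable_poisson[OF n] by (subst Bochner_Integration.integral_diff[symmetric]) (auto
          simp: algebra_simps)
    also have "norm \<dots> \<le> (LINT z|\<mu>. norm ((h z - h w) * ?P z))" by (rule integral_norm_bound)
    \<comment> \<open>Within distance \<open>d\<close> of \<open>w\<close> the oscillation of
      \<open>h\<close> is below \<open>e / 2\<close>. A point farther away is still at distance
      \<open>d / 2\<close> from the pole \<open>r k * w\<close>, as \<open>1 - r k < d / 2\<close>,
      and there the kernel is uniformly small.\<close>
    also have "\<dots> \<le> (LINT z|\<mu>. e / 2 * ?P z + 2 * B * ((1 - (r k)\<^sup>2) / (d / 2)\<^sup>2))"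
    proof (rule integral_mono)
      fix z assume "z \<in> space \<mu>"
      then have z: "norm z = 1" by (simp add: space_circle_measure)
      have P0: "0 \<le> ?P z" by (rule poisson_nonneg[OF n])
      have r1: "(r k)\<^sup>2 \<le> 1" using r(1,2)[of k] by (simp add: power_le_one)
      show "norm ((h z - h w) * ?P z) \<le> e / 2 * ?P z + 2 * B * ((1 - (r k)\<^sup>2) / (d / 2)\<^sup>2)"
      proof (cases "dist z w < d")
        case True
        have "\<bar>h z - h w\<bar> * ?P z \<le> e / 2 * ?P z"
          using d(2)[OF True] P0 by (intro mult_right_mono) auto
        then have "norm ((h z - h w) * ?P z) \<le> e / 2 * ?P z"
          using P0 by (simp only: real_norm_def abs_mult abs_of_nonneg)
        moreover have "0 \<le> 2 * B * ((1 - (r k)\<^sup>2) / (d / 2)\<^sup>2)" using B0 r1 by simp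
        ultimately show ?thesis by linarith
      next
        case False
        have "norm (z - w) \<le> norm (z - of_real (r k) * w) + norm (of_real (r k) * w - w)"
          using norm_triangle_ineq[of "z - of_real (r k) * w" "of_real (r k) * w - w"] by simp
        also have "norm (of_real (r k) * w - w) = 1 - r k"
        proof -
          have "of_real (r k) * w - w = of_real (r k - 1) * w" by (simp add: algebra_simps)
          then show ?thesis using w r(2)[of k] by (simp only: norm_mult norm_of_real) simp
        qed
        finally have "d / 2 \<le> norm (z - of_real (r k) * w)" using False elim(2) by (simp add: dist_norm)
        then have "?P z \<le> (1 - (r k)\<^sup>2) / (d / 2)\<^sup>2"
          using poisson_le[OF n z, of "d / 2"] d(1) by (simp only: nr)
        moreover have "\<bar>h z - h w\<bar> \<le> 2 * B" using B[OF z] B[OF w] by linarith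
        ultimately have "norm ((h z - h w) * ?P z) \<le> 2 * B * ((1 - (r k)\<^sup>2) / (d / 2)\<^sup>2)"
          using P0 B0 unfolding real_norm_def abs_mult by (intro mult_mono) auto
        moreover have "0 \<le> e / 2 * ?P z" using e P0 by simp
        ultimately show ?thesis by linarith
      qed
    qed (use i2 integrable_poisson[OF n] in auto)
    also have "\<dots> = e / 2 + 2 * B * ((1 - (r k)\<^sup>2) / (d / 2)\<^sup>2)"
      using integrable_poisson[OF n] poisson_integral[OF n] circle.prob_space by simp
    also have "\<dots> < e" using elim(1) by simp
    finally show ?case .
  qed
  then show "\<exists>no. \<forall>k\<ge>no. norm ((LINT z|\<mu>. h z * poisson (of_real (r k) * w) z) - h w) < e"
    by (simp add: eventually_sequentially)
qed

interpretation circle2: pair_sigma_finite \<mu> \<mu> ..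

text \<open>The Poisson smoothings \<open>?Q k\<close> converge boundedly to \<open>h\<close>. By
  Fubini and \<open>poisson_symmetric\<close>, integrating \<open>u\<close> against such a smoothing
  is the same as integrating \<open>h\<close> against the Poisson extension of \<open>u\<close> on a
  smaller circle, which is nonnegative by assumption.\<close>

lemma poisson_positive_continuous:
  fixes u h :: "complex \<Rightarrow> real"
  assumes u: "integrable \<mu> u"
    and P: "\<And>a. norm a < 1 \<Longrightarrow> 0 \<le> (LINT w|\<mu>. u w * poisson a w)"
    and h: "continuous_on UNIV h" "\<And>z. 0 \<le> h z"
  shows "0 \<le> (LINT w|\<mu>. u w * h w)"
proof -
  define r where "r = (\<lambda>k. 1 - 1 / real (k + 2))"
  have r: "0 < r k" "r k < 1" for k by (simp_all add: r_def field_simps)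
  have r1: "r \<longlonglongrightarrow> 1" unfolding r_def using filterlim_one_minus_at_left by (simp add: filterlim_at)
  have um [measurable]: "u \<in> borel_measurable \<mu>" using u by auto
  have hm [measurable]: "h \<in> borel_measurable borel" by (rule borel_measurable_continuous_onI[OF h(1)])
  obtain B where B: "\<And>z. norm z = 1 \<Longrightarrow> h z \<le> B"
    using continuous_on_sphere_bounded[OF continuous_on_subset[OF h(1) subset_UNIV]] h(2) by (metis
        abs_of_nonneg real_norm_def)
  let ?Q = "\<lambda>k w. LINT z|\<mu>. h z * poisson (of_real (r k) * w) z"
  have nr: "norm (of_real (r k) * w) = r k" if "norm w = 1" for k and w :: complex
    using r(1)[of k] that by (simp add: norm_mult)
  have Q: "0 \<le> ?Q k w" "?Q k w \<le> B" if w: "norm w = 1" for k w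
  proof -
    have n: "norm (of_real (r k) * w) < 1" using nr[OF w] r(2) by simp
    have i1: "integrable \<mu> (\<lambda>z. h z * poisson (of_real (r k) * w) z)"
      by (intro integrable_circle_continuous continuous_on_mult continuous_on_poisson n
          continuous_on_subset[OF h(1)]) auto
    show "0 \<le> ?Q k w" using h(2) poisson_nonneg[OF n] by (intro integral_nonneg_AE) auto
    have "?Q k w \<le> (LINT z|\<mu>. B * poisson (of_real (r k) * w) z)"
      using i1 integrable_poisson[OF n] poisson_nonneg[OF n] B
      by (intro integral_mono) (auto simp: space_circle_measure intro!: mult_right_mono)
    then show "?Q k w \<le> B" using poisson_integral[OF n] by simp
  qed
  have nonneg: "0 \<le> (LINT w|\<mu>. u w * ?Q k w)" for k
  proof -
    let ?f = "\<lambda>(w, z). u w * (h z * poisson (of_real (r k) * w) z)"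
    have fm: "?f \<in> borel_measurable (\<mu> \<Otimes>\<^sub>M \<mu>)"
      unfolding poisson_def by measurable
    have fi: "integrable (\<mu> \<Otimes>\<^sub>M \<mu>) ?f"
    proof (rule circle2.Fubini_integrable[OF fm])
      have Qm: "?Q k \<in> borel_measurable \<mu>"
        unfolding poisson_def by measurable
      have "(LINT z|\<mu>. norm (?f (w, z))) = norm (u w) * ?Q k w" if "w \<in> space \<mu>" for w
      proof -
        have w: "norm w = 1" using that by (simp add: space_circle_measure)
        have "(LINT z|\<mu>. norm (?f (w, z))) = (LINT z|\<mu>. norm (u w) * (h z * poisson (of_real (r k) * w) z))"
          using h(2) poisson_nonneg[of "of_real (r k) * w"] nr[OF w] r(2)
          by (intro Bochner_Integration.integral_cong) (auto simp: abs_mult)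
        then show ?thesis by simp
      qed
      moreover have "integrable \<mu> (\<lambda>w. norm (u w) * ?Q k w)"
      proof (rule Bochner_Integration.integrable_bound)
        show "integrable \<mu> (\<lambda>w. norm (u w) * B)" using u by auto
        show "AE w in \<mu>. norm (norm (u w) * ?Q k w) \<le> norm (norm (u w) * B)"
          using AE_space
        proof eventually_elim
          case (elim w)
          then have w: "norm w = 1" by (simp add: space_circle_measure)
          have "norm (u w) * ?Q k w \<le> norm (u w) * B" by (intro mult_left_mono Q(2) w) auto
          moreover have "0 \<le> norm (u w) * ?Q k w" by (intro mult_nonneg_nonneg Q(1) w) auto
          ultimately show ?case by (simp only: real_norm_def abs_of_nonneg)
        qed
      qed (use Qm in measurable)
      ultimately show "integrable \<mu> (\<lambda>w. LINT z|\<mu>. norm (?f (w, z)))"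
        by (subst Bochner_Integration.integrable_cong[OF refl]) auto
      show "AE w in \<mu>. integrable \<mu> (\<lambda>z. ?f (w, z))"
        using r(2) nr 
        by (intro AE_I2, simp only: split)
          (intro integrable_mult_right integrable_circle_continuous continuous_on_mult continuous_on_poisson
            continuous_on_subset[OF h(1)], auto simp: space_circle_measure)
    qed
    have "(LINT w|\<mu>. u w * ?Q k w) = (LINT w|\<mu>. LINT z|\<mu>. ?f (w, z))"
      by simp
    also have "\<dots> = (LINT z|\<mu>. LINT w|\<mu>. ?f (w, z))"
      using circle2.Fubini_integral[of "\<lambda>w z. ?f (w, z)"] fi by simp
    also have "\<dots> = (LINT z|\<mu>. h z * (LINT w|\<mu>. u w * poisson (of_real (r k) * z) w))"
    proof (rule Bochner_Integration.integral_cong[OF refl])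
      fix z assume z: "z \<in> space \<mu>"
      have "(LINT w|\<mu>. ?f (w, z)) = (LINT w|\<mu>. h z * (u w * poisson (of_real (r k) * z) w))"
        using z by (intro Bochner_Integration.integral_cong) (auto simp: space_circle_measure
            poisson_symmetric[of _ z])
      then show "(LINT w|\<mu>. ?f (w, z)) = h z * (LINT w|\<mu>. u w * poisson (of_real (r k) * z) w)"
        by simp
    qed
    also have "0 \<le> \<dots>"
      using h(2) nr r(2) by (intro integral_nonneg_AE AE_I2 mult_nonneg_nonneg P) (auto simp:
          space_circle_measure)
    finally show ?thesis .
  qed
  have "(\<lambda>k. LINT w|\<mu>. u w * ?Q k w) \<longlonglongrightarrow> (LINT w|\<mu>. u w * h w)"
  proof (rule integral_dominated_convergence)
    show "integrable \<mu> (\<lambda>w. norm (u w) * B)" using u by auto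
    show "AE w in \<mu>. (\<lambda>k. u w * ?Q k w) \<longlonglongrightarrow> u w * h w"
      by (intro AE_I2 tendsto_mult tendsto_const poisson_approximates h r r1) (simp add: space_circle_measure)
    show "AE w in \<mu>. norm (u w * ?Q k w) \<le> norm (u w) * B" for k
      using Q by (intro AE_I2) (auto simp: space_circle_measure abs_mult intro!: mult_left_mono)
    show "(\<lambda>w. u w * h w) \<in> borel_measurable \<mu>" using borel_measurable_circle[OF hm] by measurable
    show "(\<lambda>w. u w * ?Q k w) \<in> borel_measurable \<mu>" for k
      unfolding poisson_def by measurable
  qed
  then show ?thesis by (rule LIMSEQ_le_const) (use nonneg in auto)
qed

section \<open>The upper bound\<close>

lemma poisson_positive_compact:
  fixes u :: "complex \<Rightarrow> real"
  assumes u: "integrable \<mu> u"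
    and P: "\<And>a. norm a < 1 \<Longrightarrow> 0 \<le> (LINT w|\<mu>. u w * poisson a w)"
    and K: "closed K"
  shows "0 \<le> (LINT w|\<mu>. u w * indicator K w)"
proof (cases "K = {}")
  case False
  obtain h :: "nat \<Rightarrow> complex \<Rightarrow> real" where hc: "\<And>n S. continuous_on S (h n)"
    and hb: "\<And>n z. 0 \<le> h n z" "\<And>n z. h n z \<le> 1" and hl: "\<And>z. (\<lambda>n. h n z) \<longlonglongrightarrow> indicator K z"
    using closed_indicator_approx[OF K False] by blast
  have "(\<lambda>n. LINT w|\<mu>. u w * h n w) \<longlonglongrightarrow> (LINT w|\<mu>. u w * indicator K w)"
  proof (rule integral_dominated_convergence)
    have um [measurable]: "u \<in> borel_measurable \<mu>" using u by auto
    have hm [measurable]: "h n \<in> borel_measurable \<mu>" for n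
      by (intro borel_measurable_circle borel_measurable_continuous_onI hc)
    have Km: "indicator K \<in> borel_measurable \<mu>"
      using K by (intro borel_measurable_circle) auto
    show "(\<lambda>w. u w * indicator K w) \<in> borel_measurable \<mu>" using um Km by (rule borel_measurable_times)
    show "(\<lambda>w. u w * h n w) \<in> borel_measurable \<mu>" for n by measurable
    show "integrable \<mu> (\<lambda>w. norm (u w))" using u by simp
    show "AE w in \<mu>. (\<lambda>n. u w * h n w) \<longlonglongrightarrow> u w * indicator K w"
      by (intro AE_I2 tendsto_mult tendsto_const hl)
    show "AE w in \<mu>. norm (u w * h n w) \<le> norm (u w)" for n
      using hb by (intro AE_I2) (simp add: abs_mult mult_left_le)
  qed
  then show ?thesis
    by (rule LIMSEQ_le_const) (use poisson_positive_continuous[OF u P hc] hb in auto)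
qed simp

text \<open>On a compact set where \<open>u\<close> is negative, the integral of \<open>u\<close> is
  nonnegative by approximation and nonpositive by sign, so the set is null. Inner regularity extends
  this to the whole negativity set, and no theorem on radial limits of Poisson integrals is
  invoked.\<close>

lemma poisson_positive_AE:
  fixes u :: "complex \<Rightarrow> real"
  assumes u: "integrable \<mu> u"
    and P: "\<And>a. norm a < 1 \<Longrightarrow> 0 \<le> (LINT w|\<mu>. u w * poisson a w)"
  shows "AE w in \<mu>. 0 \<le> u w"
proof -
  have "u \<in> borel_measurable (completion circle_borel_measure)"
    using u unfolding circle_measure_def by (rule borel_measurable_integrable)
  \<comment> \<open>Inner regularity concerns Borel sets, whereas \<open>u\<close> is measurable
    only for the completion; a Borel representative \<open>v\<close> is used to define the
    negativity set.\<close>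
  from completion_ex_borel_measurable_real[OF this]
  obtain v where v: "v \<in> borel_measurable circle_borel_measure" "AE w in circle_borel_measure. u w = v w"
    by blast
  have ae: "AE w in \<mu>. u w = v w"
    using v(2) unfolding circle_measure_def by (rule AE_completion)
  let ?\<nu> = "distr \<mu> borel (\<lambda>w. w)"
  have fin: "emeasure ?\<nu> (space ?\<nu>) \<noteq> \<infinity>"
    by (simp add: emeasure_distr circle.emeasure_eq_measure)
  define N where "N = {w \<in> sphere 0 1. v w < 0}"
  have N: "N \<in> sets borel"
  proof -
    have "v \<in> borel_measurable (restrict_space borel (sphere 0 1))"
      using v(1) by (simp add: circle_borel_measure_def)
    then have "{w \<in> space (restrict_space borel (sphere 0 1)). v w < 0} \<in> sets (restrict_space borel
        (sphere 0 1))"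
      by measurable
    then show ?thesis by (auto simp: N_def sets_restrict_space_iff space_restrict_space)
  qed
  have "emeasure ?\<nu> K = 0" if K: "compact K" "K \<subseteq> N" for K
  proof -
    have Kc: "closed K" using K(1) by (rule compact_imp_closed)
    have um: "u \<in> borel_measurable \<mu>" using u by auto
    have Km: "indicator K \<in> borel_measurable \<mu>"
      using Kc by (intro borel_measurable_circle) auto
    have ui: "integrable \<mu> (\<lambda>w. u w * indicator K w)"
    proof (rule Bochner_Integration.integrable_bound[OF u])
      show "(\<lambda>w. u w * indicator K w) \<in> borel_measurable \<mu>"
        using um Km by (rule borel_measurable_times)
    qed (auto simp: indicator_def)
    have neg: "AE w in \<mu>. 0 \<le> - (u w * indicator K w)"
      using ae by eventually_elim (use K(2) in \<open>auto simp: N_def indicator_def\<close>)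
    have "0 \<le> (LINT w|\<mu>. - (u w * indicator K w))"
      using neg by (rule integral_nonneg_AE)
    moreover have "0 \<le> (LINT w|\<mu>. u w * indicator K w)"
      by (rule poisson_positive_compact[OF u P Kc])
    ultimately have "(LINT w|\<mu>. - (u w * indicator K w)) = 0" by simp
    then have "AE w in \<mu>. - (u w * indicator K w) = 0"
      using integral_nonneg_eq_0_iff_AE[of \<mu> "\<lambda>w. - (u w * indicator K w)"] ui neg by simp
    then have "AE w in \<mu>. w \<notin> K"
      using ae by eventually_elim (use K(2) in \<open>auto simp: N_def indicator_def\<close>)
    moreover have "K \<inter> space \<mu> \<in> sets \<mu>"
      using measurable_sets[OF borel_measurable_ident_circle, of K] Kc by (simp add: vimage_def Int_def)
    ultimately have "emeasure \<mu> (K \<inter> space \<mu>) = 0"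
      by (subst (asm) AE_iff_measurable[OF _ refl]) (auto simp: Int_def conj_commute)
    then show ?thesis using Kc by (simp add: emeasure_distr vimage_def Int_def)
  qed
  then have "emeasure ?\<nu> N = 0"
    using inner_regular[OF _ fin, of N] N by (simp add: SUP_constant bot_ennreal)
  then have "AE w in ?\<nu>. w \<notin> N" using N by (intro AE_not_in) (auto simp: null_sets_def)
  then have "AE w in \<mu>. w \<notin> N"
    using N by (subst (asm) AE_distr_iff) auto
  then show ?thesis using ae AE_space
    by eventually_elim (auto simp: N_def space_circle_measure)
qed

lemma integrable_powr:
  fixes h :: "complex \<Rightarrow> real"
  assumes "0 < p" "p < 1" "integrable \<mu> h"
  shows "integrable \<mu> (\<lambda>w. \<bar>h w\<bar> powr p)"
proof (rule Bochner_Integration.integrable_bound)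
  show "integrable \<mu> (\<lambda>w. 1 + \<bar>h w\<bar>)" using assms(3) by auto
  show "(\<lambda>w. \<bar>h w\<bar> powr p) \<in> borel_measurable \<mu>"
    using assms(3) by (intro powr_real_measurable) auto
  show "AE w in \<mu>. norm (\<bar>h w\<bar> powr p) \<le> norm (1 + \<bar>h w\<bar>)"
  proof (rule AE_I2)
    fix w
    have "\<bar>h w\<bar> powr p \<le> (1 + \<bar>h w\<bar>) powr p" using assms(1) by (intro powr_mono2) auto
    also have "\<dots> \<le> (1 + \<bar>h w\<bar>) powr 1" using assms(2) by (intro powr_mono) auto
    finally show "norm (\<bar>h w\<bar> powr p) \<le> norm (1 + \<bar>h w\<bar>)" by simp
  qed
qed

section \<open>From domination of Poisson kernels to the bound on the conditional
  expectation\<close>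

context
  fixes \<eta> :: "complex \<Rightarrow> complex"
  assumes inner: "inner_function \<eta>" and \<eta>0: "\<eta> 0 = 0"
begin

interpretation E: sigma_finite_subalgebra \<mu> "Sigma_alg \<eta>"
  by (rule subalg_Sigma_alg[OF inner \<eta>0])

private abbreviation "E \<equiv> real_cond_exp \<mu> (Sigma_alg \<eta>)"

lemma cond_exp_poisson:
  assumes a: "norm a < 1"
  shows "AE w in \<mu>. E (poisson a) w = poisson (\<eta> a) (boundary_fun \<eta> w)"
proof -
  have b: "norm (\<eta> a) < 1" by (rule inner_norm_less_1[OF inner \<eta>0 a])
  have i: "integrable \<mu> (\<lambda>w. Re (deriv_kernel 0 a w))" using integrable_deriv_kernel[OF a] by simp
  have i2: "integrable \<mu> (\<lambda>w. 2 * Re (deriv_kernel 0 a w))" using i by simp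
  have "AE w in \<mu>. E (poisson a) w = E (\<lambda>w. 2 * Re (deriv_kernel 0 a w) - 1) w"
    using i integrable_poisson[OF a] poisson_eq_deriv_kernel[OF a]
    by (intro E.real_cond_exp_cong AE_I2) (auto simp: space_circle_measure)
  moreover have "AE w in \<mu>. E (\<lambda>w. 2 * Re (deriv_kernel 0 a w) - 1) w = E (\<lambda>w. 2 * Re (deriv_kernel 0 a
      w)) w - E (\<lambda>w. 1) w"
    by (rule E.real_cond_exp_diff[OF i2]) simp
  moreover have "AE w in \<mu>. E (\<lambda>w. 2 * Re (deriv_kernel 0 a w)) w = 2 * E (\<lambda>w. Re (deriv_kernel 0 a w)) w"
    by (rule E.real_cond_exp_cmult[OF i])
  moreover have "AE w in \<mu>. E (\<lambda>w. 1) w = 1"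
    by (rule E.real_cond_exp_F_meas) auto
  ultimately show ?thesis
    using cexp_deriv_kernel[OF inner \<eta>0 a, of 0] boundary_norm[OF inner \<eta>0]
  proof eventually_elim
    case (elim w)
    have "E (\<lambda>w. Re (deriv_kernel 0 a w)) w = Re (cexp \<eta> (deriv_kernel 0 a) w)" by (simp add: cexp_def)
    then show ?case using elim poisson_eq_deriv_kernel[OF b, of "boundary_fun \<eta> w"] by simp
  qed
qed

lemma cexp_measurable: "cexp \<eta> f \<in> borel_measurable \<mu>"
  unfolding cexp_def complex_eq_iff Complex_eq
  using measurable_from_subalg[OF E.subalg borel_measurable_cond_exp] by auto

text \<open>\<open>cexp\<close> is defined by components, so the bound is obtained by duality: the
  phase of \<open>cexp \<eta> f\<close> is measurable for \<open>Sigma_alg \<eta>\<close>, hence its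
  conjugate may be moved inside the conditional expectation, where the real part of the product is
  at most \<open>norm (f w)\<close>.\<close>

lemma norm_cexp_le:
  assumes f: "integrable \<mu> f"
  shows "AE w in \<mu>. norm (cexp \<eta> f w) \<le> E (\<lambda>w. norm (f w)) w"
proof -
  let ?R = "\<lambda>w. Re (f w)" and ?I = "\<lambda>w. Im (f w)"
  have R: "integrable \<mu> ?R" and I: "integrable \<mu> ?I" using f by auto
  have fm [measurable]: "f \<in> borel_measurable \<mu>" using f by auto
  have Em [measurable]: "E u \<in> borel_measurable (Sigma_alg \<eta>)" for u by simp
  \<comment> \<open>Cosine and sine of the phase; where \<open>cexp \<eta> f\<close> vanishes,
    division by zero makes both 0, which respects all bounds below.\<close>
  define c s where "c w = E ?R w / norm (cexp \<eta> f w)" and "s w = E ?I w / norm (cexp \<eta> f w)" for w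
  have nm: "norm (cexp \<eta> f w) = sqrt ((E ?R w)\<^sup>2 + (E ?I w)\<^sup>2)" for w by (simp add: cexp_def cmod_def)
  have cm: "c \<in> borel_measurable (Sigma_alg \<eta>)" and sm: "s \<in> borel_measurable (Sigma_alg \<eta>)"
    unfolding c_def s_def nm by measurable
  note cM = measurable_from_subalg[OF E.subalg cm] and sM = measurable_from_subalg[OF E.subalg sm]
  have cs: "(c w)\<^sup>2 + (s w)\<^sup>2 \<le> 1" for w
    unfolding c_def s_def power_divide nm by (simp add: add_divide_distrib[symmetric])
  have c1: "\<bar>c w\<bar> \<le> 1" and s1: "\<bar>s w\<bar> \<le> 1" for w
    using cs[of w] by (simp_all add: abs_square_le_1[symmetric]) (smt (verit) zero_le_power2)+
  have ci: "integrable \<mu> (\<lambda>w. c w * ?R w)"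
    by (rule Bochner_Integration.integrable_bound[OF R])
      (use c1 cM in \<open>auto simp: abs_mult intro!: mult_left_le_one_le\<close>)
  have si: "integrable \<mu> (\<lambda>w. s w * ?I w)"
    by (rule Bochner_Integration.integrable_bound[OF I])
      (use s1 sM in \<open>auto simp: abs_mult intro!: mult_left_le_one_le\<close>)
  have le: "c w * ?R w + s w * ?I w \<le> norm (f w)" for w
  proof -
    have "c w * ?R w + s w * ?I w = Re (cnj (Complex (c w) (s w)) * f w)" by simp
    also have "\<dots> \<le> norm (cnj (Complex (c w) (s w)) * f w)" by (rule complex_Re_le_cmod)
    also have "\<dots> \<le> 1 * norm (f w)"
      unfolding norm_mult by (rule mult_right_mono) (use cs[of w] in \<open>auto simp: cmod_def\<close>)
    finally show ?thesis by simp
  qed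
  have "AE w in \<mu>. E (\<lambda>w. c w * ?R w + s w * ?I w) w \<le> E (\<lambda>w. norm (f w)) w"
    using f ci si le by (intro E.real_cond_exp_mono) auto
  moreover have "AE w in \<mu>. E (\<lambda>w. c w * ?R w + s w * ?I w) w = E (\<lambda>w. c w * ?R w) w + E (\<lambda>w. s w * ?I w) w"
    by (rule E.real_cond_exp_add[OF ci si])
  moreover have "AE w in \<mu>. E (\<lambda>w. c w * ?R w) w = c w * E ?R w"
    using cm R ci by (intro E.real_cond_exp_mult) auto
  moreover have "AE w in \<mu>. E (\<lambda>w. s w * ?I w) w = s w * E ?I w"
    using sm I si by (intro E.real_cond_exp_mult) auto
  ultimately show ?thesis
  proof eventually_elim
    case (elim w)
    have "c w * E ?R w + s w * E ?I w = (norm (cexp \<eta> f w))\<^sup>2 / norm (cexp \<eta> f w)"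
      by (simp add: c_def s_def nm power2_eq_square add_divide_distrib)
    also have "\<dots> = norm (cexp \<eta> f w)" by (simp add: power2_eq_square)
    finally show ?case using elim by simp
  qed
qed

lemma le_cond_exp_mult:
  fixes f :: "complex \<Rightarrow> real"
  assumes julia: "\<And>a. norm a < 1 \<Longrightarrow> AE w in \<mu>. poisson a w \<le> M * poisson (\<eta> a) (boundary_fun \<eta> w)"
    and f: "integrable \<mu> f" "\<And>w. 0 \<le> f w"
  shows "AE w in \<mu>. f w \<le> M * E f w"
proof -
  have Ef: "integrable \<mu> (E f)" using f by auto
  have fm [measurable]: "f \<in> borel_measurable \<mu>" using f by auto
  have ui: "integrable \<mu> (\<lambda>w. M * E f w - f w)" using f Ef by auto
  have "AE w in \<mu>. 0 \<le> M * E f w - f w"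
  proof (rule poisson_positive_AE[OF ui])
    fix a :: complex assume a: "norm a < 1"
    have b: "norm (\<eta> a) < 1" by (rule inner_norm_less_1[OF inner \<eta>0 a])
    let ?P = "poisson a" and ?Q = "\<lambda>w. poisson (\<eta> a) (boundary_fun \<eta> w)"
    have Pm: "?P \<in> borel_measurable \<mu>" using integrable_poisson[OF a] by auto
    have QS: "?Q \<in> borel_measurable (Sigma_alg \<eta>)"
      using measurable_compose[OF boundary_Sigma_alg[OF inner \<eta>0] borel_measurable_poisson] .
    note Qm = measurable_from_subalg[OF E.subalg QS]
    have Pb: "AE w in \<mu>. norm (?P w) \<le> (1 - (norm a)\<^sup>2) / (1 - norm a)\<^sup>2"
      using poisson_bounded[OF a] by (intro AE_I2) (auto simp: space_circle_measure)
    have Qb: "AE w in \<mu>. norm (?Q w) \<le> (1 - (norm (\<eta> a))\<^sup>2) / (1 - norm (\<eta> a))\<^sup>2"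
      using boundary_norm[OF inner \<eta>0] by eventually_elim (rule poisson_bounded[OF b])
    note Pf = integrable_times_bounded[OF Pm Pb f(1)] and PE = integrable_times_bounded[OF Pm Pb Ef]
      and Qf = integrable_times_bounded[OF Qm Qb f(1)]
    \<comment> \<open>Self-adjointness used twice: \<open>E\<close> passes from \<open>f\<close> to
      the Poisson kernel, where it gives \<open>?Q\<close>, and is then dropped from
      \<open>f\<close> because \<open>?Q\<close> is measurable for
      \<open>Sigma_alg \<eta>\<close>.\<close>
    have "(LINT w|\<mu>. ?P w * E f w) = (LINT w|\<mu>. E f w * E ?P w)"
      using PE Pm by (subst E.real_cond_exp_intg(2)) (auto simp: mult.commute)
    also have "\<dots> = (LINT w|\<mu>. ?Q w * E f w)"
      using cond_exp_poisson[OF a] Qm Pm by (intro integral_cong_AE) (auto elim!: eventually_mono)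
    also have "\<dots> = (LINT w|\<mu>. ?Q w * f w)"
      by (rule E.real_cond_exp_intg(2)[OF Qf QS fm])
    finally have eq: "(LINT w|\<mu>. ?P w * E f w) = (LINT w|\<mu>. ?Q w * f w)" .
    have "(LINT w|\<mu>. ?P w * f w) \<le> (LINT w|\<mu>. M * (?Q w * f w))"
    proof (rule integral_mono_AE[OF Pf])
      show "integrable \<mu> (\<lambda>w. M * (?Q w * f w))" using Qf by simp
      show "AE w in \<mu>. ?P w * f w \<le> M * (?Q w * f w)"
        using julia[OF a] by eventually_elim (simp only: mult.assoc[symmetric] mult_right_mono f(2))
    qed
    then have "0 \<le> M * (LINT w|\<mu>. ?P w * E f w) - (LINT w|\<mu>. ?P w * f w)"
      by (simp add: eq)
    also have "\<dots> = (LINT w|\<mu>. M * (?P w * E f w) - ?P w * f w)"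
      using PE Pf by simp
    also have "\<dots> = (LINT w|\<mu>. (M * E f w - f w) * ?P w)"
      by (simp add: algebra_simps)
    finally show "0 \<le> (LINT w|\<mu>. (M * E f w - f w) * ?P w)" .
  qed
  then show ?thesis by eventually_elim simp
qed

lemma cexp_Lp_bound:
  assumes p: "0 < p" "p < 1" and M: "0 < M"
    and julia: "\<And>a. norm a < 1 \<Longrightarrow> AE w in \<mu>. poisson a w \<le> M * poisson (\<eta> a) (boundary_fun \<eta> w)"
  shows "cexp_bound p (Lp_space 1) \<eta> (M powr (1 / p - 1))"
  unfolding cexp_bound_def
proof
  fix f assume "f \<in> Lp_space 1"
  then have fm: "f \<in> borel_measurable \<mu>" and "integrable \<mu> (\<lambda>w. norm (f w))"
    by (auto simp: Lp_space_def)
  then have f: "integrable \<mu> f" using integrable_norm_iff by blast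
  let ?h = "\<lambda>w. norm (f w)"
  have h: "integrable \<mu> ?h" using f by simp
  have hm: "?h \<in> borel_measurable \<mu>" using h by auto
  have hM: "AE w in \<mu>. ?h w \<le> M * E ?h w"
    by (rule le_cond_exp_mult[OF julia h]) auto
  have Epos: "AE w in \<mu>. 0 \<le> E ?h w" using hm by (intro E.real_cond_exp_pos) auto
  have Ei: "integrable \<mu> (E ?h)" using h by auto
  \<comment> \<open>Being measurable for \<open>Sigma_alg \<eta>\<close>, this weight has the same
    integral against \<open>?h\<close> as against \<open>E ?h\<close>.\<close>
  let ?g = "\<lambda>w. E ?h w powr (p - 1)"
  have gS: "?g \<in> borel_measurable (Sigma_alg \<eta>)" by (intro powr_real_measurable) auto
  note gm = measurable_from_subalg[OF E.subalg gS]
  have hp: "integrable \<mu> (\<lambda>w. ?h w powr p)" using integrable_powr[OF p h] by simp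
  \<comment> \<open>The exponent \<open>p - 1\<close> is negative and therefore reverses
    \<open>?h w / M \<le> E ?h w\<close>; where \<open>?h\<close> vanishes both sides are 0. The
    same bound makes \<open>?g * ?h\<close> integrable although \<open>?g\<close> may be
    unbounded.\<close>
  have gh: "AE w in \<mu>. ?g w * ?h w \<le> M powr (1 - p) * ?h w powr p"
    using hM Epos
  proof eventually_elim
    case (elim w)
    show ?case
    proof (cases "?h w = 0")
      case False
      then have h0: "0 < ?h w" by simp
      then have E0: "0 < E ?h w" using elim M by (metis less_le mult_zero_right not_less)
      have "E ?h w powr (p - 1) \<le> (?h w / M) powr (p - 1)"
        using p elim(1) h0 M by (intro powr_mono2') (auto simp: field_simps)
      then have "?g w * ?h w \<le> (?h w / M) powr (p - 1) * ?h w" using h0 by (intro mult_right_mono) auto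
      also have "\<dots> = M powr (1 - p) * (?h w powr (p - 1) * ?h w powr 1)"
        using h0 M by (simp add: powr_divide powr_minus_divide[of M "p - 1", simplified] field_simps)
      also have "\<dots> = M powr (1 - p) * ?h w powr p" by (simp only: powr_add[symmetric]) simp
      finally show ?thesis .
    qed (use p in simp)
  qed
  have ghi: "integrable \<mu> (\<lambda>w. ?g w * ?h w)"
  proof (rule Bochner_Integration.integrable_bound)
    show "integrable \<mu> (\<lambda>w. M powr (1 - p) * ?h w powr p)" using hp by simp
    show "(\<lambda>w. ?g w * ?h w) \<in> borel_measurable \<mu>" using gm hm by auto
    show "AE w in \<mu>. norm (?g w * ?h w) \<le> norm (M powr (1 - p) * ?h w powr p)"
      using gh by eventually_elim simp
  qed
  have "(LINT w|\<mu>. norm (cexp \<eta> f w) powr p) \<le> (LINT w|\<mu>. E ?h w powr p)"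
  proof (rule integral_mono_AE')
    have "integrable \<mu> (\<lambda>w. \<bar>E ?h w\<bar> powr p)" by (rule integrable_powr[OF p Ei])
    then show "integrable \<mu> (\<lambda>w. E ?h w powr p)"
      using Epos Ei by (subst integrable_cong_AE[of _ _ "\<lambda>w. \<bar>E ?h w\<bar> powr p"]) (auto elim!: eventually_mono)
    show "AE w in \<mu>. norm (cexp \<eta> f w) powr p \<le> E ?h w powr p"
      using norm_cexp_le[OF f] by eventually_elim (use p in \<open>auto intro: powr_mono2\<close>)
    show "AE w in \<mu>. 0 \<le> E ?h w powr p" by simp
  qed
  also have "\<dots> = (LINT w|\<mu>. ?g w * E ?h w)"
  proof (rule integral_cong_AE)
    show "AE w in \<mu>. E ?h w powr p = ?g w * E ?h w"
      using Epos
    proof eventually_elim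
      case (elim w)
      show ?case using elim powr_add[of "E ?h w" "p - 1" 1] by (cases "E ?h w = 0") auto
    qed
  qed (use gm Ei in auto)
  also have "\<dots> = (LINT w|\<mu>. ?g w * ?h w)"
    by (rule E.real_cond_exp_intg(2)[OF ghi gS hm])
  also have "\<dots> \<le> (LINT w|\<mu>. M powr (1 - p) * ?h w powr p)"
    using ghi hp gh by (intro integral_mono_AE) auto
  finally have main: "(LINT w|\<mu>. norm (cexp \<eta> f w) powr p) \<le> M powr (1 - p) * (LINT w|\<mu>. ?h w powr p)"
    by simp
  have "Lp_norm p (cexp \<eta> f) \<le> (M powr (1 - p) * (LINT w|\<mu>. ?h w powr p)) powr (1 / p)"
    unfolding Lp_norm_def using main p by (intro powr_mono2) (auto intro!: integral_nonneg_AE)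
  also have "\<dots> = M powr ((1 - p) * (1 / p)) * Lp_norm p f"
    unfolding Lp_norm_def by (simp add: powr_mult powr_powr integral_nonneg_AE)
  also have "(1 - p) * (1 / p) = 1 / p - 1" using p by (simp add: field_simps)
  finally show "Lp_norm p (cexp \<eta> f) \<le> M powr (1 / p - 1) * Lp_norm p f" .
qed

end

section \<open>Julia's inequality for finite Blaschke products\<close>

lemma moebius_norm:
  assumes "1 - cnj a * z \<noteq> 0"
  shows "1 - (norm ((z - a) / (1 - cnj a * z)))\<^sup>2 = (1 - (norm z)\<^sup>2) * (1 - (norm a)\<^sup>2) / (norm (1 - cnj a
      * z))\<^sup>2"
proof -
  have "(norm (1 - cnj a * z))\<^sup>2 - (norm (z - a))\<^sup>2 = (1 - (norm z)\<^sup>2) * (1 - (norm a)\<^sup>2)"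
    unfolding cmod_power2 by (simp add: power2_eq_square algebra_simps)
  moreover have "(norm (1 - cnj a * z))\<^sup>2 \<noteq> 0" using assms by simp
  ultimately show ?thesis
    unfolding norm_divide power_divide by (subst eq_divide_eq) (simp add: left_diff_distrib)
qed

text \<open>Contraction of the pseudo-hyperbolic distance, written for 1 minus its square: in this
  form the inequality can be divided by \<open>1 - (norm z)\<^sup>2\<close> and taken to the
  boundary.\<close>

lemma schwarz_pick:
  assumes hol: "f holomorphic_on ball 0 1" and lt: "\<And>z. norm z < 1 \<Longrightarrow> norm (f z) < 1"
    and z: "norm z < 1" and a: "norm a < 1"
  shows "(1 - (norm z)\<^sup>2) * (1 - (norm a)\<^sup>2) / (norm (1 - cnj a * z))\<^sup>2
      \<le> (1 - (norm (f z))\<^sup>2) * (1 - (norm (f a))\<^sup>2) / (norm (1 - cnj (f a) * f z))\<^sup>2"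
proof -
  let ?m = "Moebius_function 0"
  let ?h = "\<lambda>x. ?m (f a) (f (?m (-a) x))"
  have m1: "norm (?m (-a) x) < 1" if "norm x < 1" for x using Moebius_function_norm_lt_1[of "-a" x] a that
      by simp
  have m: "?m (-a) holomorphic_on ball 0 1" by (rule Moebius_function_holomorphic) (use a in simp)
  have fm: "(\<lambda>x. f (?m (-a) x)) holomorphic_on ball 0 1"
    using holomorphic_on_compose_gen[OF m hol] m1 by (auto simp: o_def image_subset_iff)
  have "?h holomorphic_on ball 0 1"
    using holomorphic_on_compose_gen[OF fm Moebius_function_holomorphic[OF lt[OF a]]] m1 lt by (auto simp:
        o_def image_subset_iff)
  moreover have "?h 0 = 0" by (simp add: Moebius_function_simple)
  moreover have "norm (?h x) < 1" if "norm x < 1" for x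
    using that by (intro Moebius_function_norm_lt_1 lt a m1)
  moreover have "norm (?m a z) < 1" by (intro Moebius_function_norm_lt_1 a z)
  ultimately have "norm (?h (?m a z)) \<le> norm (?m a z)" by (rule Schwarz_Lemma(1))
  moreover have "?m (-a) (?m a z) = z" by (rule Moebius_function_compose) (use a z in auto)
  ultimately have "norm ((f z - f a) / (1 - cnj (f a) * f z)) \<le> norm ((z - a) / (1 - cnj a * z))"
    by (simp add: Moebius_function_simple)
  then have "1 - (norm ((z - a) / (1 - cnj a * z)))\<^sup>2 \<le> 1 - (norm ((f z - f a) / (1 - cnj (f a) * f z)))\<^sup>2"
    by (simp add: power_mono)
  moreover have n: "1 - cnj a * z \<noteq> 0" "1 - cnj (f a) * f z \<noteq> 0"
    using one_minus_cnj_mult_nonzero[of a z] one_minus_cnj_mult_nonzero[of "f a" "f z"] a z lt[OF a] lt[OF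
        z] by auto
  ultimately show ?thesis unfolding moebius_norm[OF n(1)] moebius_norm[OF n(2)] by blast
qed

lemma norm_squared_has_real_derivative:
  fixes F :: "real \<Rightarrow> complex"
  assumes "(F has_vector_derivative F') (at t)"
  shows "((\<lambda>t. (norm (F t))\<^sup>2) has_real_derivative 2 * Re (cnj (F t) * F')) (at t)"
proof -
  have R: "((\<lambda>t. Re (F t)) has_real_derivative Re F') (at t)"
    using bounded_linear.has_vector_derivative[OF bounded_linear_Re assms]
    by (simp add: has_real_derivative_iff_has_vector_derivative)
  have I: "((\<lambda>t. Im (F t)) has_real_derivative Im F') (at t)"
    using bounded_linear.has_vector_derivative[OF bounded_linear_Im assms]
    by (simp add: has_real_derivative_iff_has_vector_derivative)
  show ?thesis unfolding cmod_power2
    by (rule derivative_eq_intros R I refl)+ (simp add: algebra_simps)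
qed

lemma eventually_at_left_one: "eventually (\<lambda>r::real. 0 < r \<and> r < 1) (at_left 1)"
  by (rule eventually_at_left_1) simp

text \<open>Common frame for finite Blaschke products and rotations. Since \<eta> is analytic across
  the circle, radial limits are values and boundary derivatives are ordinary complex
  derivatives.\<close>

locale disc_selfmap_boundary =
  fixes \<eta> :: "complex \<Rightarrow> complex" and S :: "complex set"
  assumes S: "open S" "cball 0 1 \<subseteq> S" and hol: "\<eta> holomorphic_on S"
    and lt: "\<And>z. norm z < 1 \<Longrightarrow> norm (\<eta> z) < 1" and one: "\<And>z. norm z = 1 \<Longrightarrow> norm (\<eta> z) = 1"
    and zero: "\<eta> 0 = 0"
begin

lemma hol_ball: "\<eta> holomorphic_on ball 0 1"
  using hol S(2) ball_subset_cball by (meson holomorphic_on_subset order_trans)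

lemma radial_limit:
  assumes "norm w = 1"
  shows "((\<lambda>r :: real. \<eta> (of_real r * w)) \<longlongrightarrow> \<eta> w) (at_left 1)"
proof -
  have "isCont \<eta> w"
    using holomorphic_on_imp_continuous_on[OF hol] S assms by (auto simp: continuous_on_eq_continuous_at
        subset_iff)
  moreover have "((\<lambda>r :: real. of_real r * w) \<longlongrightarrow> of_real 1 * w) (at_left 1)" by (intro tendsto_intros)
  ultimately show ?thesis by (auto intro: isCont_tendsto_compose)
qed

lemma boundary: "norm w = 1 \<Longrightarrow> boundary_fun \<eta> w = \<eta> w"
  unfolding boundary_fun_def by (intro tendsto_Lim radial_limit) auto

lemma inner: "inner_function \<eta>"
  unfolding inner_function_def
proof (intro conjI)
  show "bounded (\<eta> ` ball 0 1)"
    unfolding bounded_iff using lt by (intro exI[of _ 1]) (auto intro: less_imp_le)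
  show "AE w in \<mu>. \<exists>l. norm l = 1 \<and> ((\<lambda>r :: real. \<eta> (of_real r * w)) \<longlongrightarrow> l) (at_left 1)"
    using radial_limit one by (intro AE_I2) (auto simp: space_circle_measure)
qed (rule hol_ball)

lemma chain:
  assumes g: "(g has_vector_derivative g') (at t)" and "g t = w" "norm w = 1"
  shows "((\<lambda>t. \<eta> (g t)) has_vector_derivative g' * deriv \<eta> w) (at t)"
proof -
  have "(\<eta> has_field_derivative deriv \<eta> w) (at w)"
    using assms S by (intro holomorphic_derivI[OF hol]) auto
  then show ?thesis
    using field_vector_diff_chain_at[OF g, of \<eta> "deriv \<eta> w"] assms(2) by (simp add: o_def)
qed

text \<open>\<open>D\<close> is the logarithmic derivative
  \<open>w * deriv \<eta> w / \<eta> w\<close>. It is real because the modulus of \<eta> is constant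
  along the circle; its real part is half the radial derivative of the squared modulus, and the
  Schwarz lemma makes it at least 1. Hence \<open>D\<close> equals its own modulus.\<close>

lemma angular_derivative:
  assumes w: "norm w = 1"
  shows "((\<lambda>r. (1 - (norm (\<eta> (of_real r * w)))\<^sup>2) / (1 - r\<^sup>2)) \<longlongrightarrow> norm (deriv \<eta> w)) (at_left 1)"
    and "1 \<le> norm (deriv \<eta> w)"
proof -
  define D where "D = cnj (\<eta> w) * (w * deriv \<eta> w)"
  have nD: "norm D = norm (deriv \<eta> w)" using w one by (simp add: D_def norm_mult)
  have "((\<lambda>r. of_real r * w) has_vector_derivative w) (at 1)"
    by (auto intro!: derivative_eq_intros simp: has_vector_derivative_def scaleR_conv_of_real)
  from norm_squared_has_real_derivative[OF chain[OF this _ w]]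
  have rd: "((\<lambda>r. (norm (\<eta> (of_real r * w)))\<^sup>2) has_real_derivative 2 * Re D) (at 1)"
    by (simp add: D_def)
  have "((\<lambda>t. w * cis t) has_vector_derivative w * \<i>) (at 0)"
  proof -
    have "((\<lambda>z. w * exp (\<i> * z)) has_field_derivative w * \<i>) (at (of_real 0))"
      by (auto intro!: derivative_eq_intros)
    from has_vector_derivative_real_field[OF this] show ?thesis by (simp add: cis_conv_exp)
  qed
  from norm_squared_has_real_derivative[OF chain[OF this _ w]]
  have "((\<lambda>t. (norm (\<eta> (w * cis t)))\<^sup>2) has_real_derivative 2 * Re (\<i> * D)) (at 0)"
    by (simp add: D_def mult_ac)
  moreover have "(\<lambda>t. (norm (\<eta> (w * cis t)))\<^sup>2) = (\<lambda>t. 1)"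
    using one w by (simp add: norm_mult)
  ultimately have "2 * Re (\<i> * D) = 0" using DERIV_const DERIV_unique by metis
  then have im: "Im D = 0" by simp
  have nw: "norm (of_real r * w) = r" if "0 < r" for r using that w by (simp add: norm_mult)
  have ev: "eventually (\<lambda>r::real. 0 < r \<and> r < 1) (at_left 1)"
    by (rule eventually_at_left_one)
  have l1: "((\<lambda>r. ((norm (\<eta> (of_real r * w)))\<^sup>2 - 1) / (r - 1)) \<longlongrightarrow> 2 * Re D) (at_left 1)"
    using rd w one unfolding has_field_derivative_iff by (auto intro: filterlim_mono[OF _ order_refl at_le])
  have l2: "((\<lambda>r::real. (1 / (1 + r))) \<longlongrightarrow> 1 / (1 + 1)) (at_left 1)" by (intro tendsto_intros) auto
  have "((\<lambda>r. ((norm (\<eta> (of_real r * w)))\<^sup>2 - 1) / (r - 1) * (1 / (1 + r))) \<longlongrightarrow> 2 * Re D * (1 / (1 + 1)))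
      (at_left 1)"
    by (rule tendsto_mult[OF l1 l2])
  then have "((\<lambda>r. ((norm (\<eta> (of_real r * w)))\<^sup>2 - 1) / (r - 1) * (1 / (1 + r))) \<longlongrightarrow> Re D) (at_left 1)" by simp
  then have lim: "((\<lambda>r. (1 - (norm (\<eta> (of_real r * w)))\<^sup>2) / (1 - r\<^sup>2)) \<longlongrightarrow> Re D) (at_left 1)"
  proof (rule Lim_transform_eventually)
    show "eventually (\<lambda>r. ((norm (\<eta> (of_real r * w)))\<^sup>2 - 1) / (r - 1) * (1 / (1 + r)) =
        (1 - (norm (\<eta> (of_real r * w)))\<^sup>2) / (1 - r\<^sup>2)) (at_left 1)"
      using ev
    proof eventually_elim
      case (elim r)
      let ?x = "(norm (\<eta> (of_real r * w)))\<^sup>2"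
      have "(1 - ?x) / (1 - r\<^sup>2) = - (?x - 1) / - ((r - 1) * (1 + r))"
        by (simp add: power2_eq_square algebra_simps)
      also have "\<dots> = (?x - 1) / ((r - 1) * (1 + r))" by (rule minus_divide_divide)
      finally show ?case by simp
    qed
  qed
  have ge: "1 \<le> Re D"
  proof (rule tendsto_lowerbound[OF lim])
    show "eventually (\<lambda>r. 1 \<le> (1 - (norm (\<eta> (of_real r * w)))\<^sup>2) / (1 - r\<^sup>2)) (at_left 1)"
      using ev
    proof eventually_elim
      case (elim r)
      have "norm (\<eta> (of_real r * w)) \<le> r"
        using Schwarz_Lemma(1)[OF hol_ball zero lt, of "of_real r * w"] nw[of r] elim by simp
      then have "(norm (\<eta> (of_real r * w)))\<^sup>2 \<le> r\<^sup>2" by (rule power_mono) simp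
      moreover have "r\<^sup>2 < 1" using elim by (simp add: power_less_one_iff)
      ultimately show ?case by (simp add: le_divide_eq)
    qed
  qed simp
  have "Re D = norm D" using im ge by (simp add: cmod_eq_Re)
  then show "((\<lambda>r. (1 - (norm (\<eta> (of_real r * w)))\<^sup>2) / (1 - r\<^sup>2)) \<longlongrightarrow> norm (deriv \<eta> w)) (at_left 1)"
    "1 \<le> norm (deriv \<eta> w)"
    using lim ge nD by simp_all
qed

text \<open>Schwarz-Pick for the pair \<open>of_real r * w\<close> and \<open>a\<close>, divided by
  \<open>1 - r\<^sup>2\<close>; as r -> 1 the quotient on the right becomes the modulus of the
  boundary derivative.\<close>

lemma julia:
  assumes a: "norm a < 1" and w: "norm w = 1"
  shows "poisson a w \<le> norm (deriv \<eta> w) * poisson (\<eta> a) (\<eta> w)"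
proof -
  have P: "poisson b v = (1 - (norm b)\<^sup>2) / (norm (1 - cnj b * v))\<^sup>2" if "norm v = 1" for b v
    by (simp add: poisson_def norm_diff_unimodular[OF that])
  let ?z = "\<lambda>r :: real. of_real r * w"
  have nw: "norm (?z r) = r" if "0 < r" for r using that w by (simp add: norm_mult)
  have nz: "1 - cnj a * w \<noteq> 0" "1 - cnj (\<eta> a) * \<eta> w \<noteq> 0"
    using one_minus_cnj_mult_nonzero[of a w] one_minus_cnj_mult_nonzero[of "\<eta> a" "\<eta> w"] a w lt[OF a]
        one[OF w] by auto
  have z: "(?z \<longlongrightarrow> w) (at_left 1)"
  proof -
    have "(?z \<longlongrightarrow> of_real 1 * w) (at_left 1)" by (intro tendsto_intros)
    then show ?thesis by simp
  qed
  have "(1 - (norm a)\<^sup>2) / (norm (1 - cnj a * w))\<^sup>2 \<le> norm (deriv \<eta> w) * ((1 - (norm (\<eta> a))\<^sup>2) / (norm (1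
      - cnj (\<eta> a) * \<eta> w))\<^sup>2)"
  proof (rule tendsto_le)
    show "((\<lambda>r. (1 - (norm a)\<^sup>2) / (norm (1 - cnj a * ?z r))\<^sup>2) \<longlongrightarrow> (1 - (norm a)\<^sup>2) / (norm (1 - cnj a *
        w))\<^sup>2) (at_left 1)"
      using nz by (intro tendsto_intros z) auto
    show "((\<lambda>r. (1 - (norm (\<eta> (?z r)))\<^sup>2) / (1 - r\<^sup>2) * ((1 - (norm (\<eta> a))\<^sup>2) / (norm (1 - cnj (\<eta> a) * \<eta>
        (?z r)))\<^sup>2)) \<longlongrightarrow>
       norm (deriv \<eta> w) * ((1 - (norm (\<eta> a))\<^sup>2) / (norm (1 - cnj (\<eta> a) * \<eta> w))\<^sup>2)) (at_left 1)"
      using nz by (intro tendsto_intros radial_limit[OF w] angular_derivative[OF w]) auto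
    show "eventually (\<lambda>r. (1 - (norm a)\<^sup>2) / (norm (1 - cnj a * ?z r))\<^sup>2 \<le>
       (1 - (norm (\<eta> (?z r)))\<^sup>2) / (1 - r\<^sup>2) * ((1 - (norm (\<eta> a))\<^sup>2) / (norm (1 - cnj (\<eta> a) * \<eta> (?z
           r)))\<^sup>2)) (at_left 1)"
      using eventually_at_left_one
    proof eventually_elim
      case (elim r)
      have n: "norm (?z r) = r" using elim by (intro nw) simp
      have r: "0 < 1 - r\<^sup>2" using elim by (simp add: power_less_one_iff)
      have "(1 - r\<^sup>2) * ((1 - (norm a)\<^sup>2) / (norm (1 - cnj a * ?z r))\<^sup>2) \<le>
        (1 - (norm (\<eta> (?z r)))\<^sup>2) * (1 - (norm (\<eta> a))\<^sup>2) / (norm (1 - cnj (\<eta> a) * \<eta> (?z r)))\<^sup>2"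
        using schwarz_pick[OF hol_ball lt, of "?z r" a] n elim a by simp
      then have "(1 - (norm a)\<^sup>2) / (norm (1 - cnj a * ?z r))\<^sup>2 \<le>
        (1 - (norm (\<eta> (?z r)))\<^sup>2) * (1 - (norm (\<eta> a))\<^sup>2) / (norm (1 - cnj (\<eta> a) * \<eta> (?z r)))\<^sup>2 / (1 - r\<^sup>2)"
        unfolding pos_le_divide_eq[OF r] by (simp only: mult.commute)
      then show ?case by (simp add: mult_ac)
    qed
  qed simp
  then show ?thesis using w one by (simp add: P)
qed

end

lemma finite_blaschke_selfmap:
  assumes B: "finite_blaschke_product B" and B0: "B 0 = 0"
  shows "\<exists>S. disc_selfmap_boundary B S"
proof -
  obtain c k a where c: "norm c = 1" and k: "k \<ge> (1::nat)" and a': "\<forall>j\<in>{1..k}. norm (a j) < 1"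
    and Bdef: "B = (\<lambda>z. c * (\<Prod>j=1..k. (z - a j) / (1 - cnj (a j) * z)))"
    using B unfolding finite_blaschke_product_def mem_ball_0 by (elim exE conjE) (rule that; assumption)
  note a = a'[rule_format]
  define S where "S = (\<Inter>j\<in>{1..k}. {z. 1 - cnj (a j) * z \<noteq> 0})"
  show ?thesis
  proof (intro exI[of _ S], unfold_locales)
    show "open S" unfolding S_def
      by (intro open_INT ballI open_Collect_neq continuous_intros) auto
    show "cball 0 1 \<subseteq> S" using a one_minus_cnj_mult_nonzero by (auto simp: S_def)
    show "B holomorphic_on S" unfolding Bdef by (intro holomorphic_intros) (auto simp: S_def)
    have nB: "norm (B z) = (\<Prod>j=1..k. norm ((z - a j) / (1 - cnj (a j) * z)))" for z
      using c by (simp add: Bdef norm_mult prod_norm)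
    show "norm (B z) < 1" if z: "norm z < 1" for z
    proof -
      have f: "norm ((z - a j) / (1 - cnj (a j) * z)) < 1" if "j \<in> {1..k}" for j
        using Moebius_function_norm_lt_1[OF a[OF that] z, of 0] by (simp add: Moebius_function_simple)
      have "norm (B z) = norm ((z - a 1) / (1 - cnj (a 1) * z)) * (\<Prod>j\<in>{1..k}-{1}. norm ((z - a j) / (1 -
          cnj (a j) * z)))"
        unfolding nB using k by (intro prod.remove) auto
      also have "\<dots> \<le> norm ((z - a 1) / (1 - cnj (a 1) * z)) * 1"
        using f by (intro mult_left_mono prod_le_1) (auto intro: less_imp_le)
      also have "\<dots> < 1" using f[of 1] k by simp
      finally show ?thesis .
    qed
    show "norm (B z) = 1" if z: "norm z = 1" for z
    proof -
      have "norm ((z - a j) / (1 - cnj (a j) * z)) = 1" if j: "j \<in> {1..k}" for j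
      proof -
        have "1 - (norm ((z - a j) / (1 - cnj (a j) * z)))\<^sup>2 = 0"
          using moebius_norm[of "a j" z] one_minus_cnj_mult_nonzero[OF a[OF j], of z] z by simp
        then show ?thesis by (simp add: power2_eq_1_iff) (smt (verit) norm_ge_zero)
      qed
      then show ?thesis unfolding nB by simp
    qed
  qed (rule B0)
qed

section \<open>Asymptotics of kernel integrals\<close>

lemma jordan_sin_ge:
  fixes x :: real
  assumes "0 \<le> x" "x \<le> pi / 2"
  shows "2 * x / pi \<le> sin x"
proof -
  have "convex_on {0..pi} (\<lambda>x::real. - sin x)"
    by (rule f''_ge0_imp_convex[where f' = "\<lambda>x. - cos x" and f'' = sin])
       (auto intro!: derivative_eq_intros sin_ge_zero)
  from convex_onD[OF this, of "2 * x / pi" 0 "pi / 2"] assms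
  show ?thesis by (simp add: field_simps)
qed

lemma one_minus_cos_ge:
  assumes "\<bar>t\<bar> \<le> pi"
  shows "2 * t\<^sup>2 / pi\<^sup>2 \<le> 1 - cos t"
proof -
  have "2 * (\<bar>t\<bar> / 2) / pi \<le> sin (\<bar>t\<bar> / 2)" using assms by (intro jordan_sin_ge) auto
  then have "(2 * (\<bar>t\<bar> / 2) / pi)\<^sup>2 \<le> (sin (\<bar>t\<bar> / 2))\<^sup>2" by (intro power_mono) auto
  moreover have "cos t = 1 - 2 * (sin (\<bar>t\<bar> / 2))\<^sup>2"
  proof -
    have "cos t = cos \<bar>t\<bar>" by (cases "t < 0") auto
    then show ?thesis using cos_double_sin[of "\<bar>t\<bar> / 2"] by simp
  qed
  ultimately show ?thesis by (simp add: power_divide)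
qed

lemma norm_one_minus_cis: "(norm (1 - of_real r * cis t))\<^sup>2 = (1 - r)\<^sup>2 + 2 * r * (1 - cos t)"
proof -
  have "(norm (1 - of_real r * cis t))\<^sup>2 = (1 - r * cos t)\<^sup>2 + (r * sin t)\<^sup>2"
    by (simp add: cmod_power2)
  also have "\<dots> = 1 - 2 * r * cos t + r\<^sup>2 * ((sin t)\<^sup>2 + (cos t)\<^sup>2)"
  proof -
    have "(1 - r * c)\<^sup>2 + (r * d)\<^sup>2 = 1 - 2 * r * c + r\<^sup>2 * (d\<^sup>2 + c\<^sup>2)" for c d :: real
      by (simp add: power2_eq_square algebra_simps)
    then show ?thesis by blast
  qed
  also have "\<dots> = (1 - r)\<^sup>2 + 2 * r * (1 - cos t)"
    by (simp only: sin_cos_squared_add) (simp add: power2_eq_square algebra_simps)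
  finally show ?thesis .
qed

lemma norm_cis_diff_ge:
  assumes "\<bar>t - s\<bar> \<le> pi"
  shows "2 / pi * \<bar>t - s\<bar> \<le> norm (cis t - cis s)"
proof (rule power2_le_imp_le)
  have "cis t - cis s = - (cis s * (1 - of_real 1 * cis (t - s)))"
    by (simp add: algebra_simps cis_mult)
  then have "norm (cis t - cis s) = norm (1 - of_real 1 * cis (t - s))"
    by (simp only: norm_minus_cancel norm_mult norm_cis mult_1_left)
  then have "(norm (cis t - cis s))\<^sup>2 = 2 * (1 - cos (t - s))"
    by (simp only: norm_one_minus_cis) simp
  then show "(2 / pi * \<bar>t - s\<bar>)\<^sup>2 \<le> (norm (cis t - cis s))\<^sup>2"
    using one_minus_cos_ge[OF assms] by (simp add: power_mult_distrib power_divide)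
qed simp

section \<open>Rotation invariance and rescaling of circle integrals\<close>

lemma disc_selfmap_rotation: "norm c = 1 \<Longrightarrow> disc_selfmap_boundary (\<lambda>z. c * z) UNIV"
  by unfold_locales (auto simp: norm_mult intro!: holomorphic_intros)

text \<open>A rotation is an inner function fixing 0, so this is an instance of measure
  preservation.\<close>

lemma circle_rotation:
  fixes H :: "complex \<Rightarrow> 'b::{banach, second_countable_topology}"
  assumes c: "norm c = 1" and H: "H \<in> borel_measurable borel"
  shows "(LINT w|\<mu>. H (c * w)) = (LINT w|\<mu>. H w)"
proof -
  interpret disc_selfmap_boundary "\<lambda>z. c * z" UNIV by (rule disc_selfmap_rotation[OF c])
  have "(LINT w|\<mu>. H (c * w)) = (LINT w|\<mu>. H (boundary_fun (\<lambda>z. c * z) w))"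
    by (intro Bochner_Integration.integral_cong) (auto simp: space_circle_measure boundary)
  also have "\<dots> = (LINT w|\<mu>. H w)" by (rule inner_transfer(1)[OF inner zero H])
  finally show ?thesis .
qed

text \<open>The reflection \<open>w \<mapsto> - w\<close> centres the parameter interval at the
  point 1, where the kernels peak. The factor \<open>Y\<close> will be \<open>1 / (1 - r)\<close>,
  the magnification at which they have a limit profile.\<close>

lemma integral_circle_symmetric:
  fixes H :: "complex \<Rightarrow> real"
  assumes H: "H \<in> borel_measurable borel" and Y: "0 < Y"
  shows "(LINT w|\<mu>. H w) = (1 / (2*pi)) * ((1 / Y) * (LINT x|lborel. indicator {-pi * Y..pi * Y} x * H
      (cis (x / Y))))"
proof -
  have Hm: "(\<lambda>w. H (- w)) \<in> borel_measurable (restrict_space borel (sphere 0 1))"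
    by (rule measurable_restrict_space1) (use H in measurable)
  have "(LINT w|\<mu>. H w) = (LINT w|\<mu>. H (- 1 * w))"
    by (rule circle_rotation[OF _ H, symmetric]) simp
  also have "\<dots> = (1 / (2*pi)) * (LINT t:{0..2*pi}|lborel. H (- cis t))"
    using integrable_circle_iff(2)[OF Hm] by simp
  also have "(LINT t:{0..2*pi}|lborel. H (- cis t)) =
      \<bar>1 / Y\<bar> * (LINT x|lborel. indicator {0..2*pi} (pi + 1 / Y * x) * H (- cis (pi + 1 / Y * x)))"
    unfolding set_lebesgue_integral_def using Y
    by (subst lborel_integral_real_affine[where c = "1 / Y" and t = pi]) auto
  also have "(\<lambda>x. indicator {0..2*pi} (pi + 1 / Y * x) * H (- cis (pi + 1 / Y * x))) =
      (\<lambda>x. indicator {-pi * Y..pi * Y} x * H (cis (x / Y)))"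
  proof
    fix x
    have "- cis (pi + 1 / Y * x) = cis (x / Y)" by (simp add: cis_mult[symmetric])
    moreover have "pi + 1 / Y * x \<in> {0..2*pi} \<longleftrightarrow> x \<in> {-pi * Y..pi * Y}"
      using Y by (auto simp: field_simps)
    ultimately show "indicator {0..2*pi} (pi + 1 / Y * x) * H (- cis (pi + 1 / Y * x)) =
      indicator {-pi * Y..pi * Y} x * H (cis (x / Y))" by (simp add: indicator_def)
  qed
  finally show ?thesis using Y by simp
qed

lemma integrable_one_plus_abs_powr:
  fixes s :: real
  assumes s: "1 < s"
  shows "integrable lborel (\<lambda>x::real. (1 + \<bar>x\<bar>) powr (-s))"
proof -
  let ?f = "\<lambda>x::real. (1 + \<bar>x\<bar>) powr (-s)"
  have fm: "?f \<in> borel_measurable borel" by measurable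
  let ?F = "\<lambda>x::real. - ((1 + x) powr (1 - s)) / (s - 1)"
  have nn: "(\<integral>\<^sup>+x. ennreal ((1 + x) powr (-s)) * indicator {0..} x \<partial>lborel) = ennreal (0 - ?F 0)"
  proof (rule nn_integral_FTC_atLeast)
    show "(?F \<longlongrightarrow> 0) at_top" using s by real_asymp
    show "DERIV ?F x :> (1 + x) powr (-s)" if "0 \<le> x" for x
    proof -
      have "((\<lambda>x. 1 + x) has_real_derivative 1) (at x)" by (auto intro!: derivative_eq_intros)
      from DERIV_chain2[OF has_real_derivative_powr this, of "1 - s"] that
      have "((\<lambda>x. (1 + x) powr (1 - s)) has_real_derivative (1 - s) * (1 + x) powr (-s)) (at x)" by simp
      from DERIV_cdivide[OF DERIV_minus[OF this], of "s - 1"]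
      show ?thesis
        by (rule DERIV_cong) (use s in \<open>simp add: minus_divide_left minus_mult_left\<close>)
    qed
  qed auto
  have "has_bochner_integral lborel (\<lambda>x. indicator {0..} x *\<^sub>R ?f x) (0 - ?F 0)"
  proof (rule has_bochner_integral_nn_integral)
    show "(\<integral>\<^sup>+x. ennreal (indicator {0..} x *\<^sub>R ?f x) \<partial>lborel) = ennreal (0 - ?F 0)"
      unfolding nn[symmetric] by (intro nn_integral_cong) (auto simp: indicator_def)
    show "0 \<le> 0 - ?F 0" using s by simp
  qed auto
  then have "has_bochner_integral lborel ?f (2 *\<^sub>R (0 - ?F 0))"
    by (rule has_bochner_integral_even_function) simp
  then show ?thesis by (auto simp: has_bochner_integral_iff)
qed

section \<open>Growth of the kernel integrals at the boundary\<close>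

definition kernel_integral :: "real \<Rightarrow> real \<Rightarrow> real" where
  "kernel_integral s r = (LINT w|\<mu>. norm (1 - of_real r * w) powr (-s))"

text \<open>The integral of the limit profile: near the point 1, \<open>1 - r * cis t\<close> with
  \<open>t = (1 - r) * x\<close> is approximately \<open>(1 - r) * (1 - \<i> * x)\<close>.\<close>

definition kernel_constant :: "real \<Rightarrow> real" where
  "kernel_constant s = (1 / (2*pi)) * (LINT x|lborel. (sqrt (1 + x\<^sup>2)) powr (-s))"

text \<open>Uniformity in \<open>Y\<close> is the point: raised to the power \<open>- s\<close> this
  is the integrable majorant for dominated convergence. The condition \<open>2 \<le> Y\<close> keeps
  the radius \<open>1 - 1 / Y\<close> above 1/2.\<close>

lemma kernel_scaled_ge:
  assumes Y: "2 \<le> Y" and x: "\<bar>x\<bar> \<le> pi * Y"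
  shows "(1 + \<bar>x\<bar>) / pi \<le> Y * norm (1 - of_real (1 - 1 / Y) * cis (x / Y))"
proof (rule power2_le_imp_le)
  have "\<bar>x / Y\<bar> \<le> pi" using assms by (simp add: field_simps)
  then have c: "2 * (x / Y)\<^sup>2 / pi\<^sup>2 \<le> 1 - cos (x / Y)" by (rule one_minus_cos_ge)
  have "(1 + \<bar>x\<bar>)\<^sup>2 \<le> 2 * (1 + x\<^sup>2)"
    using zero_le_power2[of "1 - \<bar>x\<bar>"] by (simp add: power2_eq_square algebra_simps abs_mult_self_eq)
  also have "2 * (1 + x\<^sup>2) \<le> pi\<^sup>2 + 2 * x\<^sup>2"
    using power_mono[of 2 pi 2] pi_ge_two by simp
  finally have "((1 + \<bar>x\<bar>) / pi)\<^sup>2 \<le> 1 + 2 * x\<^sup>2 / pi\<^sup>2" by (simp add: power_divide pos_divide_le_eq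
      distrib_right)
  also have "1 + 2 * x\<^sup>2 / pi\<^sup>2 = Y\<^sup>2 * ((1 / Y)\<^sup>2 + 2 * (1/2) * (2 * (x / Y)\<^sup>2 / pi\<^sup>2)) "
    using Y by (simp add: power_divide distrib_left)
  also have "\<dots> \<le> Y\<^sup>2 * ((1 / Y)\<^sup>2 + 2 * (1 - 1 / Y) * (1 - cos (x / Y)))"
  proof -
    have h: "1 / 2 \<le> 1 - 1 / Y" using Y by (simp add: le_diff_eq field_simps)
    show ?thesis using c h by (intro mult_left_mono add_left_mono mult_mono) auto
  qed
  also have "\<dots> = (Y * norm (1 - of_real (1 - 1 / Y) * cis (x / Y)))\<^sup>2"
    unfolding power_mult_distrib norm_one_minus_cis by simp
  finally show "((1 + \<bar>x\<bar>) / pi)\<^sup>2 \<le> (Y * norm (1 - of_real (1 - 1 / Y) * cis (x / Y)))\<^sup>2" .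
qed (use Y in auto)

lemma kernel_scaled_tendsto:
  "((\<lambda>Y. Y * norm (1 - of_real (1 - 1 / Y) * cis (x / Y))) \<longlongrightarrow> sqrt (1 + x\<^sup>2)) at_top"
proof -
  have "((\<lambda>Y::real. 1 + 2 * (1 - 1 / Y) * (Y\<^sup>2 * (1 - cos (x / Y)))) \<longlongrightarrow> 1 + x\<^sup>2) at_top"
    unfolding power2_eq_square[of x] by real_asymp
  then have "((\<lambda>Y::real. sqrt (1 + 2 * (1 - 1 / Y) * (Y\<^sup>2 * (1 - cos (x / Y))))) \<longlongrightarrow> sqrt (1 + x\<^sup>2)) at_top"
    by (rule tendsto_real_sqrt)
  then show ?thesis
  proof (rule Lim_transform_eventually)
    show "eventually (\<lambda>Y. sqrt (1 + 2 * (1 - 1 / Y) * (Y\<^sup>2 * (1 - cos (x / Y)))) = Y * norm (1 - of_real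
        (1 - 1 / Y) * cis (x / Y))) at_top"
      using eventually_gt_at_top[of 0]
    proof eventually_elim
      case (elim Y)
      have "(Y * norm (1 - of_real (1 - 1 / Y) * cis (x / Y)))\<^sup>2 = Y\<^sup>2 * ((1 / Y)\<^sup>2 + 2 * (1 - 1 / Y) * (1
          - cos (x / Y)))"
        unfolding power_mult_distrib norm_one_minus_cis by simp
      also have "\<dots> = 1 + 2 * (1 - 1 / Y) * (Y\<^sup>2 * (1 - cos (x / Y)))"
        using elim by (simp add: field_simps)
      finally show ?case using elim by (intro real_sqrt_unique) auto
    qed
  qed
qed

lemma kernel_integral_scaled:
  assumes Y: "0 < Y"
  shows "(1 / Y) powr (s - 1) * kernel_integral s (1 - 1 / Y) =
    (1 / (2*pi)) * (LINT x|lborel. indicator {-pi * Y..pi * Y} x * (Y * norm (1 - of_real (1 - 1 / Y) *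
        cis (x / Y))) powr (-s))"
proof -
  have K: "kernel_integral s (1 - 1 / Y) = (1 / (2*pi)) * ((1 / Y) * (LINT x|lborel. indicator {-pi *
      Y..pi * Y} x *
      norm (1 - of_real (1 - 1 / Y) * cis (x / Y)) powr (-s)))"
    unfolding kernel_integral_def by (rule integral_circle_symmetric[OF _ Y]) measurable
  have A: "(1 / Y) powr (s - 1) * (1 / Y) = Y powr (-s)"
  proof -
    have "(1 / Y) powr (s - 1) * (1 / Y) = (1 / Y) powr (s - 1) * (1 / Y) powr 1" using Y by simp
    also have "\<dots> = (1 / Y) powr s" unfolding powr_add[symmetric] by simp
    finally show ?thesis using Y by (simp add: powr_minus powr_divide inverse_eq_divide)
  qed
  have "(LINT x|lborel. indicator {-pi * Y..pi * Y} x * (Y * norm (1 - of_real (1 - 1 / Y) * cis (x / Y)))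
      powr (-s))
     = Y powr (-s) * (LINT x|lborel. indicator {-pi * Y..pi * Y} x * norm (1 - of_real (1 - 1 / Y) * cis
         (x / Y)) powr (-s))"
    using Y by (simp add: powr_mult mult_ac flip: integral_mult_right_zero)
  then show ?thesis unfolding K A[symmetric] by (simp only: mult_ac)
qed

lemma kernel_integral_asymptotics:
  assumes s: "1 < s"
  shows "((\<lambda>r. (1 - r) powr (s - 1) * kernel_integral s r) \<longlongrightarrow> kernel_constant s) (at_left 1)"
proof -
  let ?g = "\<lambda>Y x. indicator {-pi * Y..pi * Y} x * (Y * norm (1 - of_real (1 - 1 / Y) * cis (x / Y))) powr (-s)"
  have "((\<lambda>Y. LINT x|lborel. ?g Y x) \<longlongrightarrow> (LINT x|lborel. (sqrt (1 + x\<^sup>2)) powr (-s))) at_top"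
  proof (rule integral_dominated_convergence_at_top)
    show "(\<lambda>x::real. (sqrt (1 + x\<^sup>2)) powr (-s)) \<in> borel_measurable lborel" by measurable
    show "?g Y \<in> borel_measurable lborel" for Y by measurable
    show "integrable lborel (\<lambda>x. pi powr s * (1 + \<bar>x\<bar>) powr (-s))"
      using integrable_one_plus_abs_powr[OF s] by simp
    show "AE x in lborel. ((\<lambda>Y. ?g Y x) \<longlongrightarrow> (sqrt (1 + x\<^sup>2)) powr (-s)) at_top"
    proof (rule AE_I2)
      fix x :: real
      have "1 + x\<^sup>2 \<noteq> 0" by (smt (verit) zero_le_power2)
      then have "((\<lambda>Y. (Y * norm (1 - of_real (1 - 1 / Y) * cis (x / Y))) powr (-s)) \<longlongrightarrow> (sqrt (1 + x\<^sup>2))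
          powr (-s)) at_top"
        by (intro tendsto_powr kernel_scaled_tendsto tendsto_const) auto
      then show "((\<lambda>Y. ?g Y x) \<longlongrightarrow> (sqrt (1 + x\<^sup>2)) powr (-s)) at_top"
      proof (rule Lim_transform_eventually)
        show "eventually (\<lambda>Y. (Y * norm (1 - of_real (1 - 1 / Y) * cis (x / Y))) powr (-s) = ?g Y x) at_top"
          using eventually_ge_at_top[of "\<bar>x\<bar>"]
        proof eventually_elim
          case (elim Y)
          have "0 \<le> Y" using elim by linarith
          then have "1 * Y \<le> pi * Y" using pi_ge_two by (intro mult_right_mono) auto
          then have "\<bar>x\<bar> \<le> pi * Y" using elim by simp
          then show ?case by (auto simp: indicator_def abs_le_iff)
        qed
      qed
    qed
    show "eventually (\<lambda>Y. AE x in lborel. norm (?g Y x) \<le> pi powr s * (1 + \<bar>x\<bar>) powr (-s)) at_top"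
      using eventually_ge_at_top[of 2]
    proof eventually_elim
      case (elim Y)
      show ?case
      proof (rule AE_I2)
        fix x :: real
        show "norm (?g Y x) \<le> pi powr s * (1 + \<bar>x\<bar>) powr (-s)"
        proof (cases "\<bar>x\<bar> \<le> pi * Y")
          case True
          have "(Y * norm (1 - of_real (1 - 1 / Y) * cis (x / Y))) powr (-s) \<le> ((1 + \<bar>x\<bar>) / pi) powr (-s)"
            using s by (intro powr_mono2' kernel_scaled_ge elim True) auto
          also have "\<dots> = pi powr s * (1 + \<bar>x\<bar>) powr (-s)"
            by (simp add: powr_divide powr_minus field_simps)
          finally show ?thesis by (auto simp: indicator_def)
        qed (auto simp: indicator_def)
      qed
    qed
  qed
  then have "((\<lambda>Y. (1 / (2*pi)) * (LINT x|lborel. ?g Y x)) \<longlongrightarrow> kernel_constant s) at_top"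
    unfolding kernel_constant_def by (rule tendsto_mult_left)
  then have "((\<lambda>Y. (1 / Y) powr (s - 1) * kernel_integral s (1 - 1 / Y)) \<longlongrightarrow> kernel_constant s) at_top"
    by (rule Lim_transform_eventually)
      (use eventually_gt_at_top[of 0] in \<open>eventually_elim, simp only: kernel_integral_scaled\<close>)
  moreover have "filterlim (\<lambda>r::real. 1 / (1 - r)) at_top (at_left 1)" by real_asymp
  ultimately have "((\<lambda>r. (1 / (1 / (1 - r))) powr (s - 1) * kernel_integral s (1 - 1 / (1 / (1 - r)))) \<longlongrightarrow>
      kernel_constant s) (at_left 1)"
    by (rule filterlim_compose)
  then show ?thesis by simp
qed

lemma kernel_constant_pos:
  assumes s: "1 < s"
  shows "0 < kernel_constant s"
proof -
  let ?f = "\<lambda>x::real. (sqrt (1 + x\<^sup>2)) powr (-s)"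
  have fi: "integrable lborel ?f"
  proof (rule Bochner_Integration.integrable_bound)
    show "integrable lborel (\<lambda>x. pi powr s * (1 + \<bar>x\<bar>) powr (-s))"
      using integrable_one_plus_abs_powr[OF s] by simp
    show "AE x in lborel. norm (?f x) \<le> norm (pi powr s * (1 + \<bar>x\<bar>) powr (-s))"
    proof (rule AE_I2)
      fix x :: real
      have "(1 + \<bar>x\<bar>)\<^sup>2 \<le> 2 * (1 + x\<^sup>2)"
        using zero_le_power2[of "1 - \<bar>x\<bar>"] by (simp add: power2_eq_square algebra_simps abs_mult_self_eq)
      also have "\<dots> \<le> pi\<^sup>2 * (1 + x\<^sup>2)"
        using power_mono[of 2 pi 2] pi_ge_two by (intro mult_right_mono) auto
      finally have "((1 + \<bar>x\<bar>) / pi)\<^sup>2 \<le> 1 + x\<^sup>2" by (simp add: power_divide field_simps)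
      then have "(1 + \<bar>x\<bar>) / pi \<le> sqrt (1 + x\<^sup>2)" by (rule real_le_rsqrt)
      then have "?f x \<le> ((1 + \<bar>x\<bar>) / pi) powr (-s)" using s by (intro powr_mono2') auto
      also have "\<dots> = pi powr s * (1 + \<bar>x\<bar>) powr (-s)" by (simp add: powr_divide powr_minus field_simps)
      finally show "norm (?f x) \<le> norm (pi powr s * (1 + \<bar>x\<bar>) powr (-s))" by simp
    qed
  qed measurable
  have "(LINT x|lborel. indicator {0..1::real} x *\<^sub>R (sqrt 2 powr (-s))) \<le> (LINT x|lborel. ?f x)"
  proof (rule integral_mono)
    show "integrable lborel (\<lambda>x::real. indicator {0..1} x *\<^sub>R (sqrt 2 powr (-s)))"
      by (intro integrable_scaleR_left) simp
    fix x :: real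
    show "indicator {0..1} x *\<^sub>R (sqrt 2 powr (-s)) \<le> ?f x"
    proof (cases "x \<in> {0..1}")
      case True
      then have "sqrt (1 + x\<^sup>2) \<le> sqrt 2" by (simp add: power_le_one)
      then have "sqrt 2 powr (-s) \<le> ?f x" using s by (intro powr_mono2') (auto simp: add_pos_nonneg)
      then show ?thesis using True by simp
    qed simp
  qed (rule fi)
  moreover have "(LINT x|lborel. indicator {0..1::real} x *\<^sub>R (sqrt 2 powr (-s))) = sqrt 2 powr (-s)"
    by simp
  ultimately show ?thesis unfolding kernel_constant_def by (smt (verit) mult_pos_pos pi_gt_zero
      powr_gt_zero real_sqrt_gt_zero zero_less_divide_iff)
qed

lemma kernel_integral_eq:
  assumes "norm a < 1"
  shows "(LINT w|\<mu>. norm (1 - cnj a * w) powr (-s)) = kernel_integral s (norm a)"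
proof -
  obtain u where u: "norm u = 1" "cnj a = of_real (norm a) * u"
  proof (cases "a = 0")
    case False
    then have "norm (sgn (cnj a)) = 1" by (simp add: norm_sgn)
    moreover have "cnj a = of_real (norm a) * sgn (cnj a)" using False by (simp add: sgn_eq)
    ultimately show thesis by (rule that)
  qed (use that[of 1] in simp)
  have "(LINT w|\<mu>. norm (1 - cnj a * w) powr (-s)) =
    (LINT w|\<mu>. norm (1 - of_real (norm a) * (u * w)) powr (-s))"
    by (simp only: u(2) mult.assoc)
  also have "\<dots> = kernel_integral s (norm a)"
    unfolding kernel_integral_def by (rule circle_rotation[OF u(1)]) measurable
  finally show ?thesis .
qed

lemma one_minus_norm_le:
  assumes "norm a < 1" "norm w = 1"
  shows "1 - norm a \<le> norm (1 - cnj a * w)"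
  using norm_triangle_ineq2[of 1 "cnj a * w"] assms by (simp add: norm_mult)

lemma integrable_kernel:
  assumes "norm a < 1"
  shows "integrable \<mu> (\<lambda>w. norm (1 - cnj a * w) powr (-s))"
  using one_minus_cnj_mult_nonzero[OF assms]
  by (intro integrable_circle_continuous continuous_intros) auto

lemma kernel_integral_bounded:
  assumes s: "1 < s"
  obtains K where "0 < K" "\<And>r. 0 \<le> r \<Longrightarrow> r < 1 \<Longrightarrow> kernel_integral s r \<le> K * (1 - r) powr (1 - s)"
proof -
  have "eventually (\<lambda>r. (1 - r) powr (s - 1) * kernel_integral s r < kernel_constant s + 1) (at_left 1)"
    using kernel_integral_asymptotics[OF s] by (rule order_tendstoD) simp
  then obtain r0 where r0: "r0 < 1" "\<And>r. r0 < r \<Longrightarrow> r < 1 \<Longrightarrow> (1 - r) powr (s - 1) * kernel_integral s r <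
      kernel_constant s + 1"
    unfolding eventually_at_left_field by blast
  \<comment> \<open>The first summand serves radii beyond \<open>r0\<close>, where the asymptotics
    hold; the second serves radii up to \<open>r0\<close>, where the integrand itself is at most
    \<open>(1 - r0) powr (-s)\<close>.\<close>
  let ?K = "(kernel_constant s + 1) + (1 - r0) powr (-s)"
  show thesis
  proof (rule that[of ?K])
    show K: "0 < ?K" using kernel_constant_pos[OF s] powr_ge_zero[of "1 - r0" "-s"] by linarith
    fix r :: real assume r: "0 \<le> r" "r < 1"
    have "(1 - r) powr (s - 1) * kernel_integral s r \<le> ?K"
    proof (cases "r0 < r")
      case True
      then show ?thesis using r0(2)[OF True r(2)] powr_ge_zero[of "1 - r0" "-s"] by linarith
    next
      case False
      have r1: "norm (of_real r :: complex) < 1" using r by simp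
      have "kernel_integral s r \<le> (LINT w|\<mu>. (1 - r0) powr (-s))"
        unfolding kernel_integral_def
      proof (rule integral_mono)
        show "integrable \<mu> (\<lambda>w. norm (1 - of_real r * w) powr (-s))"
          using integrable_kernel[OF r1, of s] by simp
        fix w assume "w \<in> space \<mu>"
        then have "1 - r \<le> norm (1 - of_real r * w)"
          using one_minus_norm_le[OF r1, of w] r by (simp add: space_circle_measure)
        then show "norm (1 - of_real r * w) powr (-s) \<le> (1 - r0) powr (-s)"
          using s False r0(1) by (intro powr_mono2') auto
      qed simp
      then have le: "kernel_integral s r \<le> (1 - r0) powr (-s)" using circle.prob_space by simp
      have "(1 - r) powr (s - 1) \<le> 1" using r s by (intro powr_le1) auto
      then have "(1 - r) powr (s - 1) * kernel_integral s r \<le> 1 * (1 - r0) powr (-s)"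
        using le by (intro mult_mono) (auto simp: kernel_integral_def intro!: integral_nonneg_AE)
      then show ?thesis using kernel_constant_pos[OF s] by linarith
    qed
    then have "(1 - r) powr (1 - s) * ((1 - r) powr (s - 1) * kernel_integral s r) \<le> (1 - r) powr (1 - s) * ?K"
      by (rule mult_left_mono) simp
    moreover have "(1 - r) powr (1 - s) * (1 - r) powr (s - 1) = 1"
      using r by (simp flip: powr_add)
    then have "(1 - r) powr (1 - s) * ((1 - r) powr (s - 1) * kernel_integral s r) = kernel_integral s r"
      by (simp only: mult.assoc[symmetric] mult_1_left)
    ultimately show "kernel_integral s r \<le> ?K * (1 - r) powr (1 - s)"
      by (simp only: mult.commute)
  qed
qed

section \<open>The lower bound\<close>

text \<open>Normalised by \<open>x + y\<close>, both terms lie in [0, 1], where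
  \<open>t \<le> t powr p\<close>.\<close>

lemma powr_add_le:
  fixes x y p :: real
  assumes "0 \<le> x" "0 \<le> y" "0 < p" "p < 1"
  shows "(x + y) powr p \<le> x powr p + y powr p"
proof (cases "x + y = 0")
  case False
  then have s: "0 < x + y" using assms by simp
  have *: "t \<le> t powr p" if "0 \<le> t" "t \<le> 1" for t :: real
    using powr_mono'[of p 1 t] that assms by (cases "t = 0") auto
  have "1 = x / (x + y) + y / (x + y)" using s by (simp flip: add_divide_distrib)
  also have "\<dots> \<le> (x / (x + y)) powr p + (y / (x + y)) powr p"
    using assms s by (intro add_mono *) auto
  also have "\<dots> = (x powr p + y powr p) / (x + y) powr p"
    using assms s by (simp add: powr_divide add_divide_distrib)
  finally show ?thesis using s by (simp add: le_divide_eq)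
qed (use assms in auto)

lemma powr_sum_le:
  fixes f :: "'a \<Rightarrow> real"
  assumes "finite A" "\<And>i. i \<in> A \<Longrightarrow> 0 \<le> f i" "0 < p" "p < 1"
  shows "(\<Sum>i\<in>A. f i) powr p \<le> (\<Sum>i\<in>A. f i powr p)"
  using assms(1,2)
proof (induction rule: finite_induct)
  case (insert x F)
  have "(f x + (\<Sum>i\<in>F. f i)) powr p \<le> f x powr p + (\<Sum>i\<in>F. f i) powr p"
    using insert.prems assms(3,4) by (intro powr_add_le sum_nonneg) auto
  also have "\<dots> \<le> f x powr p + (\<Sum>i\<in>F. f i powr p)"
    using insert by (intro add_left_mono) auto
  finally show ?case using insert by simp
qed simp

lemma divide_powr_mult_powr:
  fixes x y s :: real
  assumes "0 < x" "0 < y"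
  shows "(x / y) powr (1 - s) * x powr (s - 1) = y powr (s - 1)"
proof -
  have "x powr (1 - s) * x powr (s - 1) = 1" "y powr (1 - s) * y powr (s - 1) = 1"
    using assms by (simp_all flip: powr_add)
  then show ?thesis using assms by (simp add: powr_divide divide_eq_eq mult.commute)
qed

lemma norm_deriv_kernel:
  assumes "norm a < 1" "norm w = 1"
  shows "norm (deriv_kernel n a w) powr p = fact n powr p * norm (1 - cnj a * w) powr (- (real (Suc n) * p))"
proof -
  let ?x = "norm (1 - cnj a * w)"
  have x: "0 < ?x" using one_minus_cnj_mult_nonzero[OF assms(1), of w] assms(2) by simp
  have "norm (deriv_kernel n a w) = fact n * ?x powr (- real (Suc n))"
    using assms x by (simp add: deriv_kernel_def norm_divide norm_mult norm_power powr_minus powr_realpow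
        field_simps del: power_Suc of_nat_Suc)
  then have "norm (deriv_kernel n a w) powr p = fact n powr p * ?x powr (- real (Suc n) * p)"
    by (simp only:) (simp only: powr_mult powr_powr fact_ge_zero powr_ge_zero)
  then show ?thesis by (simp only: minus_mult_left)
qed

lemma integral_norm_deriv_kernel:
  assumes "norm a < 1"
  shows "(LINT w|\<mu>. norm (deriv_kernel n a w) powr p) = fact n powr p * kernel_integral (real (Suc n) * p)
      (norm a)"
proof -
  have "(LINT w|\<mu>. norm (deriv_kernel n a w) powr p) =
      (LINT w|\<mu>. fact n powr p * norm (1 - cnj a * w) powr (- (real (Suc n) * p)))"
    using norm_deriv_kernel[OF assms] by (intro Bochner_Integration.integral_cong) (auto simp:
        space_circle_measure)
  then show ?thesis by (simp add: kernel_integral_eq[OF assms])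
qed

text \<open>Partial sums of the geometric series converge boundedly on the circle; their power of
  exponent \<open>n + 1\<close> times \<open>fact n * z ^ n\<close> gives the approximating
  polynomials.\<close>

lemma deriv_kernel_Hp:
  assumes a: "norm a < 1"
  shows "deriv_kernel n a \<in> Hp_space 1"
proof -
  let ?K = "deriv_kernel n a"
  have Kc: "continuous_on (sphere 0 1) ?K" by (rule continuous_on_deriv_kernel[OF a]) auto
  have Lp: "?K \<in> Lp_space 1"
    using integrable_deriv_kernel[OF a, of n] by (auto simp: Lp_space_def)
  define Q where "Q N = monom (fact n) n * (\<Sum>k<N. monom (cnj a ^ k) k) ^ Suc n" for N
  have Q: "poly (Q N) w = fact n * w ^ n * (\<Sum>k<N. (cnj a * w) ^ k) ^ Suc n" for N w
    by (simp add: Q_def poly_monom poly_sum poly_power power_mult_distrib del: power_Suc)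
  have na: "norm (cnj a * w) < 1" if "norm w = 1" for w using a that by (simp add: norm_mult)
  let ?B = "fact n * (1 / (1 - norm a)) ^ Suc n"
  have B: "norm (poly (Q N) w) \<le> ?B" if w: "norm w = 1" for N w
  proof -
    have "norm (\<Sum>k<N. (cnj a * w) ^ k) \<le> (\<Sum>k<N. norm a ^ k)"
      using w by (intro order.trans[OF norm_sum] sum_mono) (simp add: norm_power norm_mult)
    also have "\<dots> \<le> (\<Sum>k. norm a ^ k)" using a by (intro sum_le_suminf summable_geometric) auto
    also have "\<dots> = 1 / (1 - norm a)" using a by (intro suminf_geometric) simp
    finally have "norm (\<Sum>k<N. (cnj a * w) ^ k) ^ Suc n \<le> (1 / (1 - norm a)) ^ Suc n" by (intro power_mono) auto
    then show ?thesis unfolding Q using w by (simp add: norm_mult norm_power del: power_Suc)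
  qed
  have lim: "(\<lambda>N. poly (Q N) w) \<longlonglongrightarrow> ?K w" if w: "norm w = 1" for w
  proof -
    have "(\<lambda>k. (cnj a * w) ^ k) sums (1 / (1 - cnj a * w))" by (rule geometric_sums[OF na[OF w]])
    then have "(\<lambda>N. \<Sum>k<N. (cnj a * w) ^ k) \<longlonglongrightarrow> 1 / (1 - cnj a * w)" by (simp add: sums_def)
    then have "(\<lambda>N. poly (Q N) w) \<longlonglongrightarrow> fact n * w ^ n * (1 / (1 - cnj a * w)) ^ Suc n"
      unfolding Q by (intro tendsto_intros)
    then show ?thesis by (simp add: deriv_kernel_def power_divide del: power_Suc)
  qed
  have "(\<lambda>N. LINT w|\<mu>. norm (?K w - poly (Q N) w)) \<longlonglongrightarrow> (LINT w|\<mu>. 0)"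
  proof (rule integral_dominated_convergence)
    show "integrable \<mu> (\<lambda>w. norm (?K w) + ?B)" using integrable_deriv_kernel[OF a, of n] by auto
    show "AE w in \<mu>. (\<lambda>N. norm (?K w - poly (Q N) w)) \<longlonglongrightarrow> 0"
    proof (rule AE_I2)
      fix w assume "w \<in> space \<mu>"
      then have "norm w = 1" by (simp add: space_circle_measure)
      from tendsto_norm[OF tendsto_diff[OF tendsto_const lim[OF this]], of "?K w"]
      show "(\<lambda>N. norm (?K w - poly (Q N) w)) \<longlonglongrightarrow> 0" by simp
    qed
    show "AE w in \<mu>. norm (norm (?K w - poly (Q N) w)) \<le> norm (?K w) + ?B" for N
    proof (rule AE_I2)
      fix w assume "w \<in> space \<mu>"
      then show "norm (norm (?K w - poly (Q N) w)) \<le> norm (?K w) + ?B"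
        using norm_triangle_ineq4[of "?K w" "poly (Q N) w"] B[of w N] by (simp add: space_circle_measure)
    qed
    show "(\<lambda>w. norm (?K w - poly (Q N) w)) \<in> borel_measurable \<mu>" for N
      by (intro borel_measurable_circle_continuous continuous_intros Kc)
  qed auto
  then have l: "(\<lambda>N. LINT w|\<mu>. norm (?K w - poly (Q N) w)) \<longlonglongrightarrow> 0" by simp
  have "\<exists>P :: complex poly. Lp_norm 1 (\<lambda>z. ?K z - poly P z) < e" if e: "0 < e" for e
  proof -
    obtain N where "(LINT w|\<mu>. norm (?K w - poly (Q N) w)) < e"
      using order_tendstoD(2)[OF l e] by (auto simp: eventually_sequentially)
    then show ?thesis by (intro exI[of _ "Q N"]) (simp add: Lp_norm_def integral_nonneg_AE)
  qed
  then show ?thesis using Lp by (simp add: Hp_space_def)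
qed

lemma cexp_bound_powr:
  assumes p: "0 < p" and b: "cexp_bound p X \<eta> C" and C: "0 \<le> C" and f: "f \<in> X"
  shows "(LINT w|\<mu>. norm (cexp \<eta> f w) powr p) \<le> C powr p * (LINT w|\<mu>. norm (f w) powr p)"
proof -
  have L: "Lp_norm p g powr p = (LINT w|\<mu>. norm (g w) powr p)" for g
    using p by (simp add: Lp_norm_def powr_powr integral_nonneg_AE)
  have "Lp_norm p (cexp \<eta> f) \<le> C * Lp_norm p f" using b f by (simp add: cexp_bound_def)
  then have "Lp_norm p (cexp \<eta> f) powr p \<le> (C * Lp_norm p f) powr p"
    using p by (intro powr_mono2) (auto simp: Lp_norm_def)
  also have "\<dots> = C powr p * Lp_norm p f powr p"
    using C by (intro powr_mult)
  finally show ?thesis unfolding L .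
qed

text \<open>Measure preservation removes the boundary function from the left side and leaves an
  explicit rational function. This single inequality drives both the sharp lower bound and the
  necessity of being a finite Blaschke product.\<close>

lemma kernel_test:
  assumes inner: "inner_function \<eta>" "\<eta> 0 = 0" and p: "0 < p"
    and b: "cexp_bound p (Hp_space 1) \<eta> C" and C: "0 \<le> C" and a: "norm a < 1"
  shows "(LINT w|\<mu>. norm (\<Sum>j\<le>n. cnj (faa_di_bruno \<eta> n j a) * deriv_kernel j (\<eta> a) w) powr p)
    \<le> C powr p * (fact n powr p * kernel_integral (real (Suc n) * p) (norm a))"
proof -
  let ?G = "\<lambda>w. \<Sum>j\<le>n. cnj (faa_di_bruno \<eta> n j a) * deriv_kernel j (\<eta> a) w"
  have Gm: "(\<lambda>w. norm (?G w) powr p) \<in> borel_measurable borel" by measurable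
  have cm: "cexp \<eta> (deriv_kernel n a) \<in> borel_measurable \<mu>" by (rule cexp_measurable[OF inner])
  have "(LINT w|\<mu>. norm (?G w) powr p) = (LINT w|\<mu>. norm (?G (boundary_fun \<eta> w)) powr p)"
    using inner_transfer(1)[OF inner Gm] by simp
  also have "\<dots> = (LINT w|\<mu>. norm (cexp \<eta> (deriv_kernel n a) w) powr p)"
  proof (rule integral_cong_AE)
    show "(\<lambda>w. norm (?G (boundary_fun \<eta> w)) powr p) \<in> borel_measurable \<mu>"
      using measurable_compose[OF boundary_measurable[OF inner] Gm] .
    show "(\<lambda>w. norm (cexp \<eta> (deriv_kernel n a) w) powr p) \<in> borel_measurable \<mu>"
      using cm by measurable
    show "AE w in \<mu>. norm (?G (boundary_fun \<eta> w)) powr p = norm (cexp \<eta> (deriv_kernel n a) w) powr p"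
      using cexp_deriv_kernel[OF inner a, of n] by eventually_elim simp
  qed
  also have "\<dots> \<le> C powr p * (LINT w|\<mu>. norm (deriv_kernel n a w) powr p)"
    by (rule cexp_bound_powr[OF p b C deriv_kernel_Hp[OF a]])
  finally show ?thesis unfolding integral_norm_deriv_kernel[OF a] .
qed

text \<open>As \<open>norm (1 - r * w) \<le> 2\<close>, raising the exponent costs only a constant.
  This reaches exponents at most 1, which \<open>kernel_integral_bounded\<close> does not
  cover.\<close>

lemma kernel_integral_mono:
  assumes "s' \<le> s" "0 \<le> r" "r < 1"
  shows "kernel_integral s' r \<le> 2 powr (s - s') * kernel_integral s r"
proof -
  have r1: "norm (of_real r :: complex) < 1" using assms by simp
  have i: "integrable \<mu> (\<lambda>w. norm (1 - of_real r * w) powr (-t))" for t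
    using integrable_kernel[OF r1, of t] by simp
  have "kernel_integral s' r \<le> (LINT w|\<mu>. 2 powr (s - s') * norm (1 - of_real r * w) powr (-s))"
    unfolding kernel_integral_def
  proof (rule integral_mono)
    fix w assume "w \<in> space \<mu>"
    then have w: "norm w = 1" by (simp add: space_circle_measure)
    let ?x = "norm (1 - of_real r * w)"
    have "1 - r \<le> ?x" using one_minus_norm_le[OF r1 w] assms by simp
    then have x0: "0 < ?x" using assms by linarith
    have x2: "?x \<le> 2" using norm_triangle_ineq4[of 1 "of_real r * w"] w assms by (simp add: norm_mult)
    have "?x powr (- s') = ?x powr (s - s') * ?x powr (-s)" by (simp flip: powr_add)
    also have "\<dots> \<le> 2 powr (s - s') * ?x powr (-s)"
      using x0 x2 assms by (intro mult_right_mono powr_mono2) auto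
    finally show "?x powr (- s') \<le> 2 powr (s - s') * ?x powr (-s)" .
  qed (use i in auto)
  then show ?thesis by (simp add: kernel_integral_def)
qed

section \<open>The sharp constant at a boundary point\<close>

context disc_selfmap_boundary
begin

lemma norm_le: "norm z < 1 \<Longrightarrow> norm (\<eta> z) \<le> norm z"
  by (rule Schwarz_Lemma(1)[OF hol_ball zero lt])

lemma norm_radius: "norm w = 1 \<Longrightarrow> 0 < r \<Longrightarrow> norm (of_real r * w :: complex) = r"
  by (simp add: norm_mult)

lemma radial_norm_tendsto:
  assumes w: "norm w = 1"
  shows "filterlim (\<lambda>r. norm (\<eta> (of_real r * w))) (at_left 1) (at_left 1)"
  unfolding filterlim_at
proof
  show "eventually (\<lambda>r. norm (\<eta> (of_real r * w)) \<in> {..<1} \<and> norm (\<eta> (of_real r * w)) \<noteq> 1) (at_left 1)"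
    using eventually_at_left_one
  proof eventually_elim
    case (elim r)
    then have "norm (\<eta> (of_real r * w)) < 1" using norm_radius[OF w, of r] by (intro lt) auto
    then show ?case by simp
  qed
  show "((\<lambda>r. norm (\<eta> (of_real r * w))) \<longlongrightarrow> 1) (at_left 1)"
    using tendsto_norm[OF radial_limit[OF w]] one[OF w] by simp
qed

lemma radial_ratio:
  assumes w: "norm w = 1"
  shows "((\<lambda>r. (1 - norm (\<eta> (of_real r * w))) / (1 - r)) \<longlongrightarrow> norm (deriv \<eta> w)) (at_left 1)"
proof -
  let ?\<rho> = "\<lambda>r. norm (\<eta> (of_real r * w))"
  have \<rho>: "(?\<rho> \<longlongrightarrow> 1) (at_left 1)" using radial_norm_tendsto[OF w] by (simp add: filterlim_at)
  have "((\<lambda>r. (1 - (?\<rho> r)\<^sup>2) / (1 - r\<^sup>2) * ((1 + r) / (1 + ?\<rho> r))) \<longlongrightarrow> norm (deriv \<eta> w) * ((1 + 1) / (1 +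
      1))) (at_left 1)"
    by (intro tendsto_intros \<rho> angular_derivative w) auto
  then have "((\<lambda>r. (1 - (?\<rho> r)\<^sup>2) / (1 - r\<^sup>2) * ((1 + r) / (1 + ?\<rho> r))) \<longlongrightarrow> norm (deriv \<eta> w)) (at_left 1)" by simp
  then show ?thesis
  proof (rule Lim_transform_eventually)
    show "eventually (\<lambda>r. (1 - (?\<rho> r)\<^sup>2) / (1 - r\<^sup>2) * ((1 + r) / (1 + ?\<rho> r)) = (1 - ?\<rho> r) / (1 - r))
        (at_left 1)"
      using eventually_at_left_one
    proof eventually_elim
      case (elim r)
      have f: "1 - x\<^sup>2 = (1 - x) * (1 + x)" for x :: real by (simp add: power2_eq_square algebra_simps)
      have "1 + r \<noteq> 0" "1 + ?\<rho> r \<noteq> 0" using elim norm_ge_zero[of "\<eta> (of_real r * w)"] by linarith+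
      then show ?case unfolding f by simp
    qed
  qed
qed

lemma cexp_bound_ge:
  assumes p: "0 < p" "p < 1" and b: "cexp_bound p (Hp_space 1) \<eta> C" and C: "0 \<le> C" and w: "norm w = 1"
  shows "norm (deriv \<eta> w) powr (1 / p - 1) \<le> C"
proof -
  let ?L = "norm (deriv \<eta> w)"
  have L: "1 \<le> ?L" by (rule angular_derivative(2)[OF w])
  obtain n :: nat where "1 / p - 1 < real n" using reals_Archimedean2 by blast
  define s where "s = real (Suc n) * p"
  have s: "1 < s" using \<open>1 / p - 1 < real n\<close> p by (simp add: s_def field_simps)
  let ?z = "\<lambda>r. of_real r * w :: complex" and ?\<rho> = "\<lambda>r. norm (\<eta> (of_real r * w))"
  let ?c = "\<lambda>j r. faa_di_bruno \<eta> n j (of_real r * w)"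
  have wS: "w \<in> S" using S(2) w by (auto simp: subset_iff)
  have zlim: "(?z \<longlongrightarrow> w) (at_left 1)"
  proof -
    have "(?z \<longlongrightarrow> of_real 1 * w) (at_left 1)" by (intro tendsto_intros)
    then show ?thesis by simp
  qed
  have clim: "(?c j \<longlongrightarrow> faa_di_bruno \<eta> n j w) (at_left 1)" for j
  proof -
    have "isCont (faa_di_bruno \<eta> n j) w"
      using holomorphic_on_imp_continuous_on[OF holomorphic_on_faa_di_bruno[OF hol S(1)]] S(1) wS
      by (auto simp: continuous_on_eq_continuous_at)
    then show ?thesis using zlim by (rule isCont_tendsto_compose)
  qed
  \<comment> \<open>The top term is the whole sum minus the lower terms. Subadditivity of t^p
    separates them under the integral, and the test inequality controls the whole sum.\<close>
  have ineq: "norm (?c n r) powr p * (fact n powr p * kernel_integral s (?\<rho> r))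
      - (\<Sum>j<n. norm (?c j r) powr p * (fact j powr p * kernel_integral (real (Suc j) * p) (?\<rho> r)))
      \<le> C powr p * (fact n powr p * kernel_integral s r)" if r: "0 < r" "r < 1" for r
  proof -
    have z1: "norm (?z r) < 1" using norm_radius[OF w r(1)] r by simp
    have b1: "norm (\<eta> (?z r)) < 1" by (rule lt[OF z1])
    let ?G = "\<lambda>j v. cnj (?c j r) * deriv_kernel j (\<eta> (?z r)) v"
    have Gi: "integrable \<mu> (\<lambda>v. norm (?G j v) powr p)" for j
      using p by (intro integrable_circle_continuous continuous_on_powr' continuous_intros
          continuous_on_deriv_kernel b1) auto
    have Si: "integrable \<mu> (\<lambda>v. norm (\<Sum>j\<le>n. ?G j v) powr p)"
      using p by (intro integrable_circle_continuous continuous_on_powr' continuous_intros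
          continuous_on_deriv_kernel b1) auto
    have GI: "(LINT v|\<mu>. norm (?G j v) powr p) = norm (?c j r) powr p * (fact j powr p * kernel_integral
        (real (Suc j) * p) (?\<rho> r))" for j
      by (simp add: norm_mult powr_mult integral_norm_deriv_kernel[OF b1] del: of_nat_Suc)
    have "(LINT v|\<mu>. norm (?G n v) powr p) \<le>
      (LINT v|\<mu>. norm (\<Sum>j\<le>n. ?G j v) powr p + (\<Sum>j<n. norm (?G j v) powr p))"
    proof (rule integral_mono)
      fix v
      have "norm (?G n v) = norm ((\<Sum>j\<le>n. ?G j v) - (\<Sum>j<n. ?G j v))"
        by (simp add: lessThan_Suc_atMost[symmetric])
      also have "\<dots> \<le> norm (\<Sum>j\<le>n. ?G j v) + (\<Sum>j<n. norm (?G j v))"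
        by (rule order.trans[OF norm_triangle_ineq4 add_left_mono[OF norm_sum]])
      finally have "norm (?G n v) powr p \<le> (norm (\<Sum>j\<le>n. ?G j v) + (\<Sum>j<n. norm (?G j v))) powr p"
        using p by (intro powr_mono2) auto
      also have "\<dots> \<le> norm (\<Sum>j\<le>n. ?G j v) powr p + (\<Sum>j<n. norm (?G j v)) powr p"
        using p by (intro powr_add_le sum_nonneg) auto
      also have "\<dots> \<le> norm (\<Sum>j\<le>n. ?G j v) powr p + (\<Sum>j<n. norm (?G j v) powr p)"
        using p by (intro add_left_mono powr_sum_le) auto
      finally show "norm (?G n v) powr p \<le> norm (\<Sum>j\<le>n. ?G j v) powr p + (\<Sum>j<n. norm (?G j v) powr p)" .
    qed (use Gi Si in auto)
    also have "\<dots> = (LINT v|\<mu>. norm (\<Sum>j\<le>n. ?G j v) powr p) + (\<Sum>j<n. LINT v|\<mu>. norm (?G j v) powr p)"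
      using Gi Si by (subst Bochner_Integration.integral_add) (auto intro!: Bochner_Integration.integral_sum)
    also have "(LINT v|\<mu>. norm (\<Sum>j\<le>n. ?G j v) powr p) \<le> C powr p * (fact n powr p * kernel_integral s r)"
      using kernel_test[OF inner zero p(1) b C z1, of n] norm_radius[OF w r(1)] by (simp add: s_def)
    finally show ?thesis unfolding GI by (simp add: s_def)
  qed
  have lim1: "((\<lambda>r. (1 - r) powr (s - 1) * kernel_integral s r) \<longlongrightarrow> kernel_constant s) (at_left 1)"
    by (rule kernel_integral_asymptotics[OF s])
  \<comment> \<open>Here the pole lies at distance \<open>1 - ?\<rho> r\<close> from the circle.
    Since \<open>(1 - ?\<rho> r) / (1 - r)\<close> tends to \<open>?L\<close>, normalising by
    \<open>1 - r\<close> instead costs the factor \<open>?L powr (1 - s)\<close>.\<close>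
  have lim2: "((\<lambda>r. (1 - r) powr (s - 1) * kernel_integral s (?\<rho> r)) \<longlongrightarrow> ?L powr (1 - s) * kernel_constant
      s) (at_left 1)"
  proof -
    have "((\<lambda>r. ((1 - ?\<rho> r) / (1 - r)) powr (1 - s) * ((1 - ?\<rho> r) powr (s - 1) * kernel_integral s (?\<rho> r))) \<longlongrightarrow>
        ?L powr (1 - s) * kernel_constant s) (at_left 1)"
      using L by (intro tendsto_mult tendsto_powr radial_ratio[OF w] tendsto_const
          filterlim_compose[OF lim1 radial_norm_tendsto[OF w]]) auto
    then show ?thesis
    proof (rule Lim_transform_eventually)
      show "eventually (\<lambda>r. ((1 - ?\<rho> r) / (1 - r)) powr (1 - s) * ((1 - ?\<rho> r) powr (s - 1) *
          kernel_integral s (?\<rho> r)) =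
          (1 - r) powr (s - 1) * kernel_integral s (?\<rho> r)) (at_left 1)"
        using eventually_at_left_one
      proof eventually_elim
        case (elim r)
        have "?\<rho> r < 1" using norm_radius[OF w, of r] elim by (intro lt) auto
        then have "((1 - ?\<rho> r) / (1 - r)) powr (1 - s) * (1 - ?\<rho> r) powr (s - 1) = (1 - r) powr (s - 1)"
          using elim by (intro divide_powr_mult_powr) auto
        then show ?case by (simp only: mult.assoc[symmetric])
      qed
    qed
  qed
  have lim3: "((\<lambda>r. (1 - r) powr (s - 1) * kernel_integral s' (?\<rho> r)) \<longlongrightarrow> 0) (at_left 1)" if "s' < s" for s'
  proof -
    \<comment> \<open>The growth bound needs an exponent above 1, and \<open>\<sigma> < s\<close>
      leaves the vanishing factor \<open>(1 - r) powr (s - \<sigma>)\<close>. By the Schwarz lemma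
      \<open>?\<rho> r \<le> r\<close>, so the bound at \<open>?\<rho> r\<close> is no worse than at
      \<open>r\<close>.\<close>
    define \<sigma> where "\<sigma> = (max 1 s' + s) / 2"
    have \<sigma>: "1 < \<sigma>" "s' \<le> \<sigma>" "\<sigma> < s" using that s by (auto simp: \<sigma>_def)
    obtain K where K: "0 < K" "\<And>r. 0 \<le> r \<Longrightarrow> r < 1 \<Longrightarrow> kernel_integral \<sigma> r \<le> K * (1 - r) powr (1 - \<sigma>)"
      using kernel_integral_bounded[OF \<sigma>(1)] by blast
    show ?thesis
    proof (rule tendsto_sandwich)
      show "eventually (\<lambda>r. 0 \<le> (1 - r) powr (s - 1) * kernel_integral s' (?\<rho> r)) (at_left 1)"
        by (intro always_eventually allI mult_nonneg_nonneg) (auto simp: kernel_integral_def intro!: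
            integral_nonneg_AE)
      show "eventually (\<lambda>r. (1 - r) powr (s - 1) * kernel_integral s' (?\<rho> r) \<le> 2 powr (\<sigma> - s') * K * (1 -
          r) powr (s - \<sigma>)) (at_left 1)"
        using eventually_at_left_one
      proof eventually_elim
        case (elim r)
        have z1: "norm (?z r) < 1" using norm_radius[OF w, of r] elim by simp
        have \<rho>: "?\<rho> r < 1" "?\<rho> r \<le> r" using lt[OF z1] norm_le[OF z1] norm_radius[OF w, of r] elim by auto
        have "kernel_integral s' (?\<rho> r) \<le> 2 powr (\<sigma> - s') * kernel_integral \<sigma> (?\<rho> r)"
          using \<sigma> \<rho> by (intro kernel_integral_mono) auto
        also have "\<dots> \<le> 2 powr (\<sigma> - s') * (K * (1 - ?\<rho> r) powr (1 - \<sigma>))"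
          using \<rho> by (intro mult_left_mono K) auto
        also have "\<dots> \<le> 2 powr (\<sigma> - s') * (K * (1 - r) powr (1 - \<sigma>))"
          using \<rho> elim \<sigma> K by (intro mult_left_mono powr_mono2') auto
        finally have "(1 - r) powr (s - 1) * kernel_integral s' (?\<rho> r) \<le> (1 - r) powr (s - 1) * (2 powr (\<sigma>
            - s') * (K * (1 - r) powr (1 - \<sigma>)))"
          by (rule mult_left_mono) simp
        also have "\<dots> = 2 powr (\<sigma> - s') * K * ((1 - r) powr (s - 1) * (1 - r) powr (1 - \<sigma>))"
          by (simp only: mult_ac)
        also have "(1 - r) powr (s - 1) * (1 - r) powr (1 - \<sigma>) = (1 - r) powr (s - \<sigma>)"
          by (simp flip: powr_add)
        finally show ?case .
      qed
      have "((\<lambda>r::real. (1 - r) powr (s - \<sigma>)) \<longlongrightarrow> 0) (at_left 1)" using \<sigma> by real_asymp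
      from tendsto_mult_left[OF this, of "2 powr (\<sigma> - s') * K"]
      show "((\<lambda>r::real. 2 powr (\<sigma> - s') * K * (1 - r) powr (s - \<sigma>)) \<longlongrightarrow> 0) (at_left 1)" by simp
    qed auto
  qed
  have "norm (faa_di_bruno \<eta> n n w) powr p * (fact n powr p * (?L powr (1 - s) * kernel_constant s)) -
      (\<Sum>j<n. norm (faa_di_bruno \<eta> n j w) powr p * (fact j powr p * 0)) \<le> C powr p * (fact n powr p *
          kernel_constant s)"
  proof (rule tendsto_le)
    show "((\<lambda>r. C powr p * (fact n powr p * ((1 - r) powr (s - 1) * kernel_integral s r))) \<longlongrightarrow> C powr p *
        (fact n powr p * kernel_constant s)) (at_left 1)"
      by (intro tendsto_intros lim1)
    show "((\<lambda>r. norm (?c n r) powr p * (fact n powr p * ((1 - r) powr (s - 1) * kernel_integral s (?\<rho> r))) -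
        (\<Sum>j<n. norm (?c j r) powr p * (fact j powr p * ((1 - r) powr (s - 1) * kernel_integral (real (Suc
            j) * p) (?\<rho> r))))) \<longlongrightarrow>
        norm (faa_di_bruno \<eta> n n w) powr p * (fact n powr p * (?L powr (1 - s) * kernel_constant s)) -
      (\<Sum>j<n. norm (faa_di_bruno \<eta> n j w) powr p * (fact j powr p * 0))) (at_left 1)"
      using p by (intro tendsto_diff tendsto_sum tendsto_mult tendsto_powr' tendsto_norm tendsto_const
          clim lim2 lim3)
        (auto simp: s_def)
    show "eventually (\<lambda>r. norm (?c n r) powr p * (fact n powr p * ((1 - r) powr (s - 1) * kernel_integral
        s (?\<rho> r))) -
        (\<Sum>j<n. norm (?c j r) powr p * (fact j powr p * ((1 - r) powr (s - 1) * kernel_integral (real (Suc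
            j) * p) (?\<rho> r))))
        \<le> C powr p * (fact n powr p * ((1 - r) powr (s - 1) * kernel_integral s r))) (at_left 1)"
      using eventually_at_left_one
    proof eventually_elim
      case (elim r)
      have "(1 - r) powr (s - 1) * (norm (?c n r) powr p * (fact n powr p * kernel_integral s (?\<rho> r))
        - (\<Sum>j<n. norm (?c j r) powr p * (fact j powr p * kernel_integral (real (Suc j) * p) (?\<rho> r))))
        \<le> (1 - r) powr (s - 1) * (C powr p * (fact n powr p * kernel_integral s r))"
        using ineq[of r] elim by (intro mult_left_mono) auto
      then show ?case by (simp only: right_diff_distrib sum_distrib_left mult_ac)
    qed
  qed simp
  moreover have "norm (faa_di_bruno \<eta> n n w) powr p = ?L powr (real n * p)"
  proof -
    have "norm (faa_di_bruno \<eta> n n w) = ?L ^ n" by (simp add: faa_di_bruno_top norm_power)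
    also have "\<dots> = ?L powr real n" using L by (intro powr_realpow[symmetric]) linarith
    finally show ?thesis by (simp only: powr_powr)
  qed
  ultimately have "?L powr (real n * p) * ?L powr (1 - s) * (fact n powr p * kernel_constant s) \<le> C powr p
      * (fact n powr p * kernel_constant s)"
    by (simp add: mult_ac)
  moreover have "0 < fact n powr p * kernel_constant s" using kernel_constant_pos[OF s] by simp
  ultimately have "?L powr (real n * p) * ?L powr (1 - s) \<le> C powr p" by (metis mult_le_cancel_right
      not_less_iff_gr_or_eq)
  \<comment> \<open>The auxiliary \<open>n\<close> cancels:
    \<open>n * p + 1 - (n + 1) * p = 1 - p\<close>.\<close>
  also have "?L powr (real n * p) * ?L powr (1 - s) = ?L powr (1 - p)"
    by (simp add: s_def algebra_simps flip: powr_add)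
  finally have "(?L powr (1 - p)) powr (1 / p) \<le> (C powr p) powr (1 / p)"
    using p by (intro powr_mono2) auto
  then show ?thesis using p C by (simp add: powr_powr diff_divide_distrib)
qed

end

section \<open>Characterisation of finite Blaschke products\<close>

text \<open>Approach to the circle from inside, with no restriction on the argument; limits along
  this filter are uniform over the circle.\<close>

abbreviation disc_boundary_filter :: "complex filter" where
  "disc_boundary_filter \<equiv> filtercomap norm (at_left 1)"

definition proper_on_disc :: "(complex \<Rightarrow> complex) \<Rightarrow> bool" where
  "proper_on_disc f \<longleftrightarrow> f holomorphic_on ball 0 1 \<and> ((\<lambda>z. norm (f z)) \<longlongrightarrow> 1) disc_boundary_filter"

lemma eventually_disc_boundary:
  "eventually P disc_boundary_filter \<longleftrightarrow> (\<exists>r<1. \<forall>z. r < norm z \<and> norm z < 1 \<longrightarrow> P z)"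
proof
  assume "eventually P disc_boundary_filter"
  then obtain Q where Q: "eventually Q (at_left 1)" "\<And>z::complex. Q (norm z) \<Longrightarrow> P z"
    by (auto simp: eventually_filtercomap)
  then obtain r where "r < 1" "\<And>y. r < y \<Longrightarrow> y < 1 \<Longrightarrow> Q y"
    unfolding eventually_at_left_field by blast
  then show "\<exists>r<1. \<forall>z. r < norm z \<and> norm z < 1 \<longrightarrow> P z" using Q(2) by blast
next
  assume "\<exists>r<1. \<forall>z. r < norm z \<and> norm z < 1 \<longrightarrow> P z"
  then obtain r where r: "r < 1" "\<And>z. r < norm z \<Longrightarrow> norm z < 1 \<Longrightarrow> P z" by blast
  have "eventually (\<lambda>y. r < y \<and> y < 1) (at_left 1)"
    unfolding eventually_at_left_field using r(1) by blast
  then show "eventually P disc_boundary_filter"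
    unfolding eventually_filtercomap using r(2) by blast
qed

lemma disc_boundary_maximum:
  assumes f: "f holomorphic_on ball 0 1" and lim: "((\<lambda>z. norm (f z)) \<longlongrightarrow> 1) disc_boundary_filter"
    and z: "norm z < 1"
  shows "norm (f z) \<le> 1"
proof (rule field_le_epsilon)
  fix e :: real assume "0 < e"
  then have "eventually (\<lambda>z. norm (f z) < 1 + e) disc_boundary_filter"
    using lim by (intro order_tendstoD(2)) auto
  then obtain r where r: "r < 1" "\<And>z. r < norm z \<Longrightarrow> norm z < 1 \<Longrightarrow> norm (f z) < 1 + e"
    by (auto simp: eventually_disc_boundary)
  obtain \<rho> where "max r (norm z) < \<rho>" "\<rho> < 1" using dense[of "max r (norm z)" 1] r(1) z by auto
  then have \<rho>: "r < \<rho>" "norm z < \<rho>" "\<rho> < 1" "0 < \<rho>"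
    using norm_ge_zero[of z] by (auto simp del: norm_ge_zero)
  show "norm (f z) \<le> 1 + e"
  proof (rule maximum_modulus_frontier[of f "cball 0 \<rho>"])
    show "f holomorphic_on interior (cball 0 \<rho>)" using \<rho> by (intro holomorphic_on_subset[OF f]) auto
    show "continuous_on (closure (cball 0 \<rho>)) f"
      using \<rho> by (intro continuous_on_subset[OF holomorphic_on_imp_continuous_on[OF f]]) auto
    show "norm (f w) \<le> 1 + e" if "w \<in> frontier (cball 0 \<rho>)" for w
      using that \<rho> r(2)[of w] by (auto intro: less_imp_le)
  qed (use \<rho> in auto)
qed

text \<open>The maximum principle applies to both \<open>f\<close> and \<open>1 / f\<close>, so the
  modulus is identically 1.\<close>

lemma proper_nonzero_constant:
  assumes f: "proper_on_disc f" and nz: "\<And>z. norm z < 1 \<Longrightarrow> f z \<noteq> 0"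
  shows "\<exists>c. norm c = 1 \<and> (\<forall>z\<in>ball 0 1. f z = c)"
proof -
  have hol: "f holomorphic_on ball 0 1" and lim: "((\<lambda>z. norm (f z)) \<longlongrightarrow> 1) disc_boundary_filter"
    using f by (auto simp: proper_on_disc_def)
  have hi: "(\<lambda>z. 1 / f z) holomorphic_on ball 0 1" using nz by (intro holomorphic_intros hol) auto
  have "((\<lambda>z. 1 / norm (f z)) \<longlongrightarrow> 1 / 1) disc_boundary_filter" by (intro tendsto_intros lim) auto
  then have li: "((\<lambda>z. norm (1 / f z)) \<longlongrightarrow> 1) disc_boundary_filter" by (simp add: norm_divide)
  have one: "norm (f z) = 1" if "norm z < 1" for z
  proof -
    have "1 / norm (f z) \<le> 1" using disc_boundary_maximum[OF hi li that] by (simp add: norm_divide)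
    moreover have "0 < norm (f z)" using nz[OF that] by simp
    ultimately have "1 \<le> norm (f z)" by (simp add: divide_le_eq)
    then show ?thesis using disc_boundary_maximum[OF hol lim that] by simp
  qed
  have "f constant_on ball 0 1"
    by (rule maximum_modulus_principle[OF hol _ _ open_ball order_refl, of 0]) (auto simp: one)
  then show ?thesis using one[of 0] by (auto simp: constant_on_def intro!: exI[of _ "f 0"])
qed

lemma norm_disc_boundary: "(norm \<longlongrightarrow> 1) disc_boundary_filter"
  using filterlim_filtercomap[of "norm :: complex \<Rightarrow> real" "at_left 1"] by (simp add: filterlim_at)

lemma moebius_boundary_limit:
  assumes a: "norm a < 1"
  shows "((\<lambda>z. norm ((z - a) / (1 - cnj a * z))) \<longlongrightarrow> 1) disc_boundary_filter"
proof -
  let ?\<phi> = "\<lambda>z. (z - a) / (1 - cnj a * z)"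
  have "((\<lambda>z::complex. (1 - (norm z)\<^sup>2) * ((1 - (norm a)\<^sup>2) / (1 - norm a)\<^sup>2)) \<longlongrightarrow> (1 - 1\<^sup>2) * ((1 - (norm
      a)\<^sup>2) / (1 - norm a)\<^sup>2)) disc_boundary_filter"
    using a by (intro tendsto_intros norm_disc_boundary) auto
  then have u: "((\<lambda>z::complex. (1 - (norm z)\<^sup>2) * ((1 - (norm a)\<^sup>2) / (1 - norm a)\<^sup>2)) \<longlongrightarrow> 0)
      disc_boundary_filter" by simp
  have ev: "eventually (\<lambda>z::complex. norm z < 1) disc_boundary_filter"
    unfolding eventually_disc_boundary by (intro exI[of _ 0]) auto
  have "((\<lambda>z. 1 - (norm (?\<phi> z))\<^sup>2) \<longlongrightarrow> 0) disc_boundary_filter"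
  proof (rule tendsto_sandwich[OF _ _ tendsto_const u])
    have eq: "1 - (norm (?\<phi> z))\<^sup>2 = (1 - (norm z)\<^sup>2) * (1 - (norm a)\<^sup>2) / (norm (1 - cnj a * z))\<^sup>2" if
        "norm z < 1" for z
      using that a one_minus_cnj_mult_nonzero[of a z] by (intro moebius_norm) auto
    show "eventually (\<lambda>z. 0 \<le> 1 - (norm (?\<phi> z))\<^sup>2) disc_boundary_filter"
      using ev
    proof eventually_elim
      case (elim z)
      show ?case unfolding eq[OF elim] using elim a
        by (intro divide_nonneg_nonneg mult_nonneg_nonneg) (auto simp: abs_square_le_1)
    qed
    show "eventually (\<lambda>z. 1 - (norm (?\<phi> z))\<^sup>2 \<le> (1 - (norm z)\<^sup>2) * ((1 - (norm a)\<^sup>2) / (1 - norm a)\<^sup>2))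
        disc_boundary_filter"
      using ev
    proof eventually_elim
      case (elim z)
      have "norm (cnj a * z) \<le> norm a * 1" using elim by (simp add: norm_mult mult_left_le)
      then have "1 - norm a \<le> norm (1 - cnj a * z)" using norm_triangle_ineq2[of 1 "cnj a * z"] by simp
      then have "(1 - (norm z)\<^sup>2) * (1 - (norm a)\<^sup>2) / (norm (1 - cnj a * z))\<^sup>2 \<le> (1 - (norm z)\<^sup>2) * (1 -
          (norm a)\<^sup>2) / (1 - norm a)\<^sup>2"
        using elim a by (intro divide_left_mono power_mono mult_nonneg_nonneg mult_pos_pos zero_less_power)
          (auto simp: abs_square_le_1)
      then show ?case unfolding eq[OF elim] by simp
    qed
  qed
  from tendsto_real_sqrt[OF tendsto_diff[OF tendsto_const this, of 1]]
  show ?thesis by simp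
qed

lemma proper_divide:
  assumes f: "proper_on_disc f" and a: "norm a < 1" and fa: "f a = 0"
  obtains g where "proper_on_disc g" "\<And>z. norm z < 1 \<Longrightarrow> f z = (z - a) / (1 - cnj a * z) * g z"
proof -
  have hol: "f holomorphic_on ball 0 1" and lim: "((\<lambda>z. norm (f z)) \<longlongrightarrow> 1) disc_boundary_filter"
    using f by (auto simp: proper_on_disc_def)
  define h where "h z = (if z = a then deriv f a else (f z - f a) / (z - a))" for z
  have h: "h holomorphic_on ball 0 1"
    unfolding h_def using a by (intro pole_lemma hol) auto
  define g where "g z = h z * (1 - cnj a * z)" for z
  have eq: "f z = (z - a) / (1 - cnj a * z) * g z" if "norm z < 1" for z
    using one_minus_cnj_mult_nonzero[of a z] a that fa by (auto simp: g_def h_def)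
  have "((\<lambda>z. norm (f z) / norm ((z - a) / (1 - cnj a * z))) \<longlongrightarrow> 1 / 1) disc_boundary_filter"
    by (intro tendsto_divide lim moebius_boundary_limit a) simp
  then have "((\<lambda>z. norm (f z) / norm ((z - a) / (1 - cnj a * z))) \<longlongrightarrow> 1) disc_boundary_filter" by simp
  then have "((\<lambda>z. norm (g z)) \<longlongrightarrow> 1) disc_boundary_filter"
  proof (rule Lim_transform_eventually)
    show "eventually (\<lambda>z. norm (f z) / norm ((z - a) / (1 - cnj a * z)) = norm (g z)) disc_boundary_filter"
      unfolding eventually_disc_boundary
    proof (intro exI[of _ "norm a"] conjI allI impI a)
      fix z :: complex assume z: "norm a < norm z \<and> norm z < 1"
      then have "z \<noteq> a" "1 - cnj a * z \<noteq> 0" using one_minus_cnj_mult_nonzero[of a z] a by auto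
      then show "norm (f z) / norm ((z - a) / (1 - cnj a * z)) = norm (g z)"
        using eq[of z] z by (simp add: norm_mult norm_divide)
    qed
  qed
  moreover have "g holomorphic_on ball 0 1" unfolding g_def by (intro holomorphic_intros h)
  ultimately have "proper_on_disc g" by (simp add: proper_on_disc_def)
  then show thesis using eq by (rule that)
qed

text \<open>Dividing by a Moebius factor vanishing in the disc of radius \<open>r0\<close> increases \<open>\<bar>f z0\<bar>\<^sup>2\<close>
  by a fixed factor, while the maximum principle keeps it at most 1: this bounds the number of divisions.\<close>

lemma proper_finite_blaschke_aux:
  assumes z0: "norm z0 < 1" and \<kappa>: "\<kappa> < 1"
    and \<kappa>le: "\<And>a. norm a \<le> r0 \<Longrightarrow> (norm ((z0 - a) / (1 - cnj a * z0)))\<^sup>2 \<le> 1 - \<kappa>"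
    and f: "proper_on_disc f" "\<And>z. norm z < 1 \<Longrightarrow> f z = 0 \<Longrightarrow> norm z \<le> r0"
    and N: "(1 - \<kappa>) ^ N < (norm (f z0))\<^sup>2"
  shows "\<exists>c (k::nat) a. norm c = 1 \<and> (\<forall>j\<in>{1..k}. a j \<in> ball 0 1) \<and>
    (\<forall>z\<in>ball 0 1. f z = c * (\<Prod>j=1..k. (z - a j) / (1 - cnj (a j) * z)))"
  using f N
proof (induction N arbitrary: f)
  case 0
  have "norm (f z0) \<le> 1"
    using 0 z0 by (intro disc_boundary_maximum) (auto simp: proper_on_disc_def)
  then have "(norm (f z0))\<^sup>2 \<le> 1" by (simp add: power_le_one)
  then show ?case using 0 by simp
next
  case (Suc N)
  show ?case
  proof (cases "\<exists>a. norm a < 1 \<and> f a = 0")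
    case False
    then obtain c where "norm c = 1" "\<forall>z\<in>ball 0 1. f z = c"
      using proper_nonzero_constant[OF Suc.prems(1)] by blast
    then show ?thesis by (intro exI[of _ c] exI[of _ 0]) auto
  next
    case True
    then obtain a where a: "norm a < 1" "f a = 0" by blast
    obtain g where g: "proper_on_disc g" "\<And>z. norm z < 1 \<Longrightarrow> f z = (z - a) / (1 - cnj a * z) * g z"
      using proper_divide[OF Suc.prems(1) a] by blast
    let ?\<phi> = "(norm ((z0 - a) / (1 - cnj a * z0)))\<^sup>2"
    have "(1 - \<kappa>) * (1 - \<kappa>) ^ N < ?\<phi> * (norm (g z0))\<^sup>2"
      using Suc.prems(3) by (simp add: g(2)[OF z0] norm_mult norm_divide power_mult_distrib power_divide)
    also have "\<dots> \<le> (1 - \<kappa>) * (norm (g z0))\<^sup>2"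
      using \<kappa>le[OF Suc.prems(2)[OF a]] by (intro mult_right_mono) auto
    finally have "(1 - \<kappa>) ^ N < (norm (g z0))\<^sup>2" using \<kappa> by simp
    moreover have "norm z \<le> r0" if "norm z < 1" "g z = 0" for z
      using Suc.prems(2)[OF that(1)] g(2)[OF that(1)] that(2) by simp
    ultimately obtain c k b where c: "norm c = 1" "\<forall>j\<in>{1..k}. b j \<in> ball 0 1"
      "\<forall>z\<in>ball 0 1. g z = c * (\<Prod>j=1..k::nat. (z - b j) / (1 - cnj (b j) * z))"
      using Suc.IH[OF g(1)] by blast
    let ?b = "b(Suc k := a)"
    have "f z = c * (\<Prod>j=1..Suc k. (z - ?b j) / (1 - cnj (?b j) * z))" if "z \<in> ball 0 1" for z
    proof -
      have "(\<Prod>j=1..k. (z - ?b j) / (1 - cnj (?b j) * z)) = (\<Prod>j=1..k. (z - b j) / (1 - cnj (b j) * z))"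
        by (intro prod.cong) auto
      then show ?thesis using g(2)[of z] c(3) that by (simp add: prod.cl_ivl_Suc mult_ac)
    qed
    moreover have "\<forall>j\<in>{1..Suc k}. ?b j \<in> ball 0 1" using c(2) a(1) by auto
    ultimately show ?thesis using c(1) by blast
  qed
qed

lemma proper_finite_blaschke:
  assumes f: "proper_on_disc f" and f0: "f 0 = 0"
  shows "\<exists>B. finite_blaschke_product B \<and> (\<forall>z\<in>ball 0 1. f z = B z)"
proof -
  have "eventually (\<lambda>z. 0 < norm (f z)) disc_boundary_filter"
    using f by (intro order_tendstoD(1)) (auto simp: proper_on_disc_def)
  then obtain r where r: "r < 1" "\<And>z. r < norm z \<Longrightarrow> norm z < 1 \<Longrightarrow> f z \<noteq> 0"
    by (auto simp: eventually_disc_boundary)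
  define r0 where "r0 = max r 0"
  have r0: "r0 < 1" "0 \<le> r0" "\<And>z. norm z < 1 \<Longrightarrow> f z = 0 \<Longrightarrow> norm z \<le> r0"
    using r by (auto simp: r0_def) (metis le_max_iff_disj not_le)
  \<comment> \<open>A base point outside the disc of radius \<open>r0\<close> containing all zeros,
    so that \<open>f z0\<close> is nonzero.\<close>
  define z0 :: complex where "z0 = of_real ((r0 + 1) / 2)"
  have "norm z0 = (r0 + 1) / 2" unfolding z0_def norm_of_real using r0 by simp
  then have z0: "r0 < norm z0" "norm z0 < 1" using r0 by auto
  \<comment> \<open>By \<open>moebius_norm\<close>, 1 minus the squared modulus of a Moebius factor
    at \<open>z0\<close> is at least this when its zero lies within radius \<open>r0\<close>; the 4
    bounds the squared denominator.\<close>
  define \<kappa> where "\<kappa> = (1 - (norm z0)\<^sup>2) * (1 - r0\<^sup>2) / 4"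
  have sq: "0 < 1 - (norm z0)\<^sup>2" "0 < 1 - r0\<^sup>2" using z0 r0 by (simp_all add: abs_square_less_1)
  have \<kappa>0: "0 < \<kappa>" using sq by (simp add: \<kappa>_def)
  have "(1 - (norm z0)\<^sup>2) * (1 - r0\<^sup>2) \<le> 1 * 1" using sq by (intro mult_mono) auto
  then have \<kappa>1: "\<kappa> < 1" by (simp add: \<kappa>_def)
  have \<kappa>le: "(norm ((z0 - a) / (1 - cnj a * z0)))\<^sup>2 \<le> 1 - \<kappa>" if a: "norm a \<le> r0" for a
  proof -
    have nz: "1 - cnj a * z0 \<noteq> 0" using one_minus_cnj_mult_nonzero[of a z0] a r0 z0 by auto
    have "norm (cnj a * z0) \<le> 1 * 1" unfolding norm_mult using a r0 z0 by (intro mult_mono) auto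
    then have "norm (1 - cnj a * z0) \<le> 2" using norm_triangle_ineq4[of 1 "cnj a * z0"] by simp
    then have "(norm (1 - cnj a * z0))\<^sup>2 \<le> 2\<^sup>2" by (rule power_mono) simp
    moreover have "(norm a)\<^sup>2 \<le> r0\<^sup>2" using a by (intro power_mono) auto
    ultimately have "\<kappa> \<le> (1 - (norm z0)\<^sup>2) * (1 - (norm a)\<^sup>2) / (norm (1 - cnj a * z0))\<^sup>2"
      unfolding \<kappa>_def using sq nz by (intro frac_le mult_left_mono) auto
    then show ?thesis using moebius_norm[OF nz] by simp
  qed
  have "0 < (norm (f z0))\<^sup>2" using r0(3)[OF z0(2)] z0(1) by auto
  then obtain N where "(1 - \<kappa>) ^ N < (norm (f z0))\<^sup>2" using \<kappa>0 real_arch_pow_inv[of "(norm (f z0))\<^sup>2" "1 -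
      \<kappa>"] by auto
  then obtain c k a where B: "norm c = 1" "\<forall>j\<in>{1..k::nat}. a j \<in> ball 0 1"
    "\<forall>z\<in>ball 0 1. f z = c * (\<Prod>j=1..k. (z - a j) / (1 - cnj (a j) * z))"
    using proper_finite_blaschke_aux[OF z0(2) \<kappa>1 \<kappa>le f r0(3)] by blast
  have "k \<noteq> 0"
  proof
    assume "k = 0"
    then have "f 0 = c" using B(3) by simp
    then show False using f0 B(1) by simp
  qed
  then have "finite_blaschke_product (\<lambda>z. c * (\<Prod>j=1..k. (z - a j) / (1 - cnj (a j) * z)))"
    unfolding finite_blaschke_product_def using B(1,2)
    by (intro exI[of _ c] exI[of _ k] exI[of _ a]) auto
  then show ?thesis using B(3) by blast
qed

section \<open>Leading coefficients of kernel combinations\<close>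

text \<open>Dividing by the linear factor at the last node keeps the leading coefficient and lowers
  the degree. Each division costs one factor \<Delta> and, in passing from degree \<open>n\<close>
  to \<open>n + 1\<close>, a factor \<open>n + 2\<close>, whence the factorial. It is a crude form
  of the divided difference formula.\<close>

lemma coeff_le_sum_values:
  fixes q :: "complex poly" and x :: "nat \<Rightarrow> complex"
  assumes "degree q \<le> n" "0 < \<Delta>" "\<And>i k. i < k \<Longrightarrow> k \<le> n \<Longrightarrow> \<Delta> \<le> norm (x i - x k)"
  shows "norm (coeff q n) * \<Delta> ^ n \<le> fact (Suc n) * (\<Sum>i\<le>n. norm (poly q (x i)))"
  using assms(1,3)
proof (induction n arbitrary: q)
  case 0
  then obtain c where "q = [:c:]" by (metis degree_eq_zeroE le_zero_eq)
  then show ?case by simp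
next
  case (Suc n)
  let ?c = "x (Suc n)" 
  let ?R = "synthetic_div q ?c"
  have q: "q = [:- ?c, 1:] * ?R + [:poly q ?c:]" by (rule synthetic_div_correct'[symmetric])
  have dR: "degree ?R \<le> n" using Suc.prems(1) by (simp add: degree_synthetic_div)
  have "coeff q (Suc n) = coeff ([:- ?c, 1:] * ?R + [:poly q ?c:]) (Suc n)" using q by simp
  also have "\<dots> = coeff ?R n" using dR by (simp add: coeff_eq_0)
  finally have cq: "coeff q (Suc n) = coeff ?R n" .
  have R: "\<Delta> * norm (poly ?R (x i)) \<le> norm (poly q (x i)) + norm (poly q ?c)" if "i \<le> n" for i
  proof -
    have "poly q (x i) = poly ([:- ?c, 1:] * ?R + [:poly q ?c:]) (x i)" using q by simp
    then have "poly q (x i) - poly q ?c = (x i - ?c) * poly ?R (x i)" by (simp add: algebra_simps)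
    then have "norm (x i - ?c) * norm (poly ?R (x i)) \<le> norm (poly q (x i)) + norm (poly q ?c)"
      by (metis norm_mult norm_triangle_ineq4)
    moreover have "\<Delta> * norm (poly ?R (x i)) \<le> norm (x i - ?c) * norm (poly ?R (x i))"
      using that by (intro mult_right_mono Suc.prems(2)) auto
    ultimately show ?thesis by linarith
  qed
  have "norm (coeff q (Suc n)) * \<Delta> ^ Suc n = \<Delta> * (norm (coeff ?R n) * \<Delta> ^ n)" by (simp add: cq mult_ac)
  also have "\<dots> \<le> \<Delta> * (fact (Suc n) * (\<Sum>i\<le>n. norm (poly ?R (x i))))"
    using assms(2) Suc.prems(2) by (intro mult_left_mono Suc.IH dR) auto
  also have "\<dots> = fact (Suc n) * (\<Sum>i\<le>n. \<Delta> * norm (poly ?R (x i)))"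
    by (simp only: sum_distrib_left mult.left_commute)
  also have "\<dots> \<le> fact (Suc n) * (\<Sum>i\<le>n. norm (poly q (x i)) + norm (poly q ?c))"
    by (intro mult_left_mono sum_mono R) auto
  also have "\<dots> \<le> fact (Suc n) * (real (Suc (Suc n)) * (\<Sum>i\<le>Suc n. norm (poly q (x i))))"
  proof (intro mult_left_mono)
    let ?S = "\<Sum>i\<le>n. norm (poly q (x i))"
    have S: "0 \<le> ?S" by (intro sum_nonneg) auto
    have "(\<Sum>i\<le>n. norm (poly q (x i)) + norm (poly q ?c)) = ?S + real (Suc n) * norm (poly q ?c)"
      by (simp add: sum.distrib)
    also have "\<dots> \<le> real (Suc (Suc n)) * ?S + real (Suc (Suc n)) * norm (poly q ?c)"
      using S mult_right_mono[of 1 "real (Suc (Suc n))" ?S] by (intro add_mono mult_right_mono) auto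
    finally show "(\<Sum>i\<le>n. norm (poly q (x i)) + norm (poly q ?c)) \<le> real (Suc (Suc n)) * (\<Sum>i\<le>Suc n. norm
        (poly q (x i)))"
      by (simp add: distrib_left)
  qed auto
  finally show ?case by (simp add: mult_ac)
qed

text \<open>A minimum point over the arc works: the length of the arc times the minimum is at most
  the integral over the full circle, and \<open>2 * pi\<close> undoes the normalisation.\<close>

lemma arc_mean_value:
  fixes g :: "complex \<Rightarrow> real"
  assumes g: "continuous_on (sphere 0 1) g" "g \<in> borel_measurable borel" "\<And>w. 0 \<le> g w" and u: "norm u = 1"
    and ab: "0 \<le> \<alpha>" "\<alpha> < \<beta>" "\<beta> \<le> 2 * pi"
  shows "\<exists>t\<in>{\<alpha>..\<beta>}. (\<beta> - \<alpha>) * g (u * cis t) \<le> 2 * pi * (LINT w|\<mu>. g w)"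
proof -
  have c: "continuous_on A (\<lambda>t. g (u * cis t))" for A
    using u by (intro continuous_on_compose2[OF g(1)] continuous_intros) (auto simp: norm_mult)
  obtain t where t: "t \<in> {\<alpha>..\<beta>}" "\<And>x. x \<in> {\<alpha>..\<beta>} \<Longrightarrow> g (u * cis t) \<le> g (u * cis x)"
    using continuous_attains_inf[OF compact_Icc _ c, of \<alpha> \<beta>] ab by auto
  have m: "(\<lambda>w. g (u * w)) \<in> borel_measurable (restrict_space borel (sphere 0 1))"
    by (rule measurable_restrict_space1) (use g(2) in measurable)
  have i: "set_integrable lborel {0..2*pi} (\<lambda>x. g (u * cis x))"
    by (rule borel_integrable_atLeastAtMost'[OF c])
  have "(\<beta> - \<alpha>) * g (u * cis t) = (LINT x:{\<alpha>..\<beta>}|lborel. g (u * cis t))"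
    using ab by (simp add: set_lebesgue_integral_def)
  also have "\<dots> \<le> (LINT x:{0..2*pi}|lborel. g (u * cis x))"
    unfolding set_lebesgue_integral_def
  proof (rule integral_mono)
    show "integrable lborel (\<lambda>x::real. indicator {\<alpha>..\<beta>} x *\<^sub>R g (u * cis t))"
      by (intro integrable_scaleR_left integrable_real_indicator) (auto simp: emeasure_lborel_Icc_eq)
    show "integrable lborel (\<lambda>x. indicator {0..2*pi} x *\<^sub>R g (u * cis x))" using i by (simp add:
        set_integrable_def)
    show "indicator {\<alpha>..\<beta>} x *\<^sub>R g (u * cis t) \<le> indicator {0..2*pi} x *\<^sub>R g (u * cis x)" for x :: real
      using t(2)[of x] ab g(3) by (auto simp: indicator_def)
  qed
  also have "\<dots> = 2 * pi * (LINT w|\<mu>. g (u * w))"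
    using integrable_circle_iff(2)[OF m] by simp
  also have "(LINT w|\<mu>. g (u * w)) = (LINT w|\<mu>. g w)"
    by (rule circle_rotation[OF u g(2)])
  finally show ?thesis using t(1) by blast
qed

lemma norm_one_minus_cis_le: "norm (1 - cis t) \<le> \<bar>t\<bar>"
proof (rule power2_le_imp_le)
  have "(norm (1 - cis t))\<^sup>2 = 2 * (1 - cos (2 * (t / 2)))" using norm_one_minus_cis[of 1 t] by simp
  also have "\<dots> = 4 * (sin (t / 2))\<^sup>2" by (subst cos_double_sin) simp
  also have "\<dots> \<le> 4 * (t / 2)\<^sup>2"
    using power_mono[OF abs_sin_x_le_abs_x[of "t / 2"], of 2] by (simp add: power_divide)
  finally show "(norm (1 - cis t))\<^sup>2 \<le> \<bar>t\<bar>\<^sup>2" by (simp add: power_divide)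
qed simp

text \<open>The sum is \<open>1 / (1 - cnj b z)\<close> times a polynomial in \<open>x = z / (1 - cnj b z)\<close>. On \<open>n + 1\<close> arcs of
  length comparable to \<open>1 - \<bar>b\<bar>\<close> near \<open>b / \<bar>b\<bar>\<close> the values of \<open>x\<close> have mutual distance at least
  a constant times \<open>1 / (1 - \<bar>b\<bar>)\<close>, which controls the leading coefficient of that polynomial.\<close>

lemma leading_kernel_coefficient:
  assumes p: "0 < p" "p < 1"
  obtains \<kappa> where "0 < \<kappa>" "\<And>b c. norm b < 1 \<Longrightarrow> norm (c n) powr p \<le> \<kappa> * (1 - norm b) powr (real (Suc n) * p - 1) *
      (LINT w|\<mu>. norm (\<Sum>j\<le>n. c j * deriv_kernel j b w) powr p)"
proof -
  \<comment> \<open>The \<open>n + 1\<close> arcs and the \<open>n\<close> gaps between them all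
    have length \<open>\<delta> * d\<close>, filling an interval of length \<open>d\<close>
    altogether.\<close>
  define \<delta> where "\<delta> = 1 / real (2 * n + 1)"
  have \<delta>: "0 < \<delta>" "\<delta> * real (2 * n + 1) = 1" by (simp_all add: \<delta>_def)
  \<comment> \<open>The factors come, in order, from the separation of the nodes, the factorial in
    \<open>coeff_le_sum_values\<close>, the bound \<open>2 * d\<close> on the denominators, the
    number of arcs, and the arc length in \<open>arc_mean_value\<close>.\<close>
  let ?\<kappa> = "(8 / \<delta>) powr (real n * p) * (fact (Suc n) powr p * (2 powr p * (real (Suc n) * (2 * pi / \<delta>))))"
  show thesis
  proof (rule that[of ?\<kappa>])
    show "0 < ?\<kappa>" using \<delta> by simp
    fix b :: complex and c :: "nat \<Rightarrow> complex" assume b: "norm b < 1"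
    define d where "d = 1 - norm b"
    have d: "0 < d" "d \<le> 1" using b by (auto simp: d_def)
    obtain u where u: "norm u = 1" "cnj b * u = of_real (norm b)"
    proof (cases "b = 0")
      case False
      then have "norm (sgn b) = 1" by (simp add: norm_sgn)
      moreover have "cnj b * sgn b = of_real (norm b)"
      proof -
        have "cnj b * b = of_real (norm b) * of_real (norm b)"
          using complex_norm_square[of b] by (simp add: power2_eq_square mult.commute)
        then show ?thesis using False by (simp add: sgn_eq)
      qed
      ultimately show thesis by (rule that)
    qed (use that[of 1] in simp)
    define G where "G w = (\<Sum>j\<le>n. c j * deriv_kernel j b w)" for w
    let ?I = "LINT w|\<mu>. norm (G w) powr p"
    have Gc: "continuous_on (sphere 0 1) (\<lambda>w. norm (G w) powr p)"
      unfolding G_def using p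
      by (intro continuous_on_powr' continuous_intros continuous_on_deriv_kernel b) auto
    have Gm: "(\<lambda>w. norm (G w) powr p) \<in> borel_measurable borel" unfolding G_def by measurable
    have "\<exists>t\<in>{real (2*i) * (\<delta> * d)..real (2*i+1) * (\<delta> * d)}. \<delta> * d * norm (G (u * cis t)) powr p \<le> 2 * pi * ?I"
      if "i \<le> n" for i
    proof -
      have "real (2*i+1) * (\<delta> * d) \<le> real (2 * n + 1) * (\<delta> * d)"
        using that \<delta> d by (intro mult_right_mono) auto
      also have "\<dots> = d" using \<delta>(2) by (simp add: mult.assoc[symmetric] mult.commute)
      also have "\<dots> \<le> 2 * pi" using d pi_ge_two by linarith
      finally have "real (2*i+1) * (\<delta> * d) \<le> 2 * pi" .
      then show ?thesis
        using arc_mean_value[OF Gc Gm _ u(1), of "real (2*i) * (\<delta> * d)" "real (2*i+1) * (\<delta> * d)"] \<delta> d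
        by (simp add: algebra_simps)
    qed
    then obtain t where t: "\<And>i. i \<le> n \<Longrightarrow> t i \<in> {real (2*i) * (\<delta> * d)..real (2*i+1) * (\<delta> * d)}"
      "\<And>i. i \<le> n \<Longrightarrow> \<delta> * d * norm (G (u * cis (t i))) powr p \<le> 2 * pi * ?I"
      by metis
    define z where "z i = u * cis (t i)" for i
    define D where "D i = 1 - cnj b * z i" for i
    have tb: "0 \<le> t i" "t i \<le> d" if "i \<le> n" for i
    proof -
      have "real (2*i+1) * (\<delta> * d) \<le> real (2 * n + 1) * (\<delta> * d)"
        using that \<delta> d by (intro mult_right_mono) auto
      also have "\<dots> = d" using \<delta>(2) by (simp add: mult.assoc[symmetric] mult.commute)
      finally show "t i \<le> d" using t(1)[OF that] by auto
      show "0 \<le> t i" using t(1)[OF that] \<delta> d by (auto intro: order.trans[rotated])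
    qed
    have z1: "norm (z i) = 1" for i using u by (simp add: z_def norm_mult)
    have D0: "D i \<noteq> 0" for i using one_minus_cnj_mult_nonzero[OF b, of "z i"] z1 by (simp add: D_def)
    have D2: "norm (D i) \<le> 2 * d" if "i \<le> n" for i
    proof -
      have "D i = of_real (1 - norm b) + of_real (norm b) * (1 - cis (t i))"
        unfolding D_def z_def mult.assoc[symmetric] u(2) by (simp add: algebra_simps)
      also have "norm \<dots> \<le> norm (of_real (1 - norm b) :: complex) + norm (of_real (norm b) * (1 - cis (t i)))"
        by (rule norm_triangle_ineq)
      also have "\<dots> = d + norm b * norm (1 - cis (t i))"
        unfolding norm_mult norm_of_real using b by (simp add: d_def)
      also have "\<dots> \<le> d + 1 * t i"
        using b norm_one_minus_cis_le[of "t i"] tb[OF that] by (intro add_left_mono mult_mono) auto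
      finally show ?thesis using tb[OF that] by linarith
    qed
    define x where "x i = z i / D i" for i
    define q where "q = (\<Sum>j\<le>n. monom (c j * fact j) j)"
    have dq: "degree q \<le> n" unfolding q_def by (intro degree_sum_le) (auto intro: order.trans[OF
        degree_monom_le])
    have cq: "coeff q n = c n * fact n"
      unfolding q_def by (simp add: coeff_sum)
    have Gx: "D i * G (z i) = poly q (x i)" for i
    proof -
      have "D i * (c j * deriv_kernel j b (z i)) = c j * fact j * x i ^ j" for j
        using D0[of i] by (simp add: deriv_kernel_def x_def power_divide D_def[symmetric])
      then show ?thesis unfolding G_def q_def sum_distrib_left poly_sum poly_monom
        by (intro sum.cong refl)
    qed
    \<comment> \<open>The gaps make the points \<open>z i\<close> at least
      \<open>\<delta> * d / 2\<close> apart (chord against arc, with 2 / pi above 1/2), and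
      differences of the \<open>x i\<close> are these divided by two denominators of size at most
      \<open>2 * d\<close>.\<close>
    let ?\<Delta> = "\<delta> / (8 * d)"
    have \<Delta>0: "0 < ?\<Delta>" using \<delta> d by simp
    have sep: "?\<Delta> \<le> norm (x i - x k)" if ik: "i < k" "k \<le> n" for i k
    proof -
      have e: "x i - x k = (z i - z k) / (D i * D k)"
      proof -
        have "x i - x k = (z i * D k - z k * D i) / (D i * D k)"
          using D0 by (simp add: x_def diff_divide_distrib)
        also have "z i * D k - z k * D i = z i - z k" by (simp add: D_def algebra_simps)
        finally show ?thesis .
      qed
      have ti: "t i \<le> real (2*i+1) * (\<delta> * d)" "real (2*k) * (\<delta> * d) \<le> t k" using t(1)[of i] t(1)[of k] ik
          by auto
      have "real (2*i+2) * (\<delta> * d) \<le> real (2*k) * (\<delta> * d)" using ik \<delta> d by (intro mult_right_mono) auto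
      then have td: "\<delta> * d \<le> t k - t i" using ti by (simp add: algebra_simps)
      then have ta: "\<bar>t i - t k\<bar> = t k - t i" using \<delta> d by (smt (verit) mult_pos_pos)
      have "\<delta> * d / 2 \<le> 2 / pi * (\<delta> * d)"
        using pi_less_4 \<delta> d by (simp add: field_simps)
      also have "\<dots> \<le> 2 / pi * \<bar>t i - t k\<bar>" unfolding ta using td by (intro mult_left_mono) auto
      also have "\<dots> \<le> norm (cis (t i) - cis (t k))"
        using tb[of i] tb[of k] ik d pi_ge_two by (intro norm_cis_diff_ge) (simp add: ta)
      also have "\<dots> = norm (z i - z k)"
        using u(1) by (simp add: z_def norm_mult flip: right_diff_distrib)
      finally have zz: "\<delta> * d / 2 \<le> norm (z i - z k)" .
      have "norm (D i * D k) \<le> (2 * d) * (2 * d)"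
        unfolding norm_mult using D2[of i] D2[of k] ik d by (intro mult_mono) auto
      then have "(\<delta> * d / 2) / ((2 * d) * (2 * d)) \<le> norm (z i - z k) / norm (D i * D k)"
        using zz D0 \<delta> d by (intro frac_le) auto
      then show ?thesis unfolding e norm_divide using d by simp
    qed
    have "norm (c n) * ?\<Delta> ^ n \<le> norm (coeff q n) * ?\<Delta> ^ n"
      unfolding cq using \<Delta>0 mult_left_mono[OF fact_ge_1, of "norm (c n)" n]
      by (intro mult_right_mono) (auto simp: norm_mult)
    also have "\<dots> \<le> fact (Suc n) * (\<Sum>i\<le>n. norm (poly q (x i)))"
      by (rule coeff_le_sum_values[OF dq \<Delta>0 sep])
    also have "\<dots> \<le> fact (Suc n) * (\<Sum>i\<le>n. 2 * d * norm (G (z i)))"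
      unfolding Gx[symmetric] norm_mult by (intro mult_left_mono sum_mono mult_right_mono D2) auto
    finally have "(norm (c n) * ?\<Delta> ^ n) powr p \<le> (fact (Suc n) * (\<Sum>i\<le>n. 2 * d * norm (G (z i)))) powr p"
      using p \<Delta>0 by (intro powr_mono2) auto
    also have "\<dots> = fact (Suc n) powr p * (\<Sum>i\<le>n. 2 * d * norm (G (z i))) powr p"
      using d by (intro powr_mult)
    also have "\<dots> \<le> fact (Suc n) powr p * (\<Sum>i\<le>n. (2 * d * norm (G (z i))) powr p)"
      using d p by (intro mult_left_mono powr_sum_le) auto
    also have "\<dots> \<le> fact (Suc n) powr p * (\<Sum>i\<le>n. (2 * d) powr p * (2 * pi / (\<delta> * d) * ?I))"
    proof (intro mult_left_mono sum_mono)
      fix i assume "i \<in> {..n}"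
      then have "norm (G (z i)) powr p \<le> 2 * pi / (\<delta> * d) * ?I"
        using t(2)[of i] \<delta> d by (simp add: z_def field_simps)
      then have "(2 * d) powr p * norm (G (z i)) powr p \<le> (2 * d) powr p * (2 * pi / (\<delta> * d) * ?I)"
        by (rule mult_left_mono) simp
      moreover have "(2 * d * norm (G (z i))) powr p = (2 * d) powr p * norm (G (z i)) powr p"
        using d by (intro powr_mult)
      ultimately show "(2 * d * norm (G (z i))) powr p \<le> (2 * d) powr p * (2 * pi / (\<delta> * d) * ?I)"
        by (simp only:)
    qed auto
    also have "\<dots> = fact (Suc n) powr p * (2 powr p * (real (Suc n) * (2 * pi / \<delta>))) * (d powr p / d * ?I)"
      using d by (simp add: powr_mult del: fact_Suc)
    finally have main: "norm (c n) powr p * ?\<Delta> powr (real n * p) \<le>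
        fact (Suc n) powr p * (2 powr p * (real (Suc n) * (2 * pi / \<delta>))) * (d powr p / d * ?I)"
      using \<Delta>0 by (simp add: powr_mult powr_powr flip: powr_realpow del: fact_Suc)
    have inv: "(8 / \<delta>) powr (real n * p) * d powr (real n * p) * ?\<Delta> powr (real n * p) = 1"
      using \<delta> d by (simp flip: powr_mult)
    have "norm (c n) powr p = ((8 / \<delta>) powr (real n * p) * d powr (real n * p)) * (norm (c n) powr p * ?\<Delta>
        powr (real n * p))"
      using inv by (simp only: mult_ac mult_1_right)
    also have "\<dots> \<le> ((8 / \<delta>) powr (real n * p) * d powr (real n * p)) *
      (fact (Suc n) powr p * (2 powr p * (real (Suc n) * (2 * pi / \<delta>))) * (d powr p / d * ?I))"
      by (intro mult_left_mono main) auto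
    also have "\<dots> = ?\<kappa> * (d powr (real n * p) * (d powr p / d)) * ?I"
      by (simp only: mult_ac)
    also have "d powr (real n * p) * (d powr p / d) = d powr (real (Suc n) * p - 1)"
      using d by (simp add: powr_diff powr_add algebra_simps)
    finally show "norm (c n) powr p \<le> ?\<kappa> * (1 - norm b) powr (real (Suc n) * p - 1) *
      (LINT w|\<mu>. norm (\<Sum>j\<le>n. c j * deriv_kernel j b w) powr p)"
      unfolding G_def d_def .
  qed
qed

section \<open>Bounded conditional expectations force finite Blaschke products\<close>

lemma bounded_cexp_proper:
  assumes inner: "inner_function \<eta>" "\<eta> 0 = 0" and p: "0 < p" "p < 1"
    and b: "cexp_bound p (Hp_space 1) \<eta> C" and C: "0 \<le> C"
  shows "proper_on_disc \<eta>"
proof -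
  note hol = inner_holomorphic[OF inner] and lt = inner_norm_less_1[OF inner]
  obtain n :: nat where n0: "1 / p - 1 < real n" using reals_Archimedean2 by blast
  define s where "s = real (Suc n) * p"
  have s: "1 < s" using n0 p by (simp add: s_def field_simps)
  have n: "0 < real n * p" using s p by (simp add: s_def algebra_simps)
  \<comment> \<open>Below 1 because \<open>s - 1 = n * p - (1 - p)\<close>; this is where
    \<open>p < 1\<close> enters the differential inequality.\<close>
  define \<beta> where "\<beta> = (s - 1) / (real n * p)"
  have \<beta>: "0 < \<beta>" "\<beta> < 1" using s n p by (auto simp: \<beta>_def s_def divide_less_eq algebra_simps)
  obtain \<kappa> where \<kappa>: "0 < \<kappa>" "\<And>b c. norm b < 1 \<Longrightarrow> norm (c n) powr p \<le> \<kappa> * (1 - norm b) powr (real (Suc n) *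
      p - 1) *
      (LINT w|\<mu>. norm (\<Sum>j\<le>n. c j * deriv_kernel j b w) powr p)"
    using leading_kernel_coefficient[OF p] by blast
  obtain K where K: "0 < K" "\<And>r. 0 \<le> r \<Longrightarrow> r < 1 \<Longrightarrow> kernel_integral s r \<le> K * (1 - r) powr (1 - s)"
    using kernel_integral_bounded[OF s] by blast
  define A0 where "A0 = \<kappa> * (C powr p * (fact n powr p * K))"
  have A0: "0 \<le> A0" using \<kappa>(1) K(1) by (simp add: A0_def)
  define A where "A = A0 powr (1 / (real n * p))"
  have A: "0 \<le> A" by (simp add: A_def)
  \<comment> \<open>The leading coefficient estimate at the pole \<open>\<eta> a\<close>, followed
    by the test inequality, bounds the power \<open>n * p\<close> of the derivative; the claim is
    the corresponding root.\<close>
  have deriv_bound: "norm (deriv \<eta> a) \<le> A * ((1 - norm (\<eta> a)) powr \<beta> * (1 - norm a) powr (-\<beta>))" if a: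
      "norm a < 1" for a
  proof -
    let ?u = "1 - norm (\<eta> a)" and ?v = "1 - norm a"
    have u: "0 < ?u" and v: "0 < ?v" using lt[OF a] a by auto
    have "norm (deriv \<eta> a) powr (real n * p) = norm (cnj (faa_di_bruno \<eta> n n a)) powr p"
      by (cases "deriv \<eta> a = 0") (use n p in \<open>auto simp: faa_di_bruno_top norm_power powr_powr
          zero_less_mult_iff simp flip: powr_realpow\<close>)
    also have "\<dots> \<le> \<kappa> * ?u powr (s - 1) * (LINT w|\<mu>. norm (\<Sum>j\<le>n. cnj (faa_di_bruno \<eta> n j a) * deriv_kernel
        j (\<eta> a) w) powr p)"
      unfolding s_def by (rule \<kappa>(2)[OF lt[OF a]])
    also have "\<dots> \<le> \<kappa> * ?u powr (s - 1) * (C powr p * (fact n powr p * kernel_integral s (norm a)))"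
      using kernel_test[OF inner p(1) b C a, of n] \<kappa>(1) unfolding s_def by (intro mult_left_mono) auto
    also have "\<dots> \<le> \<kappa> * ?u powr (s - 1) * (C powr p * (fact n powr p * (K * ?v powr (1 - s))))"
      using K(2)[of "norm a"] a \<kappa>(1) by (intro mult_left_mono) auto
    also have "\<dots> = A0 * (?u powr (s - 1) * ?v powr (1 - s))" unfolding A0_def by (simp only: mult_ac)
    finally have "(norm (deriv \<eta> a) powr (real n * p)) powr (1 / (real n * p)) \<le> (A0 * (?u powr (s - 1) *
        ?v powr (1 - s))) powr (1 / (real n * p))"
      using n by (intro powr_mono2) auto
    then have "norm (deriv \<eta> a) \<le> (A0 * (?u powr (s - 1) * ?v powr (1 - s))) powr (1 / (real n * p))"
      using n p(1) by (cases "n = 0") (auto simp: powr_powr)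
    also have "\<dots> = A * (?u powr \<beta> * ?v powr (-\<beta>))"
    proof -
      have "(1 - s) * (1 / (real n * p)) = - \<beta>" "(s - 1) * (1 / (real n * p)) = \<beta>"
        by (simp_all add: \<beta>_def diff_divide_distrib)
      then show ?thesis by (simp only: powr_mult powr_powr A_def)
    qed
    finally show ?thesis .
  qed
  \<comment> \<open>The square keeps this differentiable along radii even where \<eta>
    vanishes.\<close>
  define U where "U r w = 1 - (norm (\<eta> (of_real r * w)))\<^sup>2" for r w
  have nr: "norm (of_real r * w :: complex) = r" if "0 \<le> r" "norm w = 1" for r w using that by (simp add:
      norm_mult)
  have U0: "0 < U r w" if "0 \<le> r" "r < 1" "norm w = 1" for r w
    using lt[of "of_real r * w"] nr[of r w] that by (simp add: U_def abs_square_less_1)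
  \<comment> \<open>The derivative bound says that \<open>U r w powr (1 - \<beta>)\<close> has
    radial derivative at least \<open>- 2 * A * (1 - \<beta>) * (1 - r) powr (-\<beta>)\<close>. The
    subtracted term has exactly that derivative, so \<open>W w\<close> is nondecreasing.\<close>
  define W where "W w r = U r w powr (1 - \<beta>) - 2 * A * (1 - r) powr (1 - \<beta>)" for w r
  have W_mono: "W w r \<le> W w r'" if w: "norm w = 1" and r: "0 \<le> r" "r \<le> r'" "r' < 1" for w r r'
  proof (rule DERIV_nonneg_imp_nondecreasing[OF r(2)])
    fix t assume t: "r \<le> t" "t \<le> r'"
    then have t01: "0 \<le> t" "t < 1" using r by auto
    let ?a = "of_real t * w"
    have na: "norm ?a = t" "norm ?a < 1" using nr[OF t01(1) w] t01 by auto
    let ?D = "2 * Re (cnj (\<eta> ?a) * (w * deriv \<eta> ?a))"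
    have "(\<eta> has_field_derivative deriv \<eta> ?a) (at ?a)"
      using na by (intro holomorphic_derivI[OF hol]) auto
    moreover have "((\<lambda>t. of_real t * w) has_vector_derivative w) (at t)"
      by (auto intro!: derivative_eq_intros simp: has_vector_derivative_def scaleR_conv_of_real)
    ultimately have "((\<lambda>t. \<eta> (of_real t * w)) has_vector_derivative w * deriv \<eta> ?a) (at t)"
      using field_vector_diff_chain_at[of "\<lambda>t. of_real t * w" w t \<eta>] by (simp add: o_def)
    from DERIV_diff[OF DERIV_const norm_squared_has_real_derivative[OF this], of 1]
    have dU: "((\<lambda>t. U t w) has_real_derivative - ?D) (at t)"
      by (simp only: U_def diff_0)
    have Ut: "0 < U t w" by (rule U0[OF t01 w])
    have d1: "((\<lambda>t. U t w powr (1 - \<beta>)) has_real_derivative (1 - \<beta>) * U t w powr (-\<beta>) * - ?D) (at t)"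
      using DERIV_chain2[OF has_real_derivative_powr dU, of "1 - \<beta>"] Ut by simp
    have "((\<lambda>t::real. 1 - t) has_real_derivative - 1) (at t)" by (auto intro!: derivative_eq_intros)
    from DERIV_chain2[OF has_real_derivative_powr this, of "1 - \<beta>"] t01
    have d2: "((\<lambda>t. (1 - t) powr (1 - \<beta>)) has_real_derivative (1 - \<beta>) * (1 - t) powr (-\<beta>) * - 1) (at t)" by simp
    have dW: "(W w has_real_derivative (1 - \<beta>) * U t w powr (-\<beta>) * - ?D - 2 * A * ((1 - \<beta>) * (1 - t) powr
        (-\<beta>) * - 1)) (at t)"
      unfolding W_def by (intro DERIV_diff d1 DERIV_cmult d2)
    have e1: "norm (\<eta> ?a) \<le> 1" using lt[OF na(2)] by simp
    have "Re (cnj (\<eta> ?a) * (w * deriv \<eta> ?a)) \<le> norm (cnj (\<eta> ?a) * (w * deriv \<eta> ?a))" by (rule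
        complex_Re_le_cmod)
    also have "\<dots> \<le> 1 * norm (deriv \<eta> ?a)" using e1 w by (simp add: norm_mult mult_left_le_one_le)
    also have "\<dots> \<le> A * ((1 - norm (\<eta> ?a)) powr \<beta> * (1 - t) powr (-\<beta>))" using deriv_bound[OF na(2)] na(1) by simp
    also have "\<dots> \<le> A * (U t w powr \<beta> * (1 - t) powr (-\<beta>))"
    proof -
      have "(norm (\<eta> ?a))\<^sup>2 \<le> norm (\<eta> ?a)" using e1 by (simp add: power2_eq_square mult_left_le)
      then have "(1 - norm (\<eta> ?a)) powr \<beta> \<le> U t w powr \<beta>"
        using e1 \<beta> unfolding U_def by (intro powr_mono2) auto
      then show ?thesis using A by (intro mult_left_mono mult_right_mono) auto
    qed
    finally have "U t w powr (-\<beta>) * ?D \<le> U t w powr (-\<beta>) * (2 * (A * (U t w powr \<beta> * (1 - t) powr (-\<beta>))))"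
      by (intro mult_left_mono) auto
    also have "\<dots> = (U t w powr (-\<beta>) * U t w powr \<beta>) * (2 * A * (1 - t) powr (-\<beta>))" by (simp only: mult_ac)
    also have "U t w powr (-\<beta>) * U t w powr \<beta> = 1" using Ut by (simp flip: powr_add)
    finally have "(1 - \<beta>) * (U t w powr (-\<beta>) * ?D) \<le> (1 - \<beta>) * (2 * A * (1 - t) powr (-\<beta>))"
      using \<beta> by (intro mult_left_mono) auto
    then have "0 \<le> (1 - \<beta>) * U t w powr (-\<beta>) * - ?D - 2 * A * ((1 - \<beta>) * (1 - t) powr (-\<beta>) * - 1)"
    proof -
      have "x * b * - D - 2 * A * (x * c * - 1) = x * (2 * A * c) - x * (b * D)" for x b c D :: real
        by (simp add: algebra_simps)
      then show ?thesis using \<open>(1 - \<beta>) * (_ * ?D) \<le> _\<close> by (simp only: diff_ge_0_iff_ge)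
    qed
    with dW show "\<exists>y. (W w has_real_derivative y) (at t) \<and> 0 \<le> y" by blast
  qed
  define B where "B = (2 * A) powr (1 / (1 - \<beta>))"
  have B: "0 \<le> B" by (simp add: B_def)
  \<comment> \<open>With a unimodular radial limit both terms of \<open>W w\<close> tend to 0, so
    monotonicity forces \<open>W w r \<le> 0\<close>; taking the root of exponent
    \<open>1 - \<beta>\<close> makes the bound linear, with \<open>B\<close> independent of the
    radius.\<close>
  have good: "U r w \<le> B * (1 - r)" if w: "norm w = 1" and r: "0 \<le> r" "r < 1"
    and lim: "((\<lambda>r. \<eta> (of_real r * w)) \<longlongrightarrow> l) (at_left 1)" "norm l = 1" for w r l
  proof -
    have "((\<lambda>r. U r w) \<longlongrightarrow> 1 - (norm l)\<^sup>2) (at_left 1)" unfolding U_def by (intro tendsto_intros lim)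
    then have lU: "((\<lambda>r. U r w) \<longlongrightarrow> 0) (at_left 1)" using lim(2) by simp
    have ev: "eventually (\<lambda>t. max r 0 < t \<and> t < 1) (at_left (1::real))"
      unfolding eventually_at_left_field using r by (intro exI[of _ "max r 0"]) auto
    have "((\<lambda>r. W w r) \<longlongrightarrow> 0 - 2 * A * 0) (at_left 1)"
      unfolding W_def
    proof (intro tendsto_diff tendsto_mult_left)
      show "((\<lambda>r. U r w powr (1 - \<beta>)) \<longlongrightarrow> 0) (at_left 1)"
        by (rule tendsto_zero_powrI[OF lU tendsto_const])
          (use \<beta> U0 w in \<open>auto intro!: eventually_mono[OF ev] less_imp_le\<close>)
      show "((\<lambda>r::real. (1 - r) powr (1 - \<beta>)) \<longlongrightarrow> 0) (at_left 1)" using \<beta> by real_asymp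
    qed
    then have "((\<lambda>r. W w r) \<longlongrightarrow> 0) (at_left 1)" by simp
    moreover have "eventually (\<lambda>t. W w r \<le> W w t) (at_left 1)"
      using ev by eventually_elim (use r w in \<open>auto intro!: W_mono\<close>)
    ultimately have "W w r \<le> 0" by (rule tendsto_lowerbound) simp
    then have "U r w powr (1 - \<beta>) \<le> 2 * A * (1 - r) powr (1 - \<beta>)" by (simp add: W_def)
    then have "(U r w powr (1 - \<beta>)) powr (1 / (1 - \<beta>)) \<le> (2 * A * (1 - r) powr (1 - \<beta>)) powr (1 / (1 - \<beta>))"
      using \<beta> by (intro powr_mono2) auto
    also have "\<dots> = B * ((1 - r) powr (1 - \<beta>)) powr (1 / (1 - \<beta>))"
      unfolding B_def using A by (intro powr_mult)
    finally show ?thesis using \<beta> U0[OF r w] r by (simp add: powr_powr)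
  qed
  \<comment> \<open>At fixed \<open>r\<close> the function \<open>U r\<close> is continuous, and the
    directions with a unimodular radial limit are dense.\<close>
  have all: "U r w \<le> B * (1 - r)" if w: "norm w = 1" and r: "0 \<le> r" "r < 1" for w r
  proof (rule ccontr)
    assume neg: "\<not> U r w \<le> B * (1 - r)"
    have "isCont (\<lambda>v. U r v) w"
    proof -
      have "isCont \<eta> (of_real r * w)"
        using holomorphic_on_imp_continuous_on[OF hol] nr[OF r(1) w] r by (auto simp:
            continuous_on_eq_continuous_at)
      then show ?thesis unfolding U_def
        by (intro continuous_intros isCont_o2[of w "\<lambda>v. of_real r * v" \<eta>]) auto
    qed
    then obtain d where d: "0 < d" "\<And>v. dist v w < d \<Longrightarrow> dist (U r v) (U r w) < U r w - B * (1 - r)"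
      using neg unfolding continuous_at_eps_delta by (metis diff_gt_0_iff_gt not_le)
    obtain v l where v: "norm v = 1" "dist v w < d" "((\<lambda>r. \<eta> (of_real r * v)) \<longlongrightarrow> l) (at_left 1)" "norm l = 1"
      using AE_circle_dense[OF inner_function_boundary[OF inner(1)], of w d] w d(1) by auto
    show False using d(2)[OF v(2)] good[OF v(1) r v(3,4)] by (simp add: dist_real_def)
  qed
  have bound: "1 - (norm (\<eta> z))\<^sup>2 \<le> B * (1 - norm z)" if z: "norm z < 1" "z \<noteq> 0" for z
  proof -
    have "norm (sgn z) = 1" using z by (simp add: norm_sgn)
    moreover have "of_real (norm z) * sgn z = z" using z by (simp add: sgn_eq)
    ultimately show ?thesis using all[of "sgn z" "norm z"] z by (simp add: U_def)
  qed
  have "((\<lambda>z::complex. B * (1 - norm z)) \<longlongrightarrow> B * (1 - 1)) disc_boundary_filter" by (intro tendsto_intros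
      norm_disc_boundary)
  then have u: "((\<lambda>z::complex. B * (1 - norm z)) \<longlongrightarrow> 0) disc_boundary_filter" by simp
  have ev: "eventually (\<lambda>z::complex. z \<noteq> 0 \<and> norm z < 1) disc_boundary_filter"
    unfolding eventually_disc_boundary by (intro exI[of _ 0]) auto
  have "((\<lambda>z. 1 - (norm (\<eta> z))\<^sup>2) \<longlongrightarrow> 0) disc_boundary_filter"
  proof (rule tendsto_sandwich[OF _ _ tendsto_const u])
    show "eventually (\<lambda>z. 0 \<le> 1 - (norm (\<eta> z))\<^sup>2) disc_boundary_filter"
      using ev by eventually_elim (use lt in \<open>auto simp: abs_square_le_1 intro: less_imp_le\<close>)
    show "eventually (\<lambda>z. 1 - (norm (\<eta> z))\<^sup>2 \<le> B * (1 - norm z)) disc_boundary_filter"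
      using ev by eventually_elim (use bound in auto)
  qed
  from tendsto_real_sqrt[OF tendsto_diff[OF tendsto_const this, of 1]]
  show ?thesis using hol by (simp add: proper_on_disc_def)
qed

text \<open>An inner function is compared with a Blaschke product on the open disc only; radial
  limits, and with them the sigma-algebra, see nothing else.\<close>

lemma cexp_cong_disc:
  assumes "\<And>z. norm z < 1 \<Longrightarrow> \<eta> z = B z"
  shows "cexp \<eta> = cexp B"
proof -
  have "boundary_fun \<eta> w = boundary_fun B w" if w: "w \<in> space \<mu>" for w
  proof -
    have "norm w = 1" using w by (simp add: space_circle_measure)
    \<comment> \<open>Stated for every \<open>l\<close>, because \<open>Lim\<close> is a description
      over this predicate: the boundary functions then agree also at points without a limit.\<close>
    have "((\<lambda>r :: real. \<eta> (of_real r * w)) \<longlongrightarrow> l) (at_left 1) \<longleftrightarrow> ((\<lambda>r :: real. B (of_real r * w)) \<longlongrightarrow> l)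
        (at_left 1)" for l
    proof (rule tendsto_cong)
      show "eventually (\<lambda>r :: real. \<eta> (of_real r * w) = B (of_real r * w)) (at_left 1)"
        using eventually_at_left_one by eventually_elim (use \<open>norm w = 1\<close> in \<open>auto intro!: assms simp:
            norm_mult\<close>)
    qed
    then show ?thesis by (simp add: boundary_fun_def Topological_Spaces.Lim_def)
  qed
  then have "boundary_fun \<eta> -` A \<inter> space \<mu> = boundary_fun B -` A \<inter> space \<mu>" for A by auto
  then have "Sigma_alg \<eta> = Sigma_alg B" by (simp add: Sigma_alg_def)
  then show ?thesis unfolding cexp_def by (intro ext) simp
qed

section \<open>Least bounds for finite Blaschke products\<close>

lemma Hp_space_subset_Lp_space: "Hp_space p \<subseteq> Lp_space p"
  by (auto simp: Hp_space_def)

lemma cexp_bound_mono: "cexp_bound p X \<eta> C \<Longrightarrow> Y \<subseteq> X \<Longrightarrow> cexp_bound p Y \<eta> C"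
  by (auto simp: cexp_bound_def)

lemma finite_blaschke_cexp_bound:
  assumes p: "0 < p" "p < 1" and B: "finite_blaschke_product B" "B 0 = 0"
  shows "cexp_bound p (Lp_space 1) B (sup_norm_deriv B powr (1 / p - 1))"
    and "cexp_bound p (Hp_space 1) B C \<Longrightarrow> 0 \<le> C \<Longrightarrow> sup_norm_deriv B powr (1 / p - 1) \<le> C"
proof -
  obtain S where "disc_selfmap_boundary B S" using finite_blaschke_selfmap[OF B] by blast
  then interpret disc_selfmap_boundary B S .
  let ?M = "sup_norm_deriv B"
  have "deriv B holomorphic_on S" by (intro holomorphic_deriv hol S(1))
  then have "continuous_on (sphere 0 1) (deriv B)"
    using S(2) by (intro continuous_on_subset[OF holomorphic_on_imp_continuous_on]) auto
  then have dc: "continuous_on (sphere 0 1) (\<lambda>w. norm (deriv B w))" by (intro continuous_intros)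
  \<comment> \<open>The supremum is attained, so the pointwise lower bound at \<open>w0\<close>
    already matches the upper bound.\<close>
  obtain w0 where w0: "w0 \<in> sphere 0 1" "\<And>w. w \<in> sphere 0 1 \<Longrightarrow> norm (deriv B w) \<le> norm (deriv B w0)"
    using continuous_attains_sup[OF _ _ dc] by (auto simp: sphere_eq_empty)
  have M: "?M = norm (deriv B w0)"
    unfolding sup_norm_deriv_def using w0 by (intro cSup_eq_maximum) auto
  have M1: "1 \<le> ?M" unfolding M using w0(1) by (intro angular_derivative) simp
  show "cexp_bound p (Lp_space 1) B (?M powr (1 / p - 1))"
  proof (rule cexp_Lp_bound[OF inner zero p])
    fix a :: complex assume a: "norm a < 1"
    show "AE w in \<mu>. poisson a w \<le> ?M * poisson (B a) (boundary_fun B w)"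
    proof (rule AE_I2)
      fix w assume "w \<in> space \<mu>"
      then have w: "norm w = 1" by (simp add: space_circle_measure)
      have "poisson a w \<le> norm (deriv B w) * poisson (B a) (B w)" by (rule julia[OF a w])
      also have "\<dots> \<le> ?M * poisson (B a) (B w)"
        unfolding M using w0(2)[of w] w by (intro mult_right_mono poisson_nonneg lt a) auto
      finally show "poisson a w \<le> ?M * poisson (B a) (boundary_fun B w)" by (simp add: boundary[OF w])
    qed
  qed (use M1 in simp)
  show "?M powr (1 / p - 1) \<le> C" if "cexp_bound p (Hp_space 1) B C" "0 \<le> C"
    unfolding M using w0(1) by (intro cexp_bound_ge[OF p that]) simp
qed

theorem theorem1p2:
  fixes p :: real
  assumes "0 < p" and "p < 1"
  shows "(\<forall>\<eta>. inner_function \<eta> \<and> \<eta> 0 = 0 \<longrightarrow>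
            (cexp_bounded_Hp p \<eta> \<longleftrightarrow>
             (\<exists>B. finite_blaschke_product B \<and> (\<forall>z\<in>ball 0 1. \<eta> z = B z)))) \<and>
         (\<forall>\<eta>. finite_blaschke_product \<eta> \<and> \<eta> 0 = 0 \<longrightarrow>
            cexp_norm_Hp p \<eta> = cexp_norm_Lp p \<eta> \<and>
            cexp_norm_Lp p \<eta> = ennreal (sup_norm_deriv \<eta> powr (1 / p - 1)))"
proof (intro conjI allI impI)
  fix \<eta> assume \<eta>: "inner_function \<eta> \<and> \<eta> 0 = 0"
  show "cexp_bounded_Hp p \<eta> \<longleftrightarrow> (\<exists>B. finite_blaschke_product B \<and> (\<forall>z\<in>ball 0 1. \<eta> z = B z))"
  proof
    assume "cexp_bounded_Hp p \<eta>"
    then obtain C where C: "cexp_bound p (Hp_space 1) \<eta> C" by (auto simp: cexp_bounded_Hp_def)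
    \<comment> \<open>Boundedness is defined with an arbitrary real constant, while the estimates
      need a nonnegative one.\<close>
    have "cexp_bound p (Hp_space 1) \<eta> \<bar>C\<bar>"
      unfolding cexp_bound_def
    proof
      fix f assume "f \<in> Hp_space 1"
      then have "Lp_norm p (cexp \<eta> f) \<le> C * Lp_norm p f" using C by (simp add: cexp_bound_def)
      also have "\<dots> \<le> \<bar>C\<bar> * Lp_norm p f" by (intro mult_right_mono) (auto simp: Lp_norm_def)
      finally show "Lp_norm p (cexp \<eta> f) \<le> \<bar>C\<bar> * Lp_norm p f" .
    qed
    then have "proper_on_disc \<eta>" using \<eta> assms by (intro bounded_cexp_proper) auto
    then show "\<exists>B. finite_blaschke_product B \<and> (\<forall>z\<in>ball 0 1. \<eta> z = B z)"
      using \<eta> by (intro proper_finite_blaschke) auto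
  next
    assume "\<exists>B. finite_blaschke_product B \<and> (\<forall>z\<in>ball 0 1. \<eta> z = B z)"
    then obtain B where B: "finite_blaschke_product B" "\<And>z. norm z < 1 \<Longrightarrow> \<eta> z = B z" by auto
    then have "B 0 = 0" using \<eta> by (metis norm_zero zero_less_one)
    have eq: "cexp \<eta> = cexp B" by (rule cexp_cong_disc) (rule B(2))
    from cexp_bound_mono[OF finite_blaschke_cexp_bound(1)[OF assms B(1) \<open>B 0 = 0\<close>] Hp_space_subset_Lp_space]
    show "cexp_bounded_Hp p \<eta>"
      unfolding cexp_bounded_Hp_def cexp_bound_def eq by blast
  qed
next
  fix \<eta> assume \<eta>: "finite_blaschke_product \<eta> \<and> \<eta> 0 = 0"
  let ?N = "sup_norm_deriv \<eta> powr (1 / p - 1)"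
  note bounds = finite_blaschke_cexp_bound[OF assms conjunct1[OF \<eta>] conjunct2[OF \<eta>]]
  \<comment> \<open>The upper bound holds on the largest space and the lower bound already on the
    smallest, so one argument evaluates both norms.\<close>
  have Inf_eq: "Inf {ennreal C |C. 0 \<le> C \<and> cexp_bound p X \<eta> C} = ennreal ?N"
    if X: "Hp_space 1 \<subseteq> X" "X \<subseteq> Lp_space 1" for X
  proof (rule antisym)
    show "Inf {ennreal C |C. 0 \<le> C \<and> cexp_bound p X \<eta> C} \<le> ennreal ?N"
      using cexp_bound_mono[OF bounds(1) X(2)] by (intro Inf_lower) auto
    show "ennreal ?N \<le> Inf {ennreal C |C. 0 \<le> C \<and> cexp_bound p X \<eta> C}"
      using bounds(2) cexp_bound_mono[OF _ X(1)] by (intro Inf_greatest) (auto intro!: ennreal_leI)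
  qed
  show "cexp_norm_Lp p \<eta> = ennreal ?N"
    unfolding cexp_norm_Lp_def by (rule Inf_eq[OF Hp_space_subset_Lp_space order_refl])
  then show "cexp_norm_Hp p \<eta> = cexp_norm_Lp p \<eta>"
    unfolding cexp_norm_Hp_def using Inf_eq[OF order_refl Hp_space_subset_Lp_space] by simp
qed

end
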